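(* Let $\mathbb F$ be an arbitrary field. Let $m$, $n$, $r\leq \min\{m,n\}$ be positive integers and $d$ a non negative integer. Let $\gamma_1(s,t)\mid \dots \mid \gamma_r(s,t)$ be monic homogeneous polynomials with coefficients in $\mathbb F$. Let $(d_1, \ldots, d_{n-r})$ and $(v_1, \ldots, v_{m-r})$ be partitions. Then there exists $P(s)\in \mathbb F[s]^{m\times n}$ with $\operatorname{rank}(P(s))= r$, $\deg(P(s))= d$, with homogeneous invariant factors $\gamma_1(s,t), \dots, \gamma_r(s,t)$, column minimal indices $d_1, \dots, d_{n-r}$ and row minimal indices $v_1, \dots, v_{m-r}$, if and only if $$\gamma_1(s,0)\neq 0$$ and $$\sum_{i=1}^r \deg(\gamma_i)+\sum_{i=1}^{n-r} d_i+\sum_{i=1}^{m-r} v_i=rd.$$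
   Context: A homogeneous polynomial $\gamma\in\mathbb F[s,t]$ is called monic if it is monic with respect to $s$, i.e. $\gamma(s,1)$ is monic; equivalently $\gamma(s,t)=t^{e}t^{\deg(\alpha)}\alpha(s/t)$ with $e\ge 0$ and $\alpha\in\mathbb F[s]$ monic. A partition is a finite non-increasing sequence of non negative integers (possibly empty). Empty sums are $0$. Let $P(s)=P_ds^d+\dots+P_1s+P_0\in\mathbb F[s]^{m\times n}$ with $P_i\in\mathbb F^{m\times n}$ and $P_d\ne0$; then $\deg(P(s))=d$. $\operatorname{rank}(P(s))$ is the rank of $P(s)$ over the field $\mathbb F(s)$. The reversal is $\operatorname{rev}P(t)=t^dP(1/t)=P_d+P_{d-1}t+\dots+P_0t^d$. With $r=\operatorname{rank}(P(s))$, the invariant factors $\alpha_1(s)\mid\dots\mid\alpha_r(s)$ of $P(s)$ are the monic nonzero diagonal entries of its Smith form. The partial multiplicities of $\infty$ in $P(s)$, $0\le e_1\leq\dots\leq e_r$, are the exponents with which $t$ divides the successive invariant factors of $\operatorname{rev}P(t)$ (which also has rank $r$). The homogeneous invariant factors of $P(s)$ are $t^{e_i}t^{\deg(\alpha_i)}\alpha_i(s/t)$, $1\le i\le r$. The column (resp. row) minimal indices of $P(s)$ are the minimal indices of $\mathcal N_r(P)=\{x\in\mathbb F(s)^{n}:P(s)x=0\}$ (resp. $\mathcal N_\ell(P)=\{x\in\mathbb F(s)^{m}:x^TP(s)=0\}$), that is, the degrees of the vectors in a minimal basis (a basis of polynomial vectors with least possible sum of degrees among all polynomial bases), listed in non-increasing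 order. There are $n-r$ column and $m-r$ row minimal indices. *)

theory Defs
  imports
    "Jordan_Normal_Form.DL_Rank"
    "Jordan_Normal_Form.Matrix_Kernel"
begin

section \<open>Homogeneous polynomials in two variables\<close>

text \<open>The ring \<open>F[s,t]\<close> is represented by \<^typ>\<open>'a poly poly\<close>: the outer variable is \<open>t\<close>, the
  inner one is \<open>s\<close>. So the coefficient of \<open>s^i t^j\<close> in \<open>f\<close> is \<open>coeff (coeff f j) i\<close>, and for a
  constant \<open>c\<close> the polynomial \<open>f(s,c)\<close> is \<open>poly f [:c:]\<close>; in particular \<open>f(s,0)\<close> is \<open>poly f 0\<close>
  and \<open>f(s,1)\<close> is \<open>poly f 1\<close>.\<close>

definition bivar_support :: "'a::zero poly poly \<Rightarrow> (nat \<times> nat) set" where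
  "bivar_support f = {(i, j). coeff (coeff f j) i \<noteq> 0}"

text \<open>Total degree in \<open>s\<close> and \<open>t\<close>; only meaningful for \<open>f \<noteq> 0\<close>.\<close>

definition total_degree :: "'a::zero poly poly \<Rightarrow> nat" where
  "total_degree f = Max ((\<lambda>(i, j). i + j) ` bivar_support f)"

definition homogeneous :: "'a::zero poly poly \<Rightarrow> bool" where
  "homogeneous f \<longleftrightarrow> (\<exists>k. \<forall>(i, j) \<in> bivar_support f. i + j = k)"

definition monic_homogeneous :: "'a::field poly poly \<Rightarrow> bool" where
  "monic_homogeneous f \<longleftrightarrow> homogeneous f \<and> lead_coeff (poly f 1) = 1"

text \<open>\<open>t^(deg p) p(s/t)\<close>, with the powers of \<open>t\<close> cleared.\<close>

definition homogenize :: "'a::comm_monoid_add poly \<Rightarrow> 'a poly poly" where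
  "homogenize p = (\<Sum>i\<le>degree p. monom (monom (coeff p i) i) (degree p - i))"

section \<open>Degree, rank and reversal of a polynomial matrix\<close>

text \<open>A zero polynomial has degree \<open>0\<close> here, so a zero matrix has degree \<open>0\<close>. For nonzero \<open>P\<close>
  the value is the largest \<open>d\<close> for which the matrix coefficient of \<open>s^d\<close> does not vanish.\<close>

definition mat_degree :: "'a::zero poly mat \<Rightarrow> nat" where
  "mat_degree P = Max (degree ` elements_mat P)"

definition rat_mat :: "'a::field poly mat \<Rightarrow> 'a poly fract mat" where
  "rat_mat P = map_mat to_fract P"

definition poly_rank :: "'a::field poly mat \<Rightarrow> nat" where
  "poly_rank P = vec_space.rank (dim_row P) (rat_mat P)"

definition mat_reversal :: "'a::comm_monoid_add poly mat \<Rightarrow> 'a poly mat" where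
  "mat_reversal P =
     (let d = mat_degree P in map_mat (\<lambda>p. \<Sum>i\<le>d. monom (coeff p (d - i)) i) P)"

section \<open>Smith form and invariant factors\<close>

definition diag_entries :: "'a mat \<Rightarrow> 'a list" where
  "diag_entries A = map (\<lambda>i. A $$ (i, i)) [0..<min (dim_row A) (dim_col A)]"

text \<open>Since \<open>0\<close> divides only \<open>0\<close>, the divisibility chain places the zero diagonal entries last.\<close>

definition smith_form :: "'a::field poly mat \<Rightarrow> 'a poly mat \<Rightarrow> bool" where
  "smith_form P S \<longleftrightarrow>
     (\<exists>U V. U \<in> carrier_mat (dim_row P) (dim_row P) \<and> invertible_mat U \<and>
            V \<in> carrier_mat (dim_col P) (dim_col P) \<and> invertible_mat V \<and>
            S = U * P * V) \<and>
     diagonal_mat S \<and>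
     (\<forall>p \<in> set (diag_entries S). p \<noteq> 0 \<longrightarrow> lead_coeff p = 1) \<and>
     successively (dvd) (diag_entries S)"

definition invariant_factors :: "'a::field poly mat \<Rightarrow> 'a poly list \<Rightarrow> bool" where
  "invariant_factors P \<alpha>s \<longleftrightarrow>
     (\<exists>S. smith_form P S \<and> \<alpha>s = filter (\<lambda>p. p \<noteq> 0) (diag_entries S))"

text \<open>For \<open>p \<noteq> 0\<close>, \<open>order 0 p\<close> is the largest \<open>e\<close> such that \<open>t^e\<close> divides \<open>p(t)\<close>.\<close>

definition partial_multiplicities_infinity :: "'a::field poly mat \<Rightarrow> nat list \<Rightarrow> bool" where
  "partial_multiplicities_infinity P es \<longleftrightarrow>
     (\<exists>\<beta>s. invariant_factors (mat_reversal P) \<beta>s \<and> es = map (order 0) \<beta>s)"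

definition homogeneous_invariant_factors :: "'a::field poly mat \<Rightarrow> 'a poly poly list \<Rightarrow> bool" where
  "homogeneous_invariant_factors P \<gamma>s \<longleftrightarrow>
     (\<exists>\<alpha>s es. invariant_factors P \<alpha>s \<and> partial_multiplicities_infinity P es \<and>
        length es = length \<alpha>s \<and>
        \<gamma>s = map2 (\<lambda>\<alpha> e. monom 1 e * homogenize \<alpha>) \<alpha>s es)"

section \<open>Minimal bases and minimal indices\<close>

definition vec_degree :: "'a::zero poly vec \<Rightarrow> nat" where
  "vec_degree v = Max (degree ` set\<^sub>v v)"

text \<open>Here \<open>W\<close> is a subspace of \<open>F(s)^k\<close>, and the polynomial vectors in the list \<open>xs\<close> form a basis
  of \<open>W\<close> over \<open>F(s)\<close>.\<close>

definition polynomial_basis ::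
    "nat \<Rightarrow> 'a::field poly fract vec set \<Rightarrow> 'a poly vec list \<Rightarrow> bool" where
  "polynomial_basis k W xs \<longleftrightarrow>
     distinct xs \<and> set xs \<subseteq> carrier_vec k \<and>
     vectorspace.basis class_ring (module_vec TYPE('a poly fract) k\<lparr>carrier := W\<rparr>)
       (map_vec to_fract ` set xs)"

definition minimal_basis ::
    "nat \<Rightarrow> 'a::field poly fract vec set \<Rightarrow> 'a poly vec list \<Rightarrow> bool" where
  "minimal_basis k W xs \<longleftrightarrow>
     polynomial_basis k W xs \<and>
     (\<forall>ys. polynomial_basis k W ys \<longrightarrow>
        sum_list (map vec_degree xs) \<le> sum_list (map vec_degree ys))"

definition minimal_indices :: "nat \<Rightarrow> 'a::field poly fract vec set \<Rightarrow> nat list \<Rightarrow> bool" where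
  "minimal_indices k W ds \<longleftrightarrow>
     (\<exists>xs. minimal_basis k W xs \<and> ds = rev (sort (map vec_degree xs)))"

text \<open>\<open>mat_of_row x\<close> is the row \<open>x^T\<close>.\<close>

definition left_kernel :: "'a::comm_ring_1 mat \<Rightarrow> 'a vec set" where
  "left_kernel A = {x \<in> carrier_vec (dim_row A). mat_of_row x * A = 0\<^sub>m 1 (dim_col A)}"

definition column_minimal_indices :: "'a::field poly mat \<Rightarrow> nat list \<Rightarrow> bool" where
  "column_minimal_indices P ds \<longleftrightarrow> minimal_indices (dim_col P) (mat_kernel (rat_mat P)) ds"

definition row_minimal_indices :: "'a::field poly mat \<Rightarrow> nat list \<Rightarrow> bool" where
  "row_minimal_indices P vs \<longleftrightarrow> minimal_indices (dim_row P) (left_kernel (rat_mat P)) vs"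

end

theory Submission
  imports Defs "Jordan_Normal_Form.Char_Poly" "HOL-Computational_Algebra.Formal_Laurent_Series"
begin

text \<open>The theorem is a statement about maps between vector bundles on the projective line, and the proof
is the bundle argument written with matrices. Put \<open>t = 1/s\<close>. A matrix \<open>P(s)\<close> of degree \<open>d\<close> is a
map from \<open>O(-d)^n\<close> to \<open>O^m\<close>; in the chart with coordinate \<open>s\<close> it is \<open>P(s)\<close>, in the chart with
coordinate \<open>t\<close> it is \<open>Q(t) = t^d P(1/t)\<close>, the reversal. The homogeneous invariant factors describe
the torsion of the cokernel, and the minimal indices are the splitting types of the kernels of
\<open>P\<close> and \<open>P^T\<close>. Both charts are compared in the field of formal Laurent series in \<open>t\<close>,
where the order of vanishing at \<open>t = 0\<close> is a valuation.

Necessity. Take Smith decompositions \<open>U P V = diag \<alpha>\<close> over \<open>F[s]\<close> and \<open>W Q Z = diag \<beta>\<close> over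
\<open>F[t]\<close>. The transition matrices \<open>X = W(t) U(1/t)^(-1)\<close> and \<open>Y = V(1/t)^(-1) Z(t)\<close> satisfy
\<open>X t^d diag(\<alpha>(1/t)) Y = diag(\<beta>(t))\<close>. Hence they are block triangular, their determinants have
order \<open>0\<close>, and comparing the orders of the determinants of the upper blocks gives \<open>index_identity\<close>:
the degrees of the homogeneous invariant factors plus the orders of the determinants of the two
lower blocks add up to \<open>r d\<close>. The lower block of \<open>Y\<close> is the transition matrix of the kernel bundle.
Every polynomial basis of the kernel has a sum of degrees at least the order of its determinant
(\<open>kernel_degree_formula\<close>), and a column reduced basis attains it (\<open>column_reduction\<close>),
so this order is the sum of the minimal indices (\<open>minimal_basis_iff\<close>).

Sufficiency. The argument is run backwards: two transition matrices that satisfy the gluing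
equation, and each of which factors into an invertible matrix over \<open>F[t]\<close> times an invertible matrix
over \<open>F[1/t]\<close>, define \<open>P\<close> and its reversal together with their Smith decompositions. Let \<open>g i\<close> be the
degrees of the homogeneous invariant factors. The first transition matrix gets the diagonal
exponents \<open>g i + b i - d\<close> and then the row minimal indices; the second one, which is the inverse of
\<open>Y\<close>, gets \<open>b i\<close> and then the negatives of the column minimal indices. Here \<open>b i\<close> distributes the sum of the column
minimal indices over those \<open>i\<close> with \<open>g i \<le> d\<close>. The degree condition says precisely that both lists of
exponents have sum \<open>0\<close>. The key lemma \<open>extension_gluing_exists\<close> then supplies off-diagonal
entries that make such a matrix factor; they only lead from a column with positive to a row
with negative exponent, so that on the torsion part they go from a factor of degree
more than \<open>d\<close> to one of degree less than \<open>d\<close>, and divisibility of the factors makes the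
gluing equation solvable (\<open>gluing_construction\<close>). No element of the field with special properties
is ever chosen, and no point of the line has to avoid the zeros of the factors; this is why finite
fields cause no difficulty. The construction bounds the degrees of two kernel bases by the
prescribed indices; since the index identity bounds the two sums from below by the same total,
the bases are minimal and the bounds are equalities (\<open>minimal_indicesI\<close>).\<close>

section \<open>Polynomials evaluated at t and at 1/t\<close>

text \<open>Both charts live in the field of Laurent series in \<open>t\<close>: a polynomial in \<open>t\<close> is evaluated at
\<open>x = t\<close>, a polynomial in \<open>s\<close> at \<open>x = 1/t\<close>. Keeping \<open>x\<close> as a parameter makes the exchange
of the charts the substitution of \<open>inverse x\<close> for \<open>x\<close>.\<close>

definition leval :: "'a::field fls \<Rightarrow> 'a poly \<Rightarrow> 'a fls" where
  "leval x p = poly (map_poly fls_const p) x"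

lemma fls_const_hom: "comm_ring_hom (fls_const :: 'a::field \<Rightarrow> 'a fls)"
  by unfold_locales (simp_all add: fls_plus_const)

lemma leval_hom: "comm_ring_hom (leval x :: 'a::field poly \<Rightarrow> 'a fls)"
proof -
  interpret c: comm_ring_hom "fls_const :: 'a \<Rightarrow> 'a fls" by (rule fls_const_hom)
  interpret m: map_poly_comm_ring_hom "fls_const :: 'a \<Rightarrow> 'a fls" ..
  show ?thesis
    by unfold_locales (simp_all add: leval_def m.hom_add m.hom_mult)
qed

global_interpretation leval: comm_ring_hom "leval x :: 'a::field poly \<Rightarrow> 'a fls" for x
  by (rule leval_hom)

lemma leval_monom: "leval x (monom c k) = fls_const c * x ^ k"
proof -
  interpret c: comm_ring_hom "fls_const :: 'a \<Rightarrow> 'a fls" by (rule fls_const_hom)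
  show ?thesis by (simp add: leval_def poly_monom)
qed

lemma leval_const [simp]: "leval x [:c:] = fls_const c"
  using leval_monom[of x c 0] by (simp add: monom_0)

lemma leval_X [simp]: "leval x (monom 1 k) = x ^ k"
  by (simp add: leval_monom)

lemma leval_altdef: "leval x p = (\<Sum>i\<le>degree p. fls_const (coeff p i) * x ^ i)"
proof -
  have "leval x p = leval x (\<Sum>i\<le>degree p. monom (coeff p i) i)"
    by (simp add: poly_as_sum_of_monoms)
  then show ?thesis by (simp add: leval.hom_sum leval_monom)
qed

lemma fls_const_mult_powi_nth:
  "fls_nth (fls_const c * fls_X powi k) n = (if n = k then c else (0::'a::field))"
  by (simp add: fls_X_power_int)

lemma inverse_fls_X_power: "(inverse fls_X :: 'a::field fls) ^ i = fls_X powi (- int i)"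
  by (simp only: power_int_minus power_int_of_nat power_inverse)

lemma leval_X_nth: "fls_nth (leval fls_X p) n = (if n \<ge> 0 then coeff p (nat n) else (0::'a::field))"
proof -
  have "fls_nth (leval fls_X p) n = (\<Sum>i\<le>degree p. if n = int i then coeff p i else 0)"
    unfolding leval_altdef fls_nth_sum
    by (intro sum.cong refl) (use fls_const_mult_powi_nth[of _ "int _"] in \<open>simp add: \<close>)
  also have "\<dots> = (if n \<ge> 0 then coeff p (nat n) else 0)"
  proof (cases "n \<ge> 0")
    case True
    then obtain k where [simp]: "n = int k" by (metis nonneg_int_cases)
    show ?thesis by (auto simp: coeff_eq_0)
  qed auto
  finally show ?thesis .
qed

lemma leval_inv_X_nth:
  "fls_nth (leval (inverse fls_X) p) n = (if n \<le> 0 then coeff p (nat (-n)) else (0::'a::field))"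
proof -
  have "fls_nth (leval (inverse fls_X) p) n = (\<Sum>i\<le>degree p. if n = - int i then coeff p i else 0)"
    unfolding leval_altdef fls_nth_sum inverse_fls_X_power fls_const_mult_powi_nth ..
  also have "\<dots> = (if n \<le> 0 then coeff p (nat (-n)) else 0)"
  proof (cases "n \<le> 0")
    case True
    then obtain k where [simp]: "n = - int k" by (metis minus_minus neg_0_le_iff_le nonneg_int_cases)
    show ?thesis by (auto simp: coeff_eq_0)
  qed auto
  finally show ?thesis .
qed

lemma leval_X_inj: "leval fls_X p = leval fls_X q \<longleftrightarrow> p = (q :: 'a::field poly)"
proof
  assume eq: "leval fls_X p = leval fls_X q"
  show "p = q"
    by (rule poly_eqI) (use leval_X_nth[of p "int _"] leval_X_nth[of q "int _"] eq in simp)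
qed simp

lemma leval_inv_X_inj: "leval (inverse fls_X) p = leval (inverse fls_X) q \<longleftrightarrow> p = (q :: 'a::field poly)"
proof
  assume eq: "leval (inverse fls_X) p = leval (inverse fls_X) q"
  show "p = q"
    by (rule poly_eqI) (use leval_inv_X_nth[of p "- int _"] leval_inv_X_nth[of q "- int _"] eq in simp)
qed simp

lemma leval_X_eq_0_iff [simp]: "leval fls_X p = 0 \<longleftrightarrow> p = (0 :: 'a::field poly)"
  using leval_X_inj[of p 0] by simp

lemma leval_inv_X_eq_0_iff [simp]: "leval (inverse fls_X) p = 0 \<longleftrightarrow> p = (0 :: 'a::field poly)"
  using leval_inv_X_inj[of p 0] by simp

text \<open>The pole order of \<open>p(1/t)\<close> at \<open>t = 0\<close> is the degree of \<open>p\<close>; this is how degrees over \<open>F[s]\<close> and orders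
over \<open>F[t]\<close> become values of one valuation.\<close>

lemma subdegree_leval_inv_X: "fls_subdegree (leval (inverse fls_X) (p :: 'a::field poly)) = - int (degree p)"
proof (cases "p = 0")
  case False
  show ?thesis
    by (rule fls_subdegree_eqI) (use False in \<open>auto simp: leval_inv_X_nth intro!: coeff_eq_0\<close>)
qed simp

lemma subdegree_leval_X: 
  assumes "p \<noteq> (0 :: 'a::field poly)"
  shows "fls_subdegree (leval fls_X p) = int (order 0 p)"
proof -
  from order_decomp[OF assms, of 0] obtain q where q: "p = [:0,1:] ^ order 0 p * q" "\<not> [:0,1:] dvd q"
    by auto
  have c: "coeff q 0 \<noteq> 0" using q(2) by (metis dvd_iff_poly_eq_0 minus_zero poly_0_coeff_0)
  have "fls_subdegree (leval fls_X q) = 0"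
    by (rule fls_subdegree_eqI) (use c in \<open>auto simp: leval_X_nth\<close>)
  moreover have "leval fls_X p = fls_X ^ order 0 p * leval fls_X q"
    by (subst q(1)) (simp add: leval.hom_mult leval.hom_power x_as_monom)
  moreover have "leval fls_X q \<noteq> 0" using c by auto
  ultimately show ?thesis by simp
qed

section \<open>Unimodular matrices, shears and factorizations over the two charts\<close>

definition unimod :: "nat \<Rightarrow> 'a::comm_ring_1 mat \<Rightarrow> bool" where
  "unimod n G \<longleftrightarrow> G \<in> carrier_mat n n \<and> invertible_mat G"

lemma unimod_carrier [dest]: "unimod n G \<Longrightarrow> G \<in> carrier_mat n n"
  by (simp add: unimod_def)

lemma unimodI:
  assumes "G \<in> carrier_mat n n" "H \<in> carrier_mat n n" "G * H = 1\<^sub>m n" "H * G = 1\<^sub>m n"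
  shows "unimod n G"
  using assms by (auto simp: unimod_def invertible_mat_def inverts_mat_def)

lemma unimodE:
  assumes "unimod n G"
  obtains H where "H \<in> carrier_mat n n" "G * H = 1\<^sub>m n" "H * G = 1\<^sub>m n" "unimod n H"
proof -
  have G: "G \<in> carrier_mat n n" using assms by auto
  from assms obtain H where H: "G * H = 1\<^sub>m (dim_row G)" "H * G = 1\<^sub>m (dim_row H)"
    by (auto simp: unimod_def invertible_mat_def inverts_mat_def)
  have "dim_col H = n" using arg_cong[OF H(1), of dim_col] G by simp
  moreover have "dim_row H = n" using arg_cong[OF H(2), of dim_col] G by simp
  ultimately have "H \<in> carrier_mat n n" by auto
  moreover have "G * H = 1\<^sub>m n" "H * G = 1\<^sub>m n" using H G \<open>H \<in> carrier_mat n n\<close> by auto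
  ultimately show ?thesis using that unimodI[of H n G] G by auto
qed

lemma unimod_one: "unimod n (1\<^sub>m n)"
  by (rule unimodI[of _ _ "1\<^sub>m n"]) auto

lemma mult_inverse_pairs:
  fixes G :: "'a::comm_ring_1 mat"
  assumes "G \<in> carrier_mat n n" "G' \<in> carrier_mat n n" "H \<in> carrier_mat n n" "H' \<in> carrier_mat n n"
    and "G * G' = 1\<^sub>m n" "H * H' = 1\<^sub>m n"
  shows "(G * H) * (H' * G') = 1\<^sub>m n"
proof -
  have "(G * H) * (H' * G') = G * ((H * H') * G')"
    using assms(1-4) by (simp add: assoc_mult_mat[of _ n n _ n _ n])
  then show ?thesis using assms by simp
qed

lemma unimod_mult:
  assumes "unimod n G" "unimod n H"
  shows "unimod n (G * H)"
proof -
  from assms(1) obtain G' where G': "G' \<in> carrier_mat n n" "G * G' = 1\<^sub>m n" "G' * G = 1\<^sub>m n"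
    by (rule unimodE)
  from assms(2) obtain H' where H': "H' \<in> carrier_mat n n" "H * H' = 1\<^sub>m n" "H' * H = 1\<^sub>m n"
    by (rule unimodE)
  have c: "G \<in> carrier_mat n n" "H \<in> carrier_mat n n" using assms by auto
  show ?thesis
    by (rule unimodI[of _ _ "H' * G'"]) (use c G' H' mult_inverse_pairs in auto)
qed

lemma unimod_transpose:
  assumes "unimod n G"
  shows "unimod n (transpose_mat G)"
proof -
  from assms obtain H where H: "H \<in> carrier_mat n n" "G * H = 1\<^sub>m n" "H * G = 1\<^sub>m n"
    by (rule unimodE)
  have G: "G \<in> carrier_mat n n" using assms by auto
  show ?thesis
  proof (rule unimodI[of _ _ "transpose_mat H"])
    show "transpose_mat G * transpose_mat H = 1\<^sub>m n"
      using H G transpose_mult[of H n n G n] by (metis transpose_one)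
    show "transpose_mat H * transpose_mat G = 1\<^sub>m n"
      using H G transpose_mult[of G n n H n] by (metis transpose_one)
  qed (use H G in auto)
qed

text \<open>The identity plus a block with rows in \<open>A\<close> and columns outside \<open>A\<close>. That block has square zero, so
the matrix is unimodular and its inverse has the opposite block.\<close>

definition block_shear :: "nat \<Rightarrow> nat set \<Rightarrow> (nat \<Rightarrow> nat \<Rightarrow> 'a::comm_ring_1) \<Rightarrow> 'a mat" where
  "block_shear n A f = mat n n (\<lambda>(a, b). (if a = b then 1 else 0) + (if a \<in> A \<and> b \<notin> A then f a b else 0))"

lemma block_shear_carrier [simp]: "block_shear n A f \<in> carrier_mat n n"
  and dim_row_block_shear [simp]: "dim_row (block_shear n A f) = n"
  and dim_col_block_shear [simp]: "dim_col (block_shear n A f) = n"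
  by (simp_all add: block_shear_def)

lemma index_block_shear_mult:
  assumes "M \<in> carrier_mat n n" "a < n" "b < n"
  shows "(block_shear n A f * M) $$ (a, b) = M $$ (a, b) + (if a \<in> A then \<Sum>k\<in>{..<n}-A. f a k * M $$ (k, b) else 0)"
proof -
  have "(block_shear n A f * M) $$ (a, b) =
     (\<Sum>k<n. ((if a = k then 1 else 0) + (if a \<in> A \<and> k \<notin> A then f a k else 0)) * M $$ (k, b))"
    using assms by (simp add: block_shear_def scalar_prod_def lessThan_atLeast0)
  also have "\<dots> = (\<Sum>k<n. (if k = a then M $$ (k, b) else 0)) +
                   (\<Sum>k<n. if k \<notin> A then (if a \<in> A then f a k * M $$ (k, b) else 0) else 0)"
    unfolding sum.distrib[symmetric] by (intro sum.cong) (auto simp: algebra_simps)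
  also have "(\<Sum>k<n. if k \<notin> A then (if a \<in> A then f a k * M $$ (k, b) else 0) else 0)
           = (\<Sum>k\<in>{..<n}-A. (if a \<in> A then f a k * M $$ (k, b) else 0))"
    by (rule sum.mono_neutral_cong_right) auto
  finally show ?thesis using assms by (auto simp: sum.delta)
qed

lemma index_mult_block_shear:
  assumes "M \<in> carrier_mat l n" "a < l" "b < n"
  shows "(M * block_shear n A f) $$ (a, b) = M $$ (a, b) + (if b \<notin> A then \<Sum>k\<in>{..<n}\<inter>A. M $$ (a, k) * f k b else 0)"
proof -
  have "(M * block_shear n A f) $$ (a, b) =
     (\<Sum>k<n. M $$ (a, k) * ((if k = b then 1 else 0) + (if k \<in> A \<and> b \<notin> A then f k b else 0)))"
    using assms by (simp add: block_shear_def scalar_prod_def lessThan_atLeast0)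
  also have "\<dots> = (\<Sum>k<n. (if k = b then M $$ (a, k) else 0)) +
                   (\<Sum>k<n. if k \<in> A then (if b \<notin> A then M $$ (a, k) * f k b else 0) else 0)"
    unfolding sum.distrib[symmetric] by (intro sum.cong) (auto simp: algebra_simps)
  also have "(\<Sum>k<n. if k \<in> A then (if b \<notin> A then M $$ (a, k) * f k b else 0) else 0)
           = (\<Sum>k\<in>{..<n}\<inter>A. (if b \<notin> A then M $$ (a, k) * f k b else 0))"
    by (rule sum.mono_neutral_cong_right) auto
  finally show ?thesis using assms by (auto simp: sum.delta)
qed

lemma unimod_block_shear: "unimod n (block_shear n A f)"
proof -
  have *: "block_shear n A f * block_shear n A (\<lambda>a b. - f a b) = 1\<^sub>m n" for f :: "nat \<Rightarrow> nat \<Rightarrow> 'a"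
  proof (rule eq_matI)
    fix a b assume "a < dim_row (1\<^sub>m n)" "b < dim_col (1\<^sub>m n)"
    then have ab: "a < n" "b < n" by auto
    have "(\<Sum>k\<in>{..<n}-A. f a k * block_shear n A (\<lambda>a b. - f a b) $$ (k, b)) = (\<Sum>k\<in>{..<n}-A. if k = b then f a b else 0)"
      using ab by (intro sum.cong) (auto simp: block_shear_def)
    also have "\<dots> = (if b \<notin> A then f a b else 0)" using ab by (simp add: sum.delta)
    finally show "(block_shear n A f * block_shear n A (\<lambda>a b. - f a b)) $$ (a, b) = 1\<^sub>m n $$ (a, b)"
      unfolding index_block_shear_mult[OF block_shear_carrier ab]
      using ab by (auto simp: block_shear_def)
  qed auto
  show ?thesis
    using *[of f] *[of "\<lambda>a b. - f a b"] by (intro unimodI[of _ _ "block_shear n A (\<lambda>a b. - f a b)"]) simp_all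
qed

text \<open>Multiplication from the left adds multiples of row \<open>i\<close> to the other rows; multiplication from the right
adds multiples of the other columns to column \<open>i\<close>.\<close>

abbreviation shear :: "nat \<Rightarrow> nat \<Rightarrow> (nat \<Rightarrow> 'a::comm_ring_1) \<Rightarrow> 'a mat" where
  "shear n i f \<equiv> block_shear n (- {i}) (\<lambda>a _. f a)"

lemma index_shear_mult:
  assumes "M \<in> carrier_mat n n" "a < n" "b < n" "i < n"
  shows "(shear n i f * M) $$ (a, b) = M $$ (a, b) + (if a = i then 0 else f a * M $$ (i, b))"
proof -
  have "{..<n} - - {i} = {i}" using assms by auto
  then show ?thesis by (simp add: index_block_shear_mult[OF assms(1-3)] del: index_mult_mat(1))
qed

lemma index_mult_shear:
  assumes "M \<in> carrier_mat l n" "a < l" "b < n" "i < n"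
  shows "(M * shear n i f) $$ (a, b) =
           M $$ (a, b) + (if b = i then \<Sum>k\<in>{..<n}-{i}. M $$ (a, k) * f k else 0)"
proof -
  have "{..<n} \<inter> - {i} = {..<n} - {i}" by auto
  then show ?thesis by (simp add: index_mult_block_shear[OF assms(1-3)] del: index_mult_mat(1))
qed

definition laurent :: "'a::field fls \<Rightarrow> 'a fls \<Rightarrow> bool" where
  "laurent x f \<longleftrightarrow> (\<exists>p k. f = leval x p * x powi k)"

lemma laurent_add:
  assumes "x \<noteq> 0" "laurent x f" "laurent x g"
  shows "laurent x (f + g)"
proof -
  from assms(2,3) obtain p k q l where f: "f = leval x p * x powi k" and g: "g = leval x q * x powi l"
    by (auto simp: laurent_def)
  define m where "m = min k l"
  have "x powi k = x ^ nat (k - m) * x powi m" "x powi l = x ^ nat (l - m) * x powi m"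
    using assms(1) by (auto simp: m_def power_int_add[symmetric] simp flip: power_int_of_nat)
  then have "f + g = leval x (p * monom 1 (nat (k - m)) + q * monom 1 (nat (l - m))) * x powi m"
    unfolding f g by (simp add: leval.hom_add leval.hom_mult algebra_simps)
  then show ?thesis by (auto simp: laurent_def)
qed

lemma laurent_mult:
  assumes "x \<noteq> 0" "laurent x f" "laurent x g"
  shows "laurent x (f * g)"
proof -
  from assms(2,3) obtain p k q l where f: "f = leval x p * x powi k" and g: "g = leval x q * x powi l"
    by (auto simp: laurent_def)
  have "f * g = leval x (p * q) * x powi (k + l)"
    using assms(1) by (simp add: f g leval.hom_mult power_int_add)
  then show ?thesis by (auto simp: laurent_def)
qed

lemma laurent_leval: "laurent x (leval x p)"
  unfolding laurent_def by (rule exI[of _ p], rule exI[of _ 0]) simp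

lemma laurent_powi: "laurent x (x powi k)"
  by (auto simp: laurent_def intro!: exI[of _ 1] exI[of _ k])

lemma laurent_0: "laurent x 0"
  unfolding laurent_def by (rule exI[of _ 0]) simp

lemma laurent_sum: "x \<noteq> 0 \<Longrightarrow> (\<And>i. i \<in> A \<Longrightarrow> laurent x (f i)) \<Longrightarrow> laurent x (sum f A)"
  by (induction A rule: infinite_finite_induct) (auto intro: laurent_add laurent_0)

lemma laurent_leval_inverse:
  assumes "x \<noteq> 0"
  shows "laurent x (leval (inverse x) p)"
proof -
  have "laurent x (fls_const c * inverse x ^ i)" for c i
    using laurent_mult[OF assms laurent_leval[of x "[:c:]"] laurent_powi[of x "- int i"]]
    by (simp add: power_int_minus power_inverse)
  then show ?thesis
    unfolding leval_altdef[of "inverse x"] by (intro laurent_sum assms)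
qed

text \<open>This is the vanishing of the first cohomology of a line bundle of degree at least \<open>-1\<close>: each
monomial has an exponent at most \<open>a\<close> or at least \<open>b\<close>. All eliminations below use it.\<close>

lemma laurent_split:
  assumes "x \<noteq> 0" "laurent x f" "b \<le> a + 1"
  shows "\<exists>g h. f = leval (inverse x) g * x powi a + leval x h * x powi b"
proof -
  define Q where "Q f \<longleftrightarrow> (\<exists>g h. f = leval (inverse x) g * x powi a + leval x h * x powi b)" for f
  have Q0: "Q 0" unfolding Q_def by (rule exI[of _ 0])+ auto
  have Qadd: "Q (f + f')" if "Q f" "Q f'" for f f'
  proof -
    from that obtain g h g' h' where "f = leval (inverse x) g * x powi a + leval x h * x powi b"
       "f' = leval (inverse x) g' * x powi a + leval x h' * x powi b" by (auto simp: Q_def)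
    then have "f + f' = leval (inverse x) (g + g') * x powi a + leval x (h + h') * x powi b"
      by (simp add: leval.hom_add algebra_simps)
    then show ?thesis unfolding Q_def by blast
  qed
  have Qsum: "(\<And>i. i \<in> A \<Longrightarrow> Q (F i)) \<Longrightarrow> Q (sum F A)" for F and A :: "nat set"
    by (induction A rule: infinite_finite_induct) (auto intro: Qadd Q0)
  have Qmonom: "Q (fls_const c * x powi j)" for c j
  proof (cases "j \<le> a")
    case True
    have "leval (inverse x) (monom c (nat (a - j))) * x powi a
        = fls_const c * (x powi (- (a - j)) * x powi a)"
      using True by (simp add: leval_monom power_int_def)
    also have "x powi (- (a - j)) * x powi a = x powi j"
      using assms(1) by (subst power_int_add[symmetric]) auto
    finally show ?thesis unfolding Q_def by (intro exI[of _ "monom c (nat (a - j))"] exI[of _ 0]) simp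
  next
    case False
    have "leval x (monom c (nat (j - b))) * x powi b
        = fls_const c * (x powi (j - b) * x powi b)"
      using False assms(3) by (simp add: leval_monom power_int_def)
    also have "x powi (j - b) * x powi b = x powi j"
      using assms(1) by (subst power_int_add[symmetric]) auto
    finally show ?thesis unfolding Q_def by (intro exI[of _ "monom c (nat (j - b))"] exI[of _ 0]) simp
  qed
  from assms(2) obtain p k where f: "f = leval x p * x powi k" by (auto simp: laurent_def)
  have "f = (\<Sum>i\<le>degree p. fls_const (coeff p i) * x powi (int i + k))"
    using assms(1) unfolding f leval_altdef sum_distrib_right
    by (simp add: power_int_add algebra_simps)
  then have "Q f" using Qsum[OF Qmonom] by simp
  then show ?thesis by (simp add: Q_def)
qed

text \<open>The transition matrices of the trivial bundle of rank \<open>n\<close>: changes of basis in the two charts turn them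
into the identity.\<close>

definition birkhoff_trivial :: "'a::field fls \<Rightarrow> nat \<Rightarrow> 'a fls mat \<Rightarrow> bool" where
  "birkhoff_trivial x n M \<longleftrightarrow> (\<exists>G H. unimod n G \<and> unimod n H \<and>
     M = map_mat (leval x) G * map_mat (leval (inverse x)) H)"

lemma birkhoff_trivial_carrier: "birkhoff_trivial x n M \<Longrightarrow> M \<in> carrier_mat n n"
  by (auto simp: birkhoff_trivial_def intro!: mult_carrier_mat[of _ n n _ n])

lemma birkhoff_trivial_mult:
  assumes "birkhoff_trivial x n M" "unimod n G" "unimod n H"
  shows "birkhoff_trivial x n (map_mat (leval x) G * M * map_mat (leval (inverse x)) H)"
proof -
  from assms(1) obtain G' H' where GH: "unimod n G'" "unimod n H'"
    "M = map_mat (leval x) G' * map_mat (leval (inverse x)) H'" by (auto simp: birkhoff_trivial_def)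
  have c: "G \<in> carrier_mat n n" "H \<in> carrier_mat n n" "G' \<in> carrier_mat n n" "H' \<in> carrier_mat n n"
    using assms GH by auto
  have "map_mat (leval x) G * M * map_mat (leval (inverse x)) H
      = map_mat (leval x) (G * G') * map_mat (leval (inverse x)) (H' * H)"
    using c unfolding GH(3) leval.mat_hom_mult[OF c(1,3)] leval.mat_hom_mult[OF c(4,2)]
    by (simp add: assoc_mult_mat[of _ n n _ n _ n])
  then show ?thesis unfolding birkhoff_trivial_def using unimod_mult assms GH by blast
qed

lemma birkhoff_trivial_transpose:
  assumes "birkhoff_trivial x n M"
  shows "birkhoff_trivial (inverse x) n (transpose_mat M)"
proof -
  from assms obtain G H where GH: "unimod n G" "unimod n H"
    "M = map_mat (leval x) G * map_mat (leval (inverse x)) H" by (auto simp: birkhoff_trivial_def)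
  have c: "G \<in> carrier_mat n n" "H \<in> carrier_mat n n" using GH by auto
  have "transpose_mat M = map_mat (leval (inverse x)) (transpose_mat H) *
          map_mat (leval (inverse (inverse x))) (transpose_mat G)"
    unfolding GH(3) using c by (subst transpose_mult[of _ n n _ n]) (auto simp: map_mat_transpose)
  then show ?thesis unfolding birkhoff_trivial_def using unimod_transpose GH by blast
qed

lemma birkhoff_trivial_one: "birkhoff_trivial x n (1\<^sub>m n)"
  unfolding birkhoff_trivial_def
  by (rule exI[of _ "1\<^sub>m n"], rule exI[of _ "1\<^sub>m n"]) (simp add: unimod_one leval.mat_hom_one)

lemma birkhoff_trivial_laurent:
  assumes "x \<noteq> 0" "birkhoff_trivial x n M" "i < n" "j < n"
  shows "laurent x (M $$ (i, j))"
proof -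
  from assms obtain G H where GH: "unimod n G" "unimod n H"
    "M = map_mat (leval x) G * map_mat (leval (inverse x)) H" by (auto simp: birkhoff_trivial_def)
  have c: "G \<in> carrier_mat n n" "H \<in> carrier_mat n n" using GH by auto
  show ?thesis unfolding GH(3) using c assms
    by (auto simp: scalar_prod_def intro!: laurent_sum laurent_mult laurent_leval laurent_leval_inverse)
qed

lemma map_block_shear: "map_mat (leval x) (block_shear n A f) = block_shear n A (\<lambda>a b. leval x (f a b))"
  by (rule eq_matI) (auto simp: block_shear_def)

lemma birkhoff_trivial_row_shear:
  assumes "birkhoff_trivial x n M" "i < n"
  shows "birkhoff_trivial x n (mat n n (\<lambda>(a, b).
           M $$ (a, b) + (if a = i then 0 else leval x (f a) * M $$ (i, b))))"
proof -
  have M: "M \<in> carrier_mat n n" using assms birkhoff_trivial_carrier by blast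
  have "birkhoff_trivial x n (shear n i (\<lambda>a. leval x (f a)) * M)"
    using birkhoff_trivial_mult[OF assms(1) unimod_block_shear unimod_one, of "- {i}" "\<lambda>a _. f a"] M
    by (simp add: map_block_shear leval.mat_hom_one)
  also have "shear n i (\<lambda>a. leval x (f a)) * M = mat n n (\<lambda>(a, b).
           M $$ (a, b) + (if a = i then 0 else leval x (f a) * M $$ (i, b)))"
    using M by (intro eq_matI) (auto simp: index_shear_mult[OF M _ _ assms(2)] simp del: index_mult_mat(1))
  finally show ?thesis .
qed

lemma birkhoff_trivial_col_shear:
  assumes "birkhoff_trivial x n M" "i < n"
  shows "birkhoff_trivial x n (mat n n (\<lambda>(a, b).
           M $$ (a, b) + (if b = i then \<Sum>k\<in>{..<n}-{i}. M $$ (a, k) * leval (inverse x) (f k) else 0)))"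
proof -
  have M: "M \<in> carrier_mat n n" using assms birkhoff_trivial_carrier by blast
  have "birkhoff_trivial x n (M * shear n i (\<lambda>a. leval (inverse x) (f a)))"
    using birkhoff_trivial_mult[OF assms(1) unimod_one unimod_block_shear, of "- {i}" "\<lambda>a _. f a"] M
    by (simp add: map_block_shear leval.mat_hom_one)
  also have "M * shear n i (\<lambda>a. leval (inverse x) (f a)) = mat n n (\<lambda>(a, b).
           M $$ (a, b) + (if b = i then \<Sum>k\<in>{..<n}-{i}. M $$ (a, k) * leval (inverse x) (f k) else 0))"
    using M by (intro eq_matI) (auto simp: index_mult_shear[OF M _ _ assms(2)] simp del: index_mult_mat(1))
  finally show ?thesis .
qed

section \<open>Triangular gluing matrices of the trivial bundle\<close>

text \<open>Transition matrices of trivial bundles that are extensions of a sum of line bundles by another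
sum of line bundles: after sorting by the sign of the exponents the matrix is block triangular with
diagonal matrices as diagonal blocks.\<close>

definition extension_gluing :: "'a::field fls \<Rightarrow> nat \<Rightarrow> (nat \<Rightarrow> int) \<Rightarrow> 'a fls mat \<Rightarrow> bool" where
  "extension_gluing x n \<epsilon> M \<longleftrightarrow> birkhoff_trivial x n M \<and> (\<forall>i<n. M $$ (i, i) = x powi \<epsilon> i) \<and>
     (\<forall>i<n. \<forall>j<n. i \<noteq> j \<longrightarrow> M $$ (i, j) \<noteq> 0 \<longrightarrow> \<epsilon> i < 0 \<and> \<epsilon> j > 0)"

text \<open>Transposition interchanges the two factors and hence the two charts. It reduces the case of a
negative sum of the extreme exponents to the case of a nonnegative one.\<close>

lemma extension_gluing_swap:
  assumes "extension_gluing x n \<epsilon> M" "x \<noteq> 0"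
  shows "extension_gluing (inverse x) n (\<lambda>i. - \<epsilon> i) (transpose_mat M)"
proof -
  have M: "M \<in> carrier_mat n n" using assms birkhoff_trivial_carrier by (auto simp: extension_gluing_def)
  show ?thesis
    using assms M birkhoff_trivial_transpose[of x n M] unfolding extension_gluing_def
    by (auto simp: power_int_minus power_int_inverse)
qed

text \<open>Two line bundles of exponents \<open>\<epsilon> i < 0 < \<epsilon> j\<close> can be merged: with the off-diagonal entry \<open>1\<close> their
gluing matrix is equivalent to the one with diagonal exponents \<open>0\<close> and \<open>\<epsilon> i + \<epsilon> j\<close>. The operations that
undo the merging move the old column \<open>j\<close> to column \<open>i\<close>, where no off-diagonal entries are allowed. Since
\<open>\<epsilon> i\<close> is minimal, the entry in row \<open>a\<close> splits into a multiple of \<open>x^(\<epsilon> a)\<close> with coefficient in \<open>F[1/x]\<close>,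
removed by column operations, and a multiple of \<open>x^(\<epsilon> i)\<close> with coefficient in \<open>F[x]\<close>, removed by row
operations, which only create allowed entries in column \<open>j\<close>.\<close>

lemma extension_gluing_step:
  assumes x: "x \<noteq> 0" and ij: "i < n" "j < n" "\<epsilon> i < 0" "\<epsilon> j > 0" "\<epsilon> i + \<epsilon> j \<ge> 0"
    and min: "\<And>a. a < n \<Longrightarrow> \<epsilon> i \<le> \<epsilon> a"
    and good: "extension_gluing x n (\<epsilon>(i := 0, j := \<epsilon> i + \<epsilon> j)) F"
  shows "\<exists>M. extension_gluing x n \<epsilon> M"
proof -
  let ?\<epsilon> = "\<epsilon>(i := 0, j := \<epsilon> i + \<epsilon> j)"
  have neq: "i \<noteq> j" using ij by auto
  have F: "F \<in> carrier_mat n n" using good birkhoff_trivial_carrier by (auto simp: extension_gluing_def)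
  have Fd: "F $$ (a, a) = x powi ?\<epsilon> a" if "a < n" for a
    using good that by (auto simp: extension_gluing_def)
  have Fo: "F $$ (a, b) = 0" if "a < n" "b < n" "a \<noteq> b" "?\<epsilon> a \<ge> 0 \<or> ?\<epsilon> b \<le> 0" for a b
    using good that unfolding extension_gluing_def by (meson not_le)
  have Fii: "F $$ (i, i) = 1" and Fjj: "F $$ (j, j) = x powi (\<epsilon> i + \<epsilon> j)"
    using Fd[of i] Fd[of j] ij neq by auto
  have triv: "birkhoff_trivial x n F" using good by (simp add: extension_gluing_def)
  have col: "birkhoff_trivial x n (mat n n (\<lambda>(a, b). G $$ (a, b) +
              (if b = k then G $$ (a, l) * leval (inverse x) c else 0)))"
    if "birkhoff_trivial x n G" "k < n" "l < n" "k \<noteq> l" for G k l c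
  proof -
    have *: "(\<Sum>m\<in>{..<n}-{k}. G $$ (a, m) * leval (inverse x) (if m = l then c else 0)) =
      G $$ (a, l) * leval (inverse x) c" for a
    proof -
      have "(\<Sum>m\<in>{..<n}-{k}. G $$ (a, m) * leval (inverse x) (if m = l then c else 0)) =
         (\<Sum>m\<in>{..<n}-{k}. if m = l then G $$ (a, l) * leval (inverse x) c else 0)"
        by (intro sum.cong) auto
      then show ?thesis using that by (simp add: sum.delta)
    qed
    show ?thesis using birkhoff_trivial_col_shear[OF that(1,2), of "\<lambda>m. if m = l then c else 0"]
      by (simp only: *)
  qed
  have row: "birkhoff_trivial x n (mat n n (\<lambda>(a, b). G $$ (a, b) +
              (if a = k then leval x c * G $$ (l, b) else 0)))"
    if "birkhoff_trivial x n G" "k < n" "l < n" "k \<noteq> l" for G k l c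
  proof -
    have "mat n n (\<lambda>(a, b). G $$ (a, b) +
            (if a = l then 0 else leval x (if a = k then c else 0) * G $$ (l, b)))
      = mat n n (\<lambda>(a, b). G $$ (a, b) + (if a = k then leval x c * G $$ (l, b) else 0))"
      using that by (intro eq_matI) auto
    then show ?thesis
      using birkhoff_trivial_row_shear[OF that(1,3), of "\<lambda>m. if m = k then c else 0"] by simp
  qed
  \<comment> \<open>three shears replace the columns \<open>(i, j)\<close> by \<open>(- j, i)\<close>; a fourth one creates the diagonal entry of column \<open>i\<close>\<close>
  define F1 where "F1 = mat n n (\<lambda>(a, b). F $$ (a, b) + (if b = j then F $$ (a, i) * leval (inverse x) 1 else 0))"
  have t1: "birkhoff_trivial x n F1" unfolding F1_def by (rule col[OF triv]) (use ij neq in auto)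
  define F2 where "F2 = mat n n (\<lambda>(a, b). F1 $$ (a, b) + (if b = i then F1 $$ (a, j) * leval (inverse x) (-1) else 0))"
  have t2: "birkhoff_trivial x n F2" unfolding F2_def by (rule col[OF t1]) (use ij neq in auto)
  define F3 where "F3 = mat n n (\<lambda>(a, b). F2 $$ (a, b) + (if b = j then F2 $$ (a, i) * leval (inverse x) 1 else 0))"
  have t3: "birkhoff_trivial x n F3" unfolding F3_def by (rule col[OF t2]) (use ij neq in auto)
  define F4 where "F4 = mat n n (\<lambda>(a, b). F3 $$ (a, b) + (if b = i then F3 $$ (a, j) * leval (inverse x) (monom 1 (nat (- \<epsilon> i))) else 0))"
  have t4: "birkhoff_trivial x n F4" unfolding F4_def by (rule col[OF t3]) (use ij neq in auto)
  have F4: "F4 $$ (a, b) = (if b = i then - F $$ (a, j) + F $$ (a, i) * x powi \<epsilon> i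
      else if b = j then F $$ (a, i) else F $$ (a, b))" if "a < n" "b < n" for a b
    using that ij neq unfolding F4_def F3_def F2_def F1_def
    by (auto simp: leval.hom_one leval.hom_uminus power_int_def)
  define F5 where "F5 = mat n n (\<lambda>(a, b). F4 $$ (a, b) + (if a = j then leval x (monom 1 (nat (\<epsilon> j))) * F4 $$ (i, b) else 0))"
  have t5: "birkhoff_trivial x n F5" unfolding F5_def by (rule row[OF t4]) (use ij neq in auto)
  have xj: "x ^ nat (\<epsilon> j) = x powi \<epsilon> j" using ij by (simp add: power_int_def)
  have zero: "F $$ (i, b) = 0" "F $$ (b, i) = 0" if "b < n" "b \<noteq> i" for b
    using Fo[of i b] Fo[of b i] that ij neq by auto
  have zeroj: "F $$ (j, b) = 0" if "b < n" "b \<noteq> j" for b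
    using Fo[of j b] that ij neq by auto
  have F5: "F5 $$ (a, b) =
     (if b = i then if a = i then x powi \<epsilon> i else if a = j then 0 else - F $$ (a, j)
      else if b = j then if a = i then 1 else if a = j then x powi \<epsilon> j else 0
      else if a = i \<or> a = j then 0 else F $$ (a, b))" if "a < n" "b < n" for a b
  proof -
    have "x powi \<epsilon> j * x powi \<epsilon> i = x powi (\<epsilon> i + \<epsilon> j)"
      using x by (simp add: power_int_add mult.commute)
    then show ?thesis
      using that ij neq unfolding F5_def by (auto simp: F4 xj Fii Fjj zero zeroj)
  qed
  \<comment> \<open>The entries inherited from column \<open>j\<close> have to be removed from column \<open>i\<close>; here minimality of \<open>\<epsilon> i\<close> is used.\<close>
  have "\<exists>g h. F $$ (a, j) = leval (inverse x) g * x powi (\<epsilon> a) + leval x h * x powi (\<epsilon> i) \<and>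
          (\<epsilon> a \<ge> 0 \<longrightarrow> g = 0 \<and> h = 0)" if "a < n" "a \<noteq> i" "a \<noteq> j" for a
  proof (cases "\<epsilon> a \<ge> 0")
    case True
    then have "F $$ (a, j) = 0" using Fo[of a j] that ij by auto
    then show ?thesis by (intro exI[of _ 0]) simp
  next
    case False
    have "laurent x (F $$ (a, j))" using birkhoff_trivial_laurent[OF x triv] that ij by auto
    then show ?thesis using False laurent_split[OF x, of "F $$ (a, j)" "\<epsilon> i" "\<epsilon> a"] min[of a] that by auto
  qed
  then obtain g h where gh: "\<And>a. a < n \<Longrightarrow> a \<noteq> i \<Longrightarrow> a \<noteq> j \<Longrightarrow>
       F $$ (a, j) = leval (inverse x) (g a) * x powi (\<epsilon> a) + leval x (h a) * x powi (\<epsilon> i) \<and>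
          (\<epsilon> a \<ge> 0 \<longrightarrow> g a = 0 \<and> h a = 0)"
    by metis
  define g' where "g' a = (if a = j then 0 else g a)" for a
  define h' where "h' a = (if a = j then 0 else h a)" for a
  define F6 where "F6 = mat n n (\<lambda>(a, b). F5 $$ (a, b) +
       (if b = i then \<Sum>k\<in>{..<n}-{i}. F5 $$ (a, k) * leval (inverse x) (g' k) else 0))"
  have t6: "birkhoff_trivial x n F6" unfolding F6_def by (rule birkhoff_trivial_col_shear[OF t5 ij(1)])
  have sum6: "(\<Sum>k\<in>{..<n}-{i}. F5 $$ (a, k) * leval (inverse x) (g' k)) =
     (if a = i \<or> a = j then 0 else leval (inverse x) (g a) * x powi (\<epsilon> a))" if "a < n" for a
  proof -
    have "F5 $$ (a, k) * leval (inverse x) (g' k) =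
       (if k = a then if a = i \<or> a = j then 0 else leval (inverse x) (g a) * x powi (\<epsilon> a) else 0)"
      if k: "k \<in> {..<n}-{i}" for k
    proof (cases "k = j \<or> \<epsilon> k \<ge> 0")
      case True
      then have "g' k = 0" using gh[of k] k by (auto simp: g'_def)
      moreover have "g a = 0" if "k = a" "a \<noteq> i" "a \<noteq> j" using gh[of a] that k True by auto
      ultimately show ?thesis by auto
    next
      case False
      then have "F $$ (a, k) = (if a = k then x powi \<epsilon> a else 0)" if "a \<noteq> i" "a \<noteq> j"
        using Fo[of a k] Fd[of a] k \<open>a < n\<close> that by auto
      then show ?thesis using False k \<open>a < n\<close> by (auto simp: F5 g'_def)
    qed
    then have "(\<Sum>k\<in>{..<n}-{i}. F5 $$ (a, k) * leval (inverse x) (g' k)) = (\<Sum>k\<in>{..<n}-{i}. 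
       (if k = a then if a = i \<or> a = j then 0 else leval (inverse x) (g a) * x powi (\<epsilon> a) else 0))"
      by (intro sum.cong) auto
    then show ?thesis using that by (simp add: sum.delta)
  qed
  have F6: "F6 $$ (a, b) = 
     (if b = i then if a = i then x powi \<epsilon> i else if a = j then 0 else - leval x (h a) * x powi \<epsilon> i
      else F5 $$ (a, b))" if "a < n" "b < n" for a b
  proof -
    have "F6 $$ (a, b) = F5 $$ (a, b) + (if b = i then
        (if a = i \<or> a = j then 0 else leval (inverse x) (g a) * x powi (\<epsilon> a)) else 0)"
      using that by (simp add: F6_def sum6)
    then show ?thesis using that gh[of a] ij by (auto simp: F5)
  qed
  define F7 where "F7 = mat n n (\<lambda>(a, b). F6 $$ (a, b) + (if a = i then 0 else leval x (h' a) * F6 $$ (i, b)))"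
  have t7: "birkhoff_trivial x n F7" unfolding F7_def by (rule birkhoff_trivial_row_shear[OF t6 ij(1)])
  have F7: "F7 $$ (a, b) =
     (if b = i then if a = i then x powi \<epsilon> i else 0
      else if b = j then if a = i then 1 else if a = j then x powi \<epsilon> j else leval x (h a)
      else if a = i \<or> a = j then 0 else F $$ (a, b))" if "a < n" "b < n" for a b
    using that ij neq by (auto simp: F7_def F6 F5 h'_def leval.hom_zero)
  have "extension_gluing x n \<epsilon> F7"
    unfolding extension_gluing_def
  proof (intro conjI allI impI)
    show "birkhoff_trivial x n F7" by (rule t7)
    show "F7 $$ (a, a) = x powi \<epsilon> a" if "a < n" for a
      using that Fd[of a] by (auto simp: F7)
    fix a b assume ab: "a < n" "b < n" "a \<noteq> b" "F7 $$ (a, b) \<noteq> 0"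
    then consider "F $$ (a, b) \<noteq> 0" "a \<noteq> i" "a \<noteq> j" "b \<noteq> i" "b \<noteq> j" | "b = j" "a = i"
      | "b = j" "a \<noteq> i" "a \<noteq> j" "h a \<noteq> 0"
    proof -
      have "h a \<noteq> 0" if "b = j" "a \<noteq> i" "a \<noteq> j"
      proof
        assume "h a = 0"
        then show False using ab F7[OF ab(1,2)] that neq by simp
      qed
      moreover have "b \<noteq> i" using ab F7[OF ab(1,2)] by (auto split: if_splits)
      moreover have "F $$ (a, b) \<noteq> 0" "a \<noteq> i" "a \<noteq> j" if "b \<noteq> j"
        using ab F7[OF ab(1,2)] that \<open>b \<noteq> i\<close> by (auto split: if_splits)
      ultimately show ?thesis using that ab(3) by blast
    qed
    then have "\<epsilon> a < 0 \<and> \<epsilon> b > 0"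
    proof cases
      case 1
      then have "\<not> (?\<epsilon> a \<ge> 0 \<or> ?\<epsilon> b \<le> 0)" using Fo[of a b] ab by blast
      then show ?thesis using 1 by simp
    next
      case 3
      then have "\<not> \<epsilon> a \<ge> 0" using gh[of a] ab by blast
      then show ?thesis using 3 ij by simp
    qed (use ij in simp)
    then show "\<epsilon> a < 0" "\<epsilon> b > 0" by auto
  qed
  then show ?thesis by blast
qed

text \<open>Merging the most negative with the most positive exponent makes one of them \<open>0\<close>, so the
number of nonzero exponents drops. With all exponents \<open>0\<close> the identity works.\<close>

theorem extension_gluing_exists:
  fixes x :: "'a::field fls"
  assumes "x \<noteq> 0" "(\<Sum>i<n. \<epsilon> i) = 0"
  shows "\<exists>M. extension_gluing x n \<epsilon> M"
  using assms
proof (induction "card {i\<in>{..<n}. \<epsilon> i \<noteq> 0}" arbitrary: \<epsilon> x rule: less_induct)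
  case less
  show ?case
  proof (cases "\<forall>i<n. \<epsilon> i = 0")
    case True
    then have "extension_gluing x n \<epsilon> (1\<^sub>m n)"
      by (auto simp: extension_gluing_def birkhoff_trivial_one)
    then show ?thesis by blast
  next
    case False
    then have n0: "n \<noteq> 0" by auto
    have fin: "finite (\<epsilon> ` {..<n})" "\<epsilon> ` {..<n} \<noteq> {}" using n0 by auto
    obtain i where i: "i < n" "\<And>a. a < n \<Longrightarrow> \<epsilon> i \<le> \<epsilon> a"
      using Min_in[OF fin] Min_le[OF fin(1)] by (metis (no_types, lifting) imageE image_eqI lessThan_iff)
    obtain j where j: "j < n" "\<And>a. a < n \<Longrightarrow> \<epsilon> j \<ge> \<epsilon> a"
      using Max_in[OF fin] Max_ge[OF fin(1)] by (metis (no_types, lifting) imageE image_eqI lessThan_iff)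
    have "\<epsilon> i < 0"
    proof (rule ccontr)
      assume "\<not> \<epsilon> i < 0"
      then have "\<And>a. a \<in> {..<n} \<Longrightarrow> \<epsilon> a \<ge> 0" using i(2) by force
      then show False using less.prems(2) False sum_nonneg_eq_0_iff[of "{..<n}" \<epsilon>] by auto
    qed
    have "\<epsilon> j > 0"
    proof (rule ccontr)
      assume "\<not> \<epsilon> j > 0"
      then have "\<And>a. a \<in> {..<n} \<Longrightarrow> - \<epsilon> a \<ge> 0" using j(2) by force
      then show False using less.prems(2) False sum_nonneg_eq_0_iff[of "{..<n}" "\<lambda>a. - \<epsilon> a"]
        by (auto simp: sum_negf)
    qed
    have step: "\<exists>M. extension_gluing y n \<delta> M"
      if y: "y \<noteq> 0" and d: "\<And>a. {\<delta> a, - \<delta> a} = {\<epsilon> a, - \<epsilon> a}" "(\<Sum>a<n. \<delta> a) = 0"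
        and kl: "k < n" "l < n" "\<delta> k < 0" "\<delta> l > 0" "\<delta> k + \<delta> l \<ge> 0" "\<And>a. a < n \<Longrightarrow> \<delta> k \<le> \<delta> a"
      for y :: "'a fls" and \<delta> k l
    proof -
      let ?\<delta> = "\<delta>(k := 0, l := \<delta> k + \<delta> l)"
      have kl': "k \<noteq> l" using kl by auto
      have nz: "\<delta> a \<noteq> 0 \<longleftrightarrow> \<epsilon> a \<noteq> 0" for a using d(1)[of a] by auto
      have "{a\<in>{..<n}. ?\<delta> a \<noteq> 0} \<subseteq> {a\<in>{..<n}. \<epsilon> a \<noteq> 0}"
        using kl nz[of l] nz by (auto split: if_splits)
      moreover have "k \<in> {a\<in>{..<n}. \<epsilon> a \<noteq> 0}" "k \<notin> {a\<in>{..<n}. ?\<delta> a \<noteq> 0}"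
        using kl nz[of k] kl' by auto
      ultimately have "{a\<in>{..<n}. ?\<delta> a \<noteq> 0} \<subset> {a\<in>{..<n}. \<epsilon> a \<noteq> 0}"
        by blast
      then have "card {a\<in>{..<n}. ?\<delta> a \<noteq> 0} < card {a\<in>{..<n}. \<epsilon> a \<noteq> 0}"
        by (intro psubset_card_mono) auto
      moreover have "(\<Sum>a<n. ?\<delta> a) = 0"
      proof -
        have "(\<Sum>a<n. ?\<delta> a) = (\<Sum>a<n. \<delta> a + ((if a = k then - \<delta> k else 0) + (if a = l then \<delta> k else 0)))"
          using kl' by (intro sum.cong) auto
        then show ?thesis using d(2) kl by (simp add: sum.distrib)
      qed
      ultimately obtain F where "extension_gluing y n ?\<delta> F" using less.hyps y by blast
      then show ?thesis using extension_gluing_step[of y k n l \<delta> F] y kl by blast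
    qed
    show ?thesis
    proof (cases "\<epsilon> i + \<epsilon> j \<ge> 0")
      case True
      show ?thesis
        by (rule step[of x \<epsilon> i j]) (use less.prems i j True \<open>\<epsilon> i < 0\<close> \<open>\<epsilon> j > 0\<close> in auto)
    next
      case False
      have "\<exists>M. extension_gluing (inverse x) n (\<lambda>a. - \<epsilon> a) M"
        by (rule step[of _ _ j i])
           (use less.prems i j False \<open>\<epsilon> i < 0\<close> \<open>\<epsilon> j > 0\<close> in \<open>auto simp: sum_negf\<close>)
      then show ?thesis using extension_gluing_swap[of "inverse x" n "\<lambda>a. - \<epsilon> a"] less.prems(1) by auto
    qed
  qed
qed

section \<open>Rectangular diagonal matrices, blocks and reversal\<close>

abbreviation in_t :: "'a::field poly \<Rightarrow> 'a fls" where "in_t \<equiv> leval fls_X"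
abbreviation in_inv_t :: "'a::field poly \<Rightarrow> 'a fls" where "in_inv_t \<equiv> leval (inverse fls_X)"

definition rect_diag :: "nat \<Rightarrow> nat \<Rightarrow> nat \<Rightarrow> (nat \<Rightarrow> 'a::zero) \<Rightarrow> 'a mat" where
  "rect_diag m n r f = mat m n (\<lambda>(i, j). if i = j \<and> i < r then f i else 0)"

lemma rect_diag_carrier [simp]: "rect_diag m n r f \<in> carrier_mat m n"
  and dim_row_rect_diag [simp]: "dim_row (rect_diag m n r f) = m"
  and dim_col_rect_diag [simp]: "dim_col (rect_diag m n r f) = n"
  by (simp_all add: rect_diag_def)

lemma index_rect_diag_mult:
  fixes M :: "'a::comm_ring_1 mat"
  assumes "M \<in> carrier_mat n k" "r \<le> n" "i < m" "j < k"
  shows "(rect_diag m n r f * M) $$ (i, j) = (if i < r then f i * M $$ (i, j) else 0)"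
proof -
  have "(rect_diag m n r f * M) $$ (i, j) = (\<Sum>l<n. (if i = l \<and> i < r then f i else 0) * M $$ (l, j))"
    using assms by (simp add: rect_diag_def scalar_prod_def lessThan_atLeast0)
  also have "\<dots> = (\<Sum>l<n. if l = i then if i < r then f i * M $$ (l, j) else 0 else 0)"
    by (intro sum.cong) auto
  finally show ?thesis using assms by (auto simp: sum.delta)
qed

lemma index_mult_rect_diag:
  fixes M :: "'a::comm_ring_1 mat"
  assumes "M \<in> carrier_mat k m" "r \<le> m" "i < k" "j < n"
  shows "(M * rect_diag m n r f) $$ (i, j) = (if j < r then M $$ (i, j) * f j else 0)"
proof -
  have "(M * rect_diag m n r f) $$ (i, j) = (\<Sum>l<m. M $$ (i, l) * (if l = j \<and> l < r then f l else 0))"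
    using assms by (simp add: rect_diag_def scalar_prod_def lessThan_atLeast0)
  also have "\<dots> = (\<Sum>l<m. if l = j then if j < r then M $$ (i, l) * f j else 0 else 0)"
    by (intro sum.cong) auto
  finally show ?thesis using assms by (auto simp: sum.delta)
qed

lemma transpose_rect_diag: "transpose_mat (rect_diag m n r f) = rect_diag n m r f"
  by (rule eq_matI) (auto simp: rect_diag_def)

lemma det_rect_diag: "det (rect_diag n n n f) = (\<Prod>i<n. f i)"
proof -
  have "det (rect_diag n n n f) = prod_list (diag_mat (rect_diag n n n f))"
    by (rule det_lower_triangular[of n]) (auto simp: rect_diag_def)
  also have "diag_mat (rect_diag n n n f) = map f [0..<n]"
    by (auto simp: diag_mat_def rect_diag_def)
  finally show ?thesis by (simp add: prod.list_conv_set_nth lessThan_atLeast0)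
qed

lemma (in semiring_hom) map_rect_diag: "map_mat hom (rect_diag m n r f) = rect_diag m n r (\<lambda>i. hom (f i))"
  by (rule eq_matI) (auto simp: rect_diag_def)

definition upper_block :: "nat \<Rightarrow> 'a mat \<Rightarrow> 'a mat" where
  "upper_block r M = mat r r (\<lambda>(i, j). M $$ (i, j))"

definition lower_rows :: "nat \<Rightarrow> 'a mat \<Rightarrow> 'a mat" where
  "lower_rows r M = mat (dim_row M - r) (dim_col M) (\<lambda>(i, j). M $$ (i + r, j))"

definition lower_block :: "nat \<Rightarrow> 'a mat \<Rightarrow> 'a mat" where
  "lower_block r M = mat (dim_row M - r) (dim_col M - r) (\<lambda>(i, j). M $$ (i + r, j + r))"

definition last_cols :: "nat \<Rightarrow> 'a mat \<Rightarrow> 'a mat" where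
  "last_cols r M = mat (dim_row M) (dim_col M - r) (\<lambda>(i, j). M $$ (i, j + r))"

lemma block_carriers [simp]:
  "upper_block r M \<in> carrier_mat r r"
  "M \<in> carrier_mat n k \<Longrightarrow> lower_rows r M \<in> carrier_mat (n - r) k"
  "M \<in> carrier_mat n k \<Longrightarrow> lower_block r M \<in> carrier_mat (n - r) (k - r)"
  "M \<in> carrier_mat n k \<Longrightarrow> last_cols r M \<in> carrier_mat n (k - r)"
  by (auto simp: upper_block_def lower_rows_def lower_block_def last_cols_def)

lemma block_transpose:
  "upper_block r (transpose_mat M) = transpose_mat (upper_block r M)" if "r \<le> dim_row M" "r \<le> dim_col M"
  using that by (intro eq_matI) (auto simp: upper_block_def)

lemma lower_block_transpose:
  "lower_block r (transpose_mat M) = transpose_mat (lower_block r M)"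
  by (intro eq_matI) (auto simp: lower_block_def)

lemma map_lower_rows: "map_mat h (lower_rows r M) = lower_rows r (map_mat h M)"
  by (intro eq_matI) (auto simp: lower_rows_def)

lemma det_block_lower_triangular:
  fixes M :: "'a::idom mat"
  assumes "M \<in> carrier_mat n n" "r \<le> n" "\<And>i j. i < r \<Longrightarrow> r \<le> j \<Longrightarrow> j < n \<Longrightarrow> M $$ (i, j) = 0"
  shows "det M = det (upper_block r M) * det (lower_block r M)"
proof -
  define L where "L = mat (n - r) r (\<lambda>(i, j). M $$ (i + r, j))"
  have M: "M = four_block_mat (upper_block r M) (0\<^sub>m r (n - r)) L (lower_block r M)"
    using assms by (intro eq_matI) (auto simp: upper_block_def lower_block_def L_def)
  show ?thesis
    by (subst M, rule det_four_block_mat_upper_right_zero[of _ r _ "n - r"])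
       (use assms in \<open>auto simp: L_def\<close>)
qed

text \<open>For a matrix \<open>V\<close> that diagonalizes \<open>P\<close> this expresses a kernel vector \<open>V y\<close>, where the first \<open>r\<close> entries of
\<open>y\<close> vanish, through the last columns of \<open>V\<close>.\<close>

lemma mult_upper_zero:
  fixes A :: "'a::comm_ring_1 mat"
  assumes "A \<in> carrier_mat l n" "B \<in> carrier_mat n k" "r \<le> n"
    and "\<And>i j. i < r \<Longrightarrow> j < k \<Longrightarrow> B $$ (i, j) = 0"
  shows "A * B = last_cols r A * lower_rows r B"
proof (rule eq_matI)
  fix i j assume "i < dim_row (last_cols r A * lower_rows r B)" "j < dim_col (last_cols r A * lower_rows r B)"
  then have ij: "i < l" "j < k" using assms by (auto simp: last_cols_def lower_rows_def)
  have "(A * B) $$ (i, j) = (\<Sum>h\<in>{0..<n}. A $$ (i, h) * B $$ (h, j))"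
    using assms ij by (simp add: scalar_prod_def)
  also have "\<dots> = (\<Sum>h\<in>{r..<n}. A $$ (i, h) * B $$ (h, j))"
    using assms ij by (intro sum.mono_neutral_right) auto
  also have "\<dots> = (\<Sum>h\<in>{0..<n-r}. A $$ (i, h + r) * B $$ (h + r, j))"
    using assms(3) sum.shift_bounds_nat_ivl[of "\<lambda>h. A $$ (i, h) * B $$ (h, j)" 0 r "n - r"] by simp
  also have "\<dots> = (last_cols r A * lower_rows r B) $$ (i, j)"
    using assms ij by (simp add: scalar_prod_def last_cols_def lower_rows_def)
  finally show "(A * B) $$ (i, j) = (last_cols r A * lower_rows r B) $$ (i, j)" .
qed (use assms in \<open>auto simp: last_cols_def lower_rows_def\<close>)

lemma lower_rows_mult:
  fixes A :: "'a::comm_ring_1 mat"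
  assumes "A \<in> carrier_mat l n" "B \<in> carrier_mat n k"
  shows "lower_rows r (A * B) = lower_rows r A * B"
  using assms by (intro eq_matI) (auto simp: lower_rows_def scalar_prod_def)

lemma lower_rows_last_cols: "lower_rows r (last_cols r A) = lower_block r A"
  by (intro eq_matI) (auto simp: lower_rows_def last_cols_def lower_block_def)

lemma mult_last_cols:
  fixes A :: "'a::comm_ring_1 mat"
  assumes "A \<in> carrier_mat l n" "B \<in> carrier_mat n k"
  shows "A * last_cols r B = last_cols r (A * B)"
  using assms by (intro eq_matI) (auto simp: last_cols_def scalar_prod_def)

lemma map_last_cols: "map_mat h (last_cols r M) = last_cols r (map_mat h M)"
  by (intro eq_matI) (auto simp: last_cols_def)

text \<open>In the coordinates given by \<open>V\<close> the matrix is diagonal with nonzero entries in the first \<open>r\<close> places, so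
a kernel vector can only have the remaining coordinates.\<close>

lemma kernel_upper_zero:
  fixes P :: "'a::idom mat"
  assumes "P \<in> carrier_mat m n" "U \<in> carrier_mat m m" "V \<in> carrier_mat n n" "V' \<in> carrier_mat n n"
    and "V * V' = 1\<^sub>m n" "U * P * V = rect_diag m n r f" "r \<le> m" "r \<le> n" "\<And>i. i < r \<Longrightarrow> f i \<noteq> 0"
    and "N \<in> carrier_mat n k" "P * N = 0\<^sub>m m k" "i < r" "j < k"
  shows "(V' * N) $$ (i, j) = 0"
proof -
  have c: "U * P \<in> carrier_mat m n" "V' * N \<in> carrier_mat n k" using assms by auto
  have "rect_diag m n r f * (V' * N) = U * P * (V * V' * N)"
    unfolding assms(6)[symmetric] assoc_mult_mat[OF c(1) assms(3) c(2)]
      assoc_mult_mat[OF assms(3,4,10)] ..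
  also have "\<dots> = U * (P * N)" using assms(1,2,10) by (simp add: assms(5))
  also have "\<dots> = 0\<^sub>m m k" using assms(2,11) by simp
  finally have "(rect_diag m n r f * (V' * N)) $$ (i, j) = 0" using assms by simp
  then show ?thesis
    using assms index_rect_diag_mult[of "V' * N" n k r i m j f] by auto
qed

definition rev_poly :: "nat \<Rightarrow> 'a::comm_monoid_add poly \<Rightarrow> 'a poly" where
  "rev_poly k p = (\<Sum>i\<le>k. monom (coeff p (k - i)) i)"

lemma coeff_rev_poly: "coeff (rev_poly k p) i = (if i \<le> k then coeff p (k - i) else 0)"
proof -
  have "coeff (rev_poly k p) i = (\<Sum>j\<le>k. if i = j then coeff p (k - j) else 0)"
    unfolding rev_poly_def coeff_sum by (intro sum.cong) (auto simp: coeff_monom)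
  then show ?thesis by (simp add: sum.delta')
qed

text \<open>The equation \<open>q(t) = t^k p(1/t)\<close> forces the degree bound because \<open>q\<close> has no pole; it is used to produce
degree bounds as well as reversals.\<close>

lemma in_t_eq_iff:
  fixes p q :: "'a::field poly"
  shows "in_t q = fls_X ^ k * in_inv_t p \<longleftrightarrow> degree p \<le> k \<and> q = rev_poly k p"
proof -
  have nth: "fls_nth (fls_X ^ k * in_inv_t p) i = fls_nth (in_inv_t p) (i - int k)" for i
    by (simp add: fls_X_power_times_conv_shift)
  show ?thesis
  proof
    assume eq: "in_t q = fls_X ^ k * in_inv_t p"
    have "coeff p i = 0" if "i > k" for i
      using arg_cong[OF eq, of "\<lambda>f. fls_nth f (int k - int i)"] that
      by (simp add: nth leval_X_nth leval_inv_X_nth)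
    then have "degree p \<le> k" by (simp add: degree_le)
    moreover have "coeff q i = coeff (rev_poly k p) i" for i
      using arg_cong[OF eq, of "\<lambda>f. fls_nth f (int i)"]
      by (simp add: nth leval_X_nth leval_inv_X_nth coeff_rev_poly nat_diff_distrib)
    ultimately show "degree p \<le> k \<and> q = rev_poly k p" by (simp add: poly_eqI)
  next
    assume "degree p \<le> k \<and> q = rev_poly k p"
    then show "in_t q = fls_X ^ k * in_inv_t p"
      by (intro fls_eqI)
         (auto simp: nth leval_X_nth leval_inv_X_nth coeff_rev_poly nat_diff_distrib coeff_eq_0)
  qed
qed

lemma subdegree_prod_leval_X:
  fixes r :: nat
  assumes "\<And>i. i < r \<Longrightarrow> f i \<noteq> (0::'a::field poly)"
  shows "fls_subdegree (\<Prod>i<r. in_t (f i)) = (\<Sum>i<r. int (order 0 (f i)))"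
proof -
  have "(\<And>i. i < r \<Longrightarrow> f i \<noteq> 0) \<Longrightarrow> fls_subdegree (\<Prod>i<r. in_t (f i)) = (\<Sum>i<r. int (order 0 (f i)))"
    by (induction r) (auto simp: subdegree_leval_X)
  then show ?thesis using assms by blast
qed

lemma subdegree_prod_leval_inv_X:
  fixes r :: nat
  assumes "\<And>i. i < r \<Longrightarrow> f i \<noteq> (0::'a::field poly)"
  shows "fls_subdegree (\<Prod>i<r. in_inv_t (f i)) = - (\<Sum>i<r. int (degree (f i)))"
proof -
  have "(\<And>i. i < r \<Longrightarrow> f i \<noteq> 0) \<Longrightarrow> fls_subdegree (\<Prod>i<r. in_inv_t (f i)) = - (\<Sum>i<r. int (degree (f i)))"
    by (induction r) (auto simp: subdegree_leval_inv_X)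
  then show ?thesis using assms by blast
qed

lemma det_unimod:
  fixes G :: "'a::field poly mat"
  assumes "unimod n G"
  shows "degree (det G) = 0 \<and> det G \<noteq> 0 \<and> order 0 (det G) = 0"
proof -
  from assms obtain H where H: "H \<in> carrier_mat n n" "G * H = 1\<^sub>m n" by (rule unimodE)
  have "det G * det H = 1" using H assms det_mult[of G n H] by auto
  then have "det G dvd 1" by (metis dvd_triv_left)
  then obtain c where c: "det G = [:c:]" "c \<noteq> 0"
    unfolding is_unit_poly_iff by (metis dvd_0_left_iff one_neq_zero)
  then have "poly (det G) 0 \<noteq> 0" by simp
  then show ?thesis using c by (auto simp: order_0I)
qed

section \<open>The index identity\<close>

definition inverse_pair :: "nat \<Rightarrow> 'a::comm_ring_1 mat \<Rightarrow> 'a mat \<Rightarrow> bool" where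
  "inverse_pair n G H \<longleftrightarrow> G \<in> carrier_mat n n \<and> H \<in> carrier_mat n n \<and> G * H = 1\<^sub>m n \<and> H * G = 1\<^sub>m n"

lemma inverse_pair_carrier: "inverse_pair n G H \<Longrightarrow> G \<in> carrier_mat n n" "inverse_pair n G H \<Longrightarrow> H \<in> carrier_mat n n"
  by (auto simp: inverse_pair_def)

lemma inverse_pair_sym: "inverse_pair n G H \<Longrightarrow> inverse_pair n H G"
  by (auto simp: inverse_pair_def)

lemma inverse_pair_transpose:
  assumes "inverse_pair n G H"
  shows "inverse_pair n (transpose_mat G) (transpose_mat H)"
  using assms transpose_mult[of H n n G n] transpose_mult[of G n n H n]
  unfolding inverse_pair_def by (metis transpose_carrier_mat transpose_one)

lemma (in comm_ring_hom) inverse_pair_map: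
  assumes "inverse_pair n G H"
  shows "inverse_pair n (map_mat hom G) (map_mat hom H)"
  using assms unfolding inverse_pair_def
  by (auto simp: mat_hom_mult[symmetric] mat_hom_one)

lemma inverse_pair_mult:
  assumes "inverse_pair n G G'" "inverse_pair n H H'"
  shows "inverse_pair n (G * H) (H' * G')"
  using mult_inverse_pairs[of G n G' H H'] mult_inverse_pairs[of H' n H G' G] assms
  unfolding inverse_pair_def by (metis mult_carrier_mat)

lemma unimod_inverse_pair: "unimod n G \<longleftrightarrow> (\<exists>H. inverse_pair n G H)"
proof
  assume "unimod n G"
  then obtain H where "H \<in> carrier_mat n n" "G * H = 1\<^sub>m n" "H * G = 1\<^sub>m n" by (rule unimodE)
  then show "\<exists>H. inverse_pair n G H"
    using \<open>unimod n G\<close> by (auto simp: inverse_pair_def)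
qed (use unimodI[of G n] in \<open>auto simp: inverse_pair_def\<close>)

lemma inverse_pair_unimod: "inverse_pair n G H \<Longrightarrow> unimod n G" "inverse_pair n G H \<Longrightarrow> unimod n H"
  using unimod_inverse_pair inverse_pair_sym by blast+

lemma inverse_pair_cancel:
  assumes "inverse_pair n G H" "M \<in> carrier_mat n k"
  shows "G * (H * M) = M" "H * (G * M) = M"
  using assms assoc_mult_mat[of G n n H n M k, symmetric] assoc_mult_mat[of H n n G n M k, symmetric]
  by (auto simp: inverse_pair_def)

lemma inverse_pair_cancel_right:
  assumes "inverse_pair n G H" "M \<in> carrier_mat k n"
  shows "M * G * H = M" "M * H * G = M"
  using assms assoc_mult_mat[of M k n G n H n] assoc_mult_mat[of M k n H n G n]
  by (auto simp: inverse_pair_def)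

lemma subdegree_det_gluing:
  assumes "unimod n (V :: 'a::field poly mat)" "unimod n V'"
  shows "det (map_mat in_inv_t V * map_mat in_t V') \<noteq> 0"
    "fls_subdegree (det (map_mat in_inv_t V * map_mat in_t V')) = 0"
proof -
  have c: "V \<in> carrier_mat n n" "V' \<in> carrier_mat n n" using assms by auto
  have *: "det (map_mat in_inv_t V * map_mat in_t V') = in_inv_t (det V) * in_t (det V')"
    using c by (subst det_mult[of _ n]) (auto simp: leval.hom_det)
  show "det (map_mat in_inv_t V * map_mat in_t V') \<noteq> 0"
    "fls_subdegree (det (map_mat in_inv_t V * map_mat in_t V')) = 0"
    unfolding * using det_unimod[OF assms(1)] det_unimod[OF assms(2)]
    by (auto simp: subdegree_leval_inv_X subdegree_leval_X)
qed

text \<open>Here \<open>V'\<close> is the inverse of a matrix that diagonalizes \<open>P\<close> and \<open>Z\<close> diagonalizes the reversal; the last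
columns of \<open>V\<close> and of \<open>Z\<close> are bases of the kernel in the two charts, and the lower block is the transition
matrix between them. The order of its determinant is, up to sign, the degree of the kernel bundle.\<close>

definition kernel_bundle_degree :: "nat \<Rightarrow> 'a::field poly mat \<Rightarrow> 'a poly mat \<Rightarrow> int" where
  "kernel_bundle_degree r V' Z = fls_subdegree (det (lower_block r (map_mat in_inv_t V' * map_mat in_t Z)))"

text \<open>The map from \<open>O(-d)^n\<close> to \<open>O^m\<close> seen in both charts, with a diagonalization in each. The inverses \<open>U'\<close>, \<open>V'\<close>,
\<open>W'\<close>, \<open>Z'\<close> are parameters so that the transposed map is an instance of the same locale; this is
how statements about the kernel of \<open>P\<close> become statements about the left kernel.\<close>

locale two_charts =
  fixes m n r d :: nat and P Q :: "'a::field poly mat"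
    and U U' V V' W W' Z Z' :: "'a poly mat" and \<alpha> \<beta> :: "nat \<Rightarrow> 'a poly"
  assumes P: "P \<in> carrier_mat m n" and Q: "Q \<in> carrier_mat m n"
    and charts: "map_mat in_t Q = fls_X ^ d \<cdot>\<^sub>m map_mat in_inv_t P"
    and r: "r \<le> m" "r \<le> n"
    and U: "inverse_pair m U U'" and V: "inverse_pair n V V'"
    and W: "inverse_pair m W W'" and Z: "inverse_pair n Z Z'"
    and smithP: "U * P * V = rect_diag m n r \<alpha>" and smithQ: "W * Q * Z = rect_diag m n r \<beta>"
    and \<alpha>: "\<And>i. i < r \<Longrightarrow> \<alpha> i \<noteq> 0" and \<beta>: "\<And>i. i < r \<Longrightarrow> \<beta> i \<noteq> 0"
begin

definition X where "X = map_mat in_t W * map_mat in_inv_t U'"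
definition Y where "Y = map_mat in_inv_t V' * map_mat in_t Z"

lemmas carriers = P Q inverse_pair_carrier[OF U] inverse_pair_carrier[OF V] inverse_pair_carrier[OF W]
  inverse_pair_carrier[OF Z]

lemma XY_carrier: "X \<in> carrier_mat m m" "Y \<in> carrier_mat n n"
  unfolding X_def Y_def using carriers by auto

lemma gluing: "X * rect_diag m n r (\<lambda>i. fls_X ^ d * in_inv_t (\<alpha> i)) * Y = rect_diag m n r (\<lambda>i. in_t (\<beta> i))"
proof -
  note hm = leval.mat_hom_mult
  have "P = U' * (U * P * V) * V'"
    using carriers inverse_pair_cancel[OF U, of "P * V" n] inverse_pair_cancel_right[OF V, of P m]
    by (simp add: assoc_mult_mat[of U m m P n V n])
  then have P': "P = U' * rect_diag m n r \<alpha> * V'" by (simp only: smithP)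
  have eq1: "map_mat in_inv_t P = map_mat in_inv_t U' * rect_diag m n r (\<lambda>i. in_inv_t (\<alpha> i)) * map_mat in_inv_t V'"
    using carriers by (subst P', subst hm[of _ m n _ n], force, force, subst hm[of _ m m _ n])
      (auto simp: leval.map_rect_diag)
  have eq2: "fls_X ^ d \<cdot>\<^sub>m rect_diag m n r (\<lambda>i. in_inv_t (\<alpha> i)) = rect_diag m n r (\<lambda>i. fls_X ^ d * in_inv_t (\<alpha> i))"
    by (rule eq_matI) (auto simp: rect_diag_def)
  have eq3: "map_mat in_t Q = map_mat in_inv_t U' * rect_diag m n r (\<lambda>i. fls_X ^ d * in_inv_t (\<alpha> i)) * map_mat in_inv_t V'"
    unfolding charts eq1 eq2[symmetric] using carriers
    by (simp add: mult_smult_distrib[of _ m m _ n] mult_smult_assoc_mat[of _ m n _ n] mult_carrier_mat[of _ m m _ n])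
  have "rect_diag m n r (\<lambda>i. in_t (\<beta> i)) = map_mat in_t (W * Q * Z)"
    by (simp add: smithQ leval.map_rect_diag)
  also have "\<dots> = map_mat in_t W * map_mat in_t Q * map_mat in_t Z"
    using carriers by (subst hm[of _ m n _ n], force, force, subst hm[of _ m m _ n]) auto
  also have "\<dots> = X * rect_diag m n r (\<lambda>i. fls_X ^ d * in_inv_t (\<alpha> i)) * Y"
    unfolding eq3 X_def Y_def using carriers
    by (simp add: assoc_mult_mat[of _ m m _ m _ n] assoc_mult_mat[of _ m n _ n _ n]
       assoc_mult_mat[of _ m m _ n _ n] mult_carrier_mat[of _ m m _ n] mult_carrier_mat[of _ n n _ n] 
       mult_carrier_mat[of _ m n _ n])
  finally show ?thesis ..
qed

definition X' where "X' = map_mat in_inv_t U * map_mat in_t W'"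
definition Y' where "Y' = map_mat in_t Z' * map_mat in_inv_t V"

lemma XX': "inverse_pair m X X'" 
  unfolding X_def X'_def
  by (intro inverse_pair_mult leval.inverse_pair_map W inverse_pair_sym[OF U])

lemma YY': "inverse_pair n Y Y'"
  unfolding Y_def Y'_def
  by (intro inverse_pair_mult leval.inverse_pair_map Z inverse_pair_sym[OF V])

text \<open>The transition matrices respect the kernel, hence they are block triangular: by the gluing equation
multiplication by the diagonal matrix of \<open>\<alpha>\<close> turns \<open>Y\<close> into a matrix whose last columns vanish.\<close>

lemma Y_zero: "Y $$ (i, j) = 0" if "i < r" "r \<le> j" "j < n"
proof -
  let ?A = "rect_diag m n r (\<lambda>i. fls_X ^ d * in_inv_t (\<alpha> i))"
  have "?A * Y = X' * (X * (?A * Y))"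
    by (rule inverse_pair_cancel(2)[OF XX', symmetric, of _ n], rule mult_carrier_mat[of _ m n])
       (use XY_carrier in auto)
  also have "X * (?A * Y) = rect_diag m n r (\<lambda>i. in_t (\<beta> i))"
    using gluing XY_carrier by (simp add: assoc_mult_mat[of _ m m _ n _ n])
  finally have eq: "?A * Y = X' * rect_diag m n r (\<lambda>i. in_t (\<beta> i))" .
  have "(?A * Y) $$ (i, j) = fls_X ^ d * in_inv_t (\<alpha> i) * Y $$ (i, j)"
    using that r XY_carrier by (subst index_rect_diag_mult[of _ n n]) auto
  moreover have "(X' * rect_diag m n r (\<lambda>i. in_t (\<beta> i))) $$ (i, j) = 0"
    using that r inverse_pair_carrier(2)[OF XX'] by (subst index_mult_rect_diag[of _ m m]) auto
  ultimately show ?thesis using \<alpha>[OF that(1)] by (simp add: eq)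
qed

lemma X_zero: "X $$ (i, j) = 0" if "j < r" "r \<le> i" "i < m"
proof -
  let ?A = "rect_diag m n r (\<lambda>i. fls_X ^ d * in_inv_t (\<alpha> i))"
  have "X * ?A = X * ?A * Y * Y'"
    by (rule inverse_pair_cancel_right(1)[OF YY', symmetric, of _ m], rule mult_carrier_mat[of _ m m])
       (use XY_carrier in auto)
  then have eq: "X * ?A = rect_diag m n r (\<lambda>i. in_t (\<beta> i)) * Y'" by (simp only: gluing)
  have "(X * ?A) $$ (i, j) = X $$ (i, j) * (fls_X ^ d * in_inv_t (\<alpha> j))"
    using that r XY_carrier by (subst index_mult_rect_diag[of _ m m]) auto
  moreover have "(rect_diag m n r (\<lambda>i. in_t (\<beta> i)) * Y') $$ (i, j) = 0"
    using that r inverse_pair_carrier(2)[OF YY'] by (subst index_rect_diag_mult[of _ n n]) auto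
  ultimately show ?thesis using \<alpha>[OF that(1)] by (simp add: eq)
qed

text \<open>Restricting the gluing equation to the first \<open>r\<close> coordinates makes all matrices square, so that determinants
can be taken.\<close>

lemma upper_gluing: "upper_block r X * rect_diag r r r (\<lambda>i. fls_X ^ d * in_inv_t (\<alpha> i)) * upper_block r Y
   = rect_diag r r r (\<lambda>i. in_t (\<beta> i))"
proof (rule eq_matI)
  fix i j assume "i < dim_row (rect_diag r r r (\<lambda>i. in_t (\<beta> i)))" "j < dim_col (rect_diag r r r (\<lambda>i. in_t (\<beta> i)))"
  then have ij: "i < r" "j < r" by auto
  let ?a = "\<lambda>i. fls_X ^ d * in_inv_t (\<alpha> i)"
  have "(rect_diag m n r (\<lambda>i. in_t (\<beta> i))) $$ (i, j) = (X * rect_diag m n r ?a * Y) $$ (i, j)"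
    by (simp only: gluing)
  also have "\<dots> = (\<Sum>k<n. (X * rect_diag m n r ?a) $$ (i, k) * Y $$ (k, j))"
    using XY_carrier ij r by (subst index_mult_mat) (auto simp: scalar_prod_def lessThan_atLeast0)
  also have "\<dots> = (\<Sum>k<n. (if k < r then X $$ (i, k) * ?a k else 0) * Y $$ (k, j))"
    using XY_carrier ij r by (intro sum.cong refl, subst index_mult_rect_diag[of _ m m]) auto
  also have "\<dots> = (\<Sum>k<r. X $$ (i, k) * ?a k * Y $$ (k, j))"
    using r by (intro sum.mono_neutral_cong_right) auto
  also have "\<dots> = (\<Sum>k<r. (upper_block r X * rect_diag r r r ?a) $$ (i, k) * upper_block r Y $$ (k, j))"
    using XY_carrier ij r by (intro sum.cong refl, subst index_mult_rect_diag[of _ r r]) (auto simp: upper_block_def)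
  also have "\<dots> = (upper_block r X * rect_diag r r r ?a * upper_block r Y) $$ (i, j)"
    using ij by (subst (2) index_mult_mat) (auto simp: scalar_prod_def lessThan_atLeast0 upper_block_def)
  finally show "(upper_block r X * rect_diag r r r ?a * upper_block r Y) $$ (i, j) = rect_diag r r r (\<lambda>i. in_t (\<beta> i)) $$ (i, j)"
    using ij r by (simp add: rect_diag_def)
qed (auto simp: upper_block_def)

text \<open>The determinants of \<open>X\<close> and \<open>Y\<close> are products of nonzero constants, so the orders of the upper blocks
are the negatives of those of the lower blocks. The order of the determinant of \<open>upper_gluing\<close> then
gives the identity.\<close>

theorem index_identity:
  "(\<Sum>i<r. int (order 0 (\<beta> i)) + int (degree (\<alpha> i))) + kernel_bundle_degree r V' Z
     + kernel_bundle_degree r (transpose_mat U') (transpose_mat W) = int (r * d)"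
proof -
  let ?a = "\<lambda>i. fls_X ^ d * in_inv_t (\<alpha> i)"
  define x1 where "x1 = det (upper_block r X)"
  define x2 where "x2 = det (lower_block r X)"
  define y1 where "y1 = det (upper_block r Y)"
  define y2 where "y2 = det (lower_block r Y)"
  have detY: "det Y = y1 * y2"
    unfolding y1_def y2_def by (rule det_block_lower_triangular[of _ n]) (use XY_carrier r Y_zero in auto)
  have detX: "det X = x1 * x2"
  proof -
    have c: "lower_block r X \<in> carrier_mat (m - r) (m - r)" using XY_carrier by simp
    have "det (transpose_mat X) = det (upper_block r (transpose_mat X)) * det (lower_block r (transpose_mat X))"
      by (rule det_block_lower_triangular[of _ m]) (use XY_carrier r X_zero in auto)
    then show ?thesis unfolding x1_def x2_def
      using XY_carrier r c by (simp add: block_transpose lower_block_transpose det_transpose[of _ m] 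
         det_transpose[of _ r] det_transpose[of _ "m - r"])
  qed
  have X: "transpose_mat X = map_mat in_inv_t (transpose_mat U') * map_mat in_t (transpose_mat W)"
    unfolding X_def using carriers by (subst transpose_mult[of _ m m _ m]) (auto simp: map_mat_transpose)
  have "det (transpose_mat X) \<noteq> 0 \<and> fls_subdegree (det (transpose_mat X)) = 0"
    unfolding X using subdegree_det_gluing[of m "transpose_mat U'" "transpose_mat W"] U W
      inverse_pair_unimod inverse_pair_transpose by blast
  then have sX: "det X \<noteq> 0" "fls_subdegree (det X) = 0" using XY_carrier by (auto simp: det_transpose)
  have sY: "det Y \<noteq> 0" "fls_subdegree (det Y) = 0"
    unfolding Y_def using subdegree_det_gluing[of n V' Z] V Z inverse_pair_unimod by blast+
  have nz: "x1 \<noteq> 0" "x2 \<noteq> 0" "y1 \<noteq> 0" "y2 \<noteq> 0" using detX detY sX sY by auto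
  have e1: "fls_subdegree x1 = - fls_subdegree x2" using sX detX nz by simp
  have e2: "fls_subdegree y1 = - fls_subdegree y2" using sY detY nz by simp
  have "x1 * (\<Prod>i<r. ?a i) * y1 = (\<Prod>i<r. in_t (\<beta> i))"
    using arg_cong[OF upper_gluing, of det] unfolding x1_def y1_def
    by (simp add: det_mult[of _ r] det_rect_diag mult_carrier_mat[of _ r r _ r])
  moreover have "(\<Prod>i<r. ?a i) = fls_X ^ (r * d) * (\<Prod>i<r. in_inv_t (\<alpha> i))"
    by (simp add: prod.distrib power_mult mult.commute)
  ultimately have eq: "x1 * (fls_X ^ (r * d) * (\<Prod>i<r. in_inv_t (\<alpha> i))) * y1 = (\<Prod>i<r. in_t (\<beta> i))"
    by simp
  have nza: "(\<Prod>i<r. in_inv_t (\<alpha> i)) \<noteq> 0" using \<alpha> by simp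
  have "fls_subdegree x1 + (int (r * d) - (\<Sum>i<r. int (degree (\<alpha> i)))) + fls_subdegree y1
     = (\<Sum>i<r. int (order 0 (\<beta> i)))"
    using arg_cong[OF eq, of fls_subdegree] nz nza \<alpha> \<beta>
    by (simp add: subdegree_prod_leval_X subdegree_prod_leval_inv_X)
  moreover have "kernel_bundle_degree r V' Z = fls_subdegree y2"
    by (simp add: kernel_bundle_degree_def y2_def Y_def)
  moreover have "kernel_bundle_degree r (transpose_mat U') (transpose_mat W) = fls_subdegree x2"
    unfolding kernel_bundle_degree_def x2_def X[symmetric] using XY_carrier
    by (simp add: lower_block_transpose det_transpose[of _ "m - r"])
  ultimately show ?thesis using e1 e2 by (simp add: sum.distrib)
qed

end

section \<open>Degrees of polynomial bases of the kernel\<close>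

lemma vec_degree_le_iff:
  assumes "v \<in> carrier_vec n" "n > 0"
  shows "vec_degree v \<le> k \<longleftrightarrow> (\<forall>i<n. degree (v $ i) \<le> k)"
proof -
  have "vec_degree v \<le> k \<longleftrightarrow> (\<forall>p\<in>set\<^sub>v v. degree p \<le> k)"
    unfolding vec_degree_def using assms by (subst Max_le_iff) (auto simp: vec_set_def)
  then show ?thesis using assms by (auto simp: vec_set_def)
qed

lemma degree_le_vec_degree: "v \<in> carrier_vec n \<Longrightarrow> i < n \<Longrightarrow> degree (v $ i) \<le> vec_degree v"
  using vec_degree_le_iff[of v n "vec_degree v"] by auto

context two_charts
begin

abbreviation "kdeg \<equiv> kernel_bundle_degree r V' Z"

text \<open>A polynomial basis \<open>N\<close> of the kernel has coordinates \<open>V' N\<close> in one chart, and its column-wise reversal \<open>R\<close> has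
coordinates \<open>Z' R\<close> in the other. The transition matrix of the kernel relates the two, and the
orders of the determinants give the formula. The two correction terms measure how far \<open>N\<close> is from
being a basis of the kernel over \<open>F[s]\<close> and how far its leading column coefficients are from being
independent.\<close>

lemma kernel_degree_formula:
  fixes k :: "nat \<Rightarrow> nat"
  assumes N: "N \<in> carrier_mat n (n - r)" and PN: "P * N = 0\<^sub>m m (n - r)"
    and deg: "\<And>i j. i < n \<Longrightarrow> j < n - r \<Longrightarrow> degree (N $$ (i, j)) \<le> k j"
    and nz: "det (lower_rows r (V' * N)) \<noteq> 0"
  defines "R \<equiv> mat n (n - r) (\<lambda>(i, j). rev_poly (k j) (N $$ (i, j)))"
  shows "det (lower_rows r (Z' * R)) \<noteq> 0"
    and "R = last_cols r Z * lower_rows r (Z' * R)"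
    and "int (\<Sum>j<n-r. k j) = kdeg + int (degree (det (lower_rows r (V' * N))))
           + int (order 0 (det (lower_rows r (Z' * R))))"
proof -
  let ?D = "rect_diag (n - r) (n - r) (n - r) (\<lambda>j. fls_X ^ k j :: 'a fls)"
  define w where "w = lower_rows r (V' * N)"
  define w' where "w' = lower_rows r (Z' * R)"
  have R: "R \<in> carrier_mat n (n - r)" by (simp add: R_def)
  have VN: "V' * N \<in> carrier_mat n (n - r)" and ZR: "Z' * R \<in> carrier_mat n (n - r)"
    using carriers N R by auto
  have wc: "w \<in> carrier_mat (n - r) (n - r)" "w' \<in> carrier_mat (n - r) (n - r)"
    unfolding w_def w'_def using VN ZR by auto
  have ND: "map_mat in_t R = map_mat in_inv_t N * ?D"
  proof (rule eq_matI)
    fix i j assume "i < dim_row (map_mat in_inv_t N * ?D)" "j < dim_col (map_mat in_inv_t N * ?D)"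
    then have ij: "i < n" "j < n - r" using N by auto
    have "map_mat in_t R $$ (i, j) = fls_X ^ k j * in_inv_t (N $$ (i, j))"
      using ij deg[OF ij] in_t_eq_iff[of "R $$ (i, j)" "k j" "N $$ (i, j)"] by (simp add: R_def)
    then show "map_mat in_t R $$ (i, j) = (map_mat in_inv_t N * ?D) $$ (i, j)"
      using ij N by (subst index_mult_rect_diag[of _ n "n - r"]) (auto simp: mult.commute)
  qed (use N R in auto)
  have "map_mat in_t (Q * R) = (fls_X ^ d \<cdot>\<^sub>m map_mat in_inv_t P) * (map_mat in_inv_t N * ?D)"
    using carriers R by (subst leval.mat_hom_mult[of _ m n _ "n - r"]) (auto simp: charts ND)
  also have "\<dots> = fls_X ^ d \<cdot>\<^sub>m (map_mat in_inv_t (P * N) * ?D)"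
    using carriers N
    by (simp add: mult_smult_assoc_mat[of _ m n _ "n - r"] leval.mat_hom_mult[of _ m n _ "n - r"]
         mult_carrier_mat[of _ n "n - r" _ "n - r"] assoc_mult_mat[of _ m n _ "n - r" _ "n - r"])
  also have "\<dots> = 0\<^sub>m m (n - r)"
  proof -
    have "map_mat in_inv_t (0\<^sub>m m (n - r)) = (0\<^sub>m m (n - r) :: 'a fls mat)"
      by (intro eq_matI) auto
    then show ?thesis unfolding PN by (simp add: left_mult_zero_mat[of _ "n - r" "n - r"])
  qed
  finally have QR0: "map_mat in_t (Q * R) = 0\<^sub>m m (n - r)" .
  have QR: "Q * R = 0\<^sub>m m (n - r)"
  proof (rule eq_matI)
    fix i j assume "i < dim_row (0\<^sub>m m (n - r))" "j < dim_col (0\<^sub>m m (n - r))"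
    then have ij: "i < m" "j < n - r" by auto
    have "in_t ((Q * R) $$ (i, j)) = map_mat in_t (Q * R) $$ (i, j)"
      using ij carriers R by simp
    also have "\<dots> = 0" unfolding QR0 using ij by simp
    finally show "(Q * R) $$ (i, j) = 0\<^sub>m m (n - r) $$ (i, j)" using ij by simp
  qed (use carriers R in auto)
  have top: "(Z' * R) $$ (i, j) = 0" if "i < r" "j < n - r" for i j
    by (rule kernel_upper_zero[OF Q _ _ _ _ smithQ r \<beta> R QR that])
       (use W Z in \<open>auto simp: inverse_pair_def\<close>)
  have "Z * (Z' * R) = last_cols r Z * w'"
    unfolding w'_def by (rule mult_upper_zero[OF inverse_pair_carrier(1)[OF Z] ZR r(2) top])
  then have Rw: "R = last_cols r Z * w'"
    using inverse_pair_cancel[OF Z R] by simp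
  then show "R = last_cols r Z * lower_rows r (Z' * R)" by (simp only: w'_def)
  have "map_mat in_inv_t V' * map_mat in_t R = map_mat in_inv_t (V' * N) * ?D"
    unfolding ND using carriers N
    by (simp add: leval.mat_hom_mult[of _ n n _ "n - r"] assoc_mult_mat[of _ n n _ "n - r" _ "n - r"])
  then have a: "lower_rows r (map_mat in_inv_t V' * map_mat in_t R) = map_mat in_inv_t w * ?D"
    using VN by (simp add: w_def map_lower_rows lower_rows_mult[of _ n "n - r" _ "n - r"])
  have "map_mat in_inv_t V' * map_mat in_t R = map_mat in_inv_t V' * map_mat in_t (Z * (Z' * R))"
    using inverse_pair_cancel[OF Z R] by simp
  also have "\<dots> = Y * map_mat in_t (Z' * R)"
    unfolding Y_def using carriers ZR
    by (simp add: leval.mat_hom_mult[of Z n n "Z' * R" "n - r"] assoc_mult_mat[of _ n n _ n _ "n - r"])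
  also have "\<dots> = last_cols r Y * lower_rows r (map_mat in_t (Z' * R))"
    by (rule mult_upper_zero[of _ n n _ "n - r"]) (use XY_carrier ZR r top carriers R in \<open>auto simp del: index_mult_mat(1)\<close>)
  finally have *: "map_mat in_inv_t V' * map_mat in_t R = last_cols r Y * lower_rows r (map_mat in_t (Z' * R))" .
  have b: "lower_rows r (map_mat in_inv_t V' * map_mat in_t R) = lower_block r Y * map_mat in_t w'"
  proof -
    have "lower_rows r (last_cols r Y * map_mat in_t w') = lower_block r Y * map_mat in_t w'"
      using XY_carrier wc lower_rows_mult[of "last_cols r Y" n "n - r" "map_mat in_t w'" "n - r" r]
      by (simp add: lower_rows_last_cols)
    then show ?thesis using *  by (simp only: w'_def map_lower_rows)
  qed
  have eq: "map_mat in_inv_t w * ?D = lower_block r Y * map_mat in_t w'" using a b by simp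
  have "in_inv_t (det w) * (\<Prod>j<n-r. fls_X ^ k j) = det (lower_block r Y) * in_t (det w')"
    using arg_cong[OF eq, of det] wc XY_carrier
    by (simp add: det_mult[of _ "n - r"] det_rect_diag leval.hom_det)
  then have deteq: "in_inv_t (det w) * fls_X ^ (\<Sum>j<n-r. k j) = det (lower_block r Y) * in_t (det w')"
    by (simp add: power_sum)
  have nz': "det w \<noteq> 0" using nz by (simp add: w_def)
  then have nzs: "det (lower_block r Y) \<noteq> 0" "det w' \<noteq> 0"
    using deteq by auto
  then show "det (lower_rows r (Z' * R)) \<noteq> 0" by (simp add: w'_def)
  have "fls_subdegree (det (lower_block r Y)) = kdeg"
    by (simp add: kernel_bundle_degree_def Y_def)
  then show "int (\<Sum>j<n-r. k j) = kdeg + int (degree (det (lower_rows r (V' * N))))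
           + int (order 0 (det (lower_rows r (Z' * R))))"
    using arg_cong[OF deteq, of fls_subdegree] nz' nzs
    by (simp add: subdegree_leval_X subdegree_leval_inv_X w_def[symmetric] w'_def[symmetric])
qed

lemma kernel_combination:
  assumes T: "T \<in> carrier_mat (n - r) k"
  shows "last_cols r V * T \<in> carrier_mat n k" "P * (last_cols r V * T) = 0\<^sub>m m k"
    "lower_rows r (V' * (last_cols r V * T)) = T"
proof -
  have L: "last_cols r V \<in> carrier_mat n (n - r)" using carriers by simp
  show N: "last_cols r V * T \<in> carrier_mat n k" using L T by simp
  have "P * V = U' * (U * (P * V))"
    by (rule inverse_pair_cancel(2)[OF U, symmetric, of _ n], rule mult_carrier_mat[of _ m n])
       (use carriers in auto)
  also have "U * (P * V) = rect_diag m n r \<alpha>"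
    using carriers smithP by (simp add: assoc_mult_mat[of U m m P n V n])
  finally have "P * V = U' * rect_diag m n r \<alpha>" .
  then have "P * last_cols r V = last_cols r (U' * rect_diag m n r \<alpha>)"
    using mult_last_cols[OF P inverse_pair_carrier(1)[OF V]] by simp
  also have "\<dots> = 0\<^sub>m m (n - r)"
  proof (rule eq_matI)
    fix i j assume "i < dim_row (0\<^sub>m m (n - r) :: 'a poly mat)" "j < dim_col (0\<^sub>m m (n - r) :: 'a poly mat)"
    then show "last_cols r (U' * rect_diag m n r \<alpha>) $$ (i, j) = 0\<^sub>m m (n - r) $$ (i, j)"
      using carriers r index_mult_rect_diag[of U' m m r i "j + r" n \<alpha>]
      by (simp add: last_cols_def del: index_mult_mat(1))
  qed (use carriers in \<open>auto simp: last_cols_def\<close>)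
  finally have "P * last_cols r V = 0\<^sub>m m (n - r)" .
  then show "P * (last_cols r V * T) = 0\<^sub>m m k"
    using assoc_mult_mat[OF P L T, symmetric] T by simp
  have "V' * last_cols r V = last_cols r (1\<^sub>m n)"
    using mult_last_cols[of V' n n V n r] V by (simp add: inverse_pair_def)
  then have "V' * (last_cols r V * T) = last_cols r (1\<^sub>m n) * T"
    using assoc_mult_mat[OF inverse_pair_carrier(2)[OF V] L T, symmetric] by simp
  then have "lower_rows r (V' * (last_cols r V * T)) = lower_rows r (last_cols r (1\<^sub>m n)) * T"
    using T by (simp add: lower_rows_mult[of _ n "n - r" _ k])
  also have "lower_rows r (last_cols r (1\<^sub>m n :: 'a poly mat)) = 1\<^sub>m (n - r)"
    by (rule eq_matI) (auto simp: lower_rows_def last_cols_def)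
  finally show "lower_rows r (V' * (last_cols r V * T)) = T" using T by simp
qed

text \<open>Among all bases of the kernel over \<open>F[s]\<close> take one with the least sum of column degrees. If its leading
column coefficients were dependent, a shear of the column of largest degree in the dependence would
lower that degree. So both correction terms of \<open>kernel_degree_formula\<close> vanish.\<close>

lemma column_reduction:
  "\<exists>T. unimod (n - r) T \<and> int (\<Sum>j<n-r. vec_degree (col (last_cols r V * T) j)) = kdeg"
proof -
  define S where "S T = (\<Sum>j<n-r. vec_degree (col (last_cols r V * T) j))" for T
  obtain T where T: "unimod (n - r) T" and least: "\<And>T'. unimod (n - r) T' \<Longrightarrow> S T \<le> S T'"
    using ex_has_least_nat[of "unimod (n - r)" "1\<^sub>m (n - r)" S] unimod_one by blast
  have Tc: "T \<in> carrier_mat (n - r) (n - r)" using T by auto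
  define N where "N = last_cols r V * T"
  note N = kernel_combination[OF Tc, folded N_def]
  define k where "k j = vec_degree (col N j)" for j
  have deg: "degree (N $$ (i, j)) \<le> k j" if "i < n" "j < n - r" for i j
    using degree_le_vec_degree[of "col N j" n i] that N(1) by (simp add: k_def)
  define R where "R = mat n (n - r) (\<lambda>(i, j). rev_poly (k j) (N $$ (i, j)))"
  define w where "w = lower_rows r (Z' * R)"
  have ZR: "Z' * R \<in> carrier_mat n (n - r)" using carriers by (auto simp: R_def)
  have wc: "w \<in> carrier_mat (n - r) (n - r)" using ZR by (simp add: w_def)
  note kd = kernel_degree_formula[OF N(1,2) deg, folded R_def, folded w_def, unfolded N(3)]
  have detT: "det T \<noteq> 0" "degree (det T) = 0" using det_unimod[OF T] by auto
  have "poly (det w) 0 \<noteq> 0"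
  proof
    assume p0: "poly (det w) 0 = 0"
    have ev: "comm_ring_hom (\<lambda>p::'a poly. poly p 0)" by unfold_locales auto
    then have evs: "semiring_hom (\<lambda>p::'a poly. poly p 0)"
      unfolding comm_ring_hom_def ring_hom_def by blast
    have "det (map_mat (\<lambda>p. poly p 0) w) = 0" using p0 by (simp add: comm_ring_hom.hom_det[OF ev])
    then obtain v where v: "v \<in> carrier_vec (n - r)" "v \<noteq> 0\<^sub>v (n - r)"
      "map_mat (\<lambda>p. poly p 0) w *\<^sub>v v = 0\<^sub>v (n - r)"
      using det_0_iff_vec_prod_zero[of "map_mat (\<lambda>p. poly p 0) w" "n - r"] wc by auto
    have "map_mat (\<lambda>p. poly p 0) R = map_mat (\<lambda>p. poly p 0) (last_cols r Z) * map_mat (\<lambda>p. poly p 0) w"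
      using kd(2) detT semiring_hom.mat_hom_mult[OF evs,
          of "last_cols r Z" n "n - r" w "n - r"] carriers wc by simp
    then have "map_mat (\<lambda>p. poly p 0) R *\<^sub>v v = map_mat (\<lambda>p. poly p 0) (last_cols r Z) *\<^sub>v 0\<^sub>v (n - r)"
      using carriers wc v by (simp add: assoc_mult_mat_vec[of _ n "n - r" _ "n - r"])
    also have "\<dots> = 0\<^sub>v n" using carriers by (intro eq_vecI) (auto simp: last_cols_def)
    finally have Rv: "map_mat (\<lambda>p. poly p 0) R *\<^sub>v v = 0\<^sub>v n" .
    have rel: "(\<Sum>j<n-r. coeff (N $$ (i, j)) (k j) * v $ j) = 0" if "i < n" for i
    proof -
      have "(map_mat (\<lambda>p. poly p 0) R *\<^sub>v v) $ i = (\<Sum>j<n-r. coeff (N $$ (i, j)) (k j) * v $ j)"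
        using that v(1) by (simp add: R_def scalar_prod_def lessThan_atLeast0 poly_0_coeff_0 coeff_rev_poly)
      then show ?thesis using Rv that by simp
    qed
    \<comment> \<open>\<open>rel\<close> is a dependence between the leading column coefficients; the column to be lowered has the largest degree in it.\<close>
    define J where "J = {j. j < n - r \<and> v $ j \<noteq> 0}"
    have "finite J" "J \<noteq> {}" using v(1,2) by (auto simp: J_def intro!: eq_vecI)
    then obtain j0 where j0: "j0 \<in> J" "\<And>j. j \<in> J \<Longrightarrow> k j \<le> k j0"
      using Max_in[of "k ` J"] Max_ge[of "k ` J"] by (metis (no_types, lifting) finite_imageI imageE image_eqI image_is_empty)
    have j0': "j0 < n - r" "v $ j0 \<noteq> 0" using j0 by (auto simp: J_def)
    define f where "f j = (if v $ j = 0 then 0 else monom (v $ j / v $ j0) (k j0 - k j))" for j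
    define T' where "T' = T * shear (n - r) j0 f"
    have T': "unimod (n - r) T'" unfolding T'_def by (intro unimod_mult T unimod_block_shear)
    have T'c: "T' \<in> carrier_mat (n - r) (n - r)" using T' by auto
    define N' where "N' = last_cols r V * T'"
    note N' = kernel_combination[OF T'c, folded N'_def]
    have "N' = N * shear (n - r) j0 f"
      unfolding N'_def T'_def N_def using carriers Tc
      by (intro assoc_mult_mat[symmetric, of _ n "n - r" _ "n - r" _ "n - r"]) auto
    then have N'e: "N' $$ (i, j) = N $$ (i, j) + (if j = j0 then \<Sum>l\<in>{..<n-r}-{j0}. N $$ (i, l) * f l else 0)"
      if "i < n" "j < n - r" for i j
      using that j0' N(1) by (simp add: index_mult_shear[of N n "n - r"] del: index_mult_mat(1))
    have col_eq: "col N' j = col N j" if "j < n - r" "j \<noteq> j0" for j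
      using that N(1) N'(1) by (intro eq_vecI) (auto simp: N'e)
    have summand: "degree (N $$ (i, l) * f l) \<le> k j0 \<and>
        coeff (N $$ (i, l) * f l) (k j0) = coeff (N $$ (i, l)) (k l) * v $ l / v $ j0"
      if "i < n" "l < n - r" for i l
    proof (cases "v $ l = 0")
      case False
      then have "k l \<le> k j0" using j0(2)[of l] that by (auto simp: J_def)
      moreover have "degree (N $$ (i, l) * f l) \<le> k l + (k j0 - k l)"
        using degree_mult_le[of "N $$ (i, l)" "f l"] deg[OF that] degree_monom_le[of "v $ l / v $ j0" "k j0 - k l"] False
        by (auto simp: f_def)
      ultimately show ?thesis using False
        by (simp add: f_def mult.commute[of "N $$ (i, l)"] coeff_monom_mult)
    qed (simp add: f_def)
    have top: "degree (N' $$ (i, j0)) \<le> k j0 \<and> coeff (N' $$ (i, j0)) (k j0) = 0" if i: "i < n" for i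
    proof -
      have e: "N' $$ (i, j0) = N $$ (i, j0) + (\<Sum>l\<in>{..<n-r}-{j0}. N $$ (i, l) * f l)"
        using N'e[OF i j0'(1)] by simp
      have "degree (\<Sum>l\<in>{..<n-r}-{j0}. N $$ (i, l) * f l) \<le> k j0"
        by (rule degree_sum_le) (use summand i in auto)
      then have deg0: "degree (N' $$ (i, j0)) \<le> k j0"
        unfolding e using deg[OF i j0'(1)] by (simp add: degree_add_le)
      have "coeff (N' $$ (i, j0)) (k j0) = coeff (N $$ (i, j0)) (k j0)
          + (\<Sum>l\<in>{..<n-r}-{j0}. coeff (N $$ (i, l)) (k l) * v $ l / v $ j0)"
        unfolding e coeff_add coeff_sum using summand i by simp
      also have "\<dots> = (\<Sum>l<n-r. coeff (N $$ (i, l)) (k l) * v $ l / v $ j0)"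
        using j0' by (subst sum.remove[of "{..<n-r}" j0]) auto
      also have "\<dots> = 0" using rel[OF i] by (simp add: sum_divide_distrib[symmetric])
      finally show ?thesis using deg0 by simp
    qed
    have n0: "n > 0" using j0' by simp
    have N'col: "col N' j0 \<in> carrier_vec n" using N'(1) j0' by auto
    show False
    proof (cases "k j0 = 0")
      case True
      have z: "N' $$ (i, j0) = 0" if "i < n" for i
        using top[OF that] True by (metis degree_eq_zeroE coeff_pCons_0 le_zero_eq pCons_0_0)
      obtain H where H: "H \<in> carrier_mat (n - r) (n - r)" "H * T' = 1\<^sub>m (n - r)"
        using unimodE[OF T'] by metis
      have "(V' * N') $$ (i, j0) = 0" if "i < n" for i
        using that j0' N'(1) carriers z by (auto simp: scalar_prod_def)
      then have "lower_rows r (V' * N') $$ (i, j0) = 0" if "i < n - r" for i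
        using that j0' N'(1) carriers by (simp add: lower_rows_def del: index_mult_mat(1))
      then have "T' $$ (i, j0) = 0" if "i < n - r" for i using that by (simp only: N'(3))
      then have "(H * T') $$ (j0, j0) = 0" using H(1) j0' T'c by (auto simp: scalar_prod_def)
      then show False using H(2) j0' by simp
    next
      case False
      have "degree (N' $$ (i, j0)) \<le> k j0 - 1" if "i < n" for i
      proof (rule degree_le, intro allI impI)
        fix l assume "k j0 - 1 < l"
        then have "l = k j0 \<or> l > k j0" by auto
        then show "coeff (N' $$ (i, j0)) l = 0"
          using top[OF that] by (elim disjE) (simp_all add: coeff_eq_0)
      qed
      then have "vec_degree (col N' j0) \<le> k j0 - 1"
        using vec_degree_le_iff[OF N'col n0] N'(1) j0' by auto
      then have lt: "vec_degree (col N' j0) < k j0" using False by simp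
      have "S T' = vec_degree (col N' j0) + (\<Sum>j\<in>{..<n-r}-{j0}. vec_degree (col N' j))"
        unfolding S_def N'_def[symmetric] using j0' by (intro sum.remove) auto
      also have "(\<Sum>j\<in>{..<n-r}-{j0}. vec_degree (col N' j)) = (\<Sum>j\<in>{..<n-r}-{j0}. k j)"
        by (intro sum.cong) (auto simp: col_eq k_def)
      also have "vec_degree (col N' j0) + (\<Sum>j\<in>{..<n-r}-{j0}. k j) < k j0 + (\<Sum>j\<in>{..<n-r}-{j0}. k j)"
        using lt by simp
      also have "\<dots> = (\<Sum>j<n-r. k j)" using j0' by (intro sum.remove[symmetric]) auto
      also have "\<dots> = S T" by (simp add: S_def k_def N_def)
      finally show False using least[OF T'] by simp
    qed
  qed
  then have "order 0 (det w) = 0" by (rule order_0I)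
  then have "int (\<Sum>j<n-r. k j) = kdeg" using kd(3) detT by simp
  then show ?thesis using T by (auto simp: k_def N_def)
qed

end

section \<open>Minimal bases of the kernel\<close>

lemma to_fract_hom: "comm_ring_hom (to_fract :: 'a::idom \<Rightarrow> 'a fract)"
  by unfold_locales auto

lemma to_fract_semiring_hom: "semiring_hom (to_fract :: 'a::idom \<Rightarrow> 'a fract)"
  using to_fract_hom unfolding comm_ring_hom_def ring_hom_def by blast

lemmas fract_mult = semiring_hom.mat_hom_mult[OF to_fract_semiring_hom]
lemmas fract_mult_vec = semiring_hom.mult_mat_vec_hom[OF to_fract_semiring_hom]
lemmas fract_det = comm_ring_hom.hom_det[OF to_fract_hom]
lemmas fract_inverse_pair = comm_ring_hom.inverse_pair_map[OF to_fract_hom]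
lemmas fract_rect_diag = semiring_hom.map_rect_diag[OF to_fract_semiring_hom]

lemma map_vec_to_fract_inj: "map_vec to_fract v = map_vec to_fract w \<longleftrightarrow> v = (w :: 'a::idom vec)"
  by (auto simp: vec_eq_iff)

lemma distinct_map_vec_to_fract: "distinct (map (map_vec to_fract) xs) \<longleftrightarrow> distinct (xs :: 'a::idom vec list)"
  by (simp add: distinct_map inj_on_def map_vec_to_fract_inj)

lemma cols_map_mat: "cols (map_mat f A) = map (map_vec f) (cols A)"
  by (intro nth_equalityI) auto

lemma mult_mat_vec_zero_iff:
  fixes T :: "'a::field mat"
  assumes "T \<in> carrier_mat k k" "det T \<noteq> 0" "v \<in> carrier_vec k" "T *\<^sub>v v = 0\<^sub>v k"
  shows "v = 0\<^sub>v k"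
  using det_0_iff_vec_prod_zero_field[OF assms(1)] assms by blast

context two_charts
begin

lemma kernel_rat: "kernel m n (rat_mat P)"
  using P by unfold_locales (simp add: rat_mat_def)

text \<open>Span and independence do not change when they are computed in the whole space instead of
in the kernel.\<close>

lemma polynomial_basis_iff:
  "polynomial_basis n (mat_kernel (rat_mat P)) xs \<longleftrightarrow> 
     distinct xs \<and> set xs \<subseteq> carrier_vec n \<and>
     map_vec to_fract ` set xs \<subseteq> mat_kernel (rat_mat P) \<and>
     \<not> module.lin_dep class_ring (module_vec TYPE('a poly fract) n) (map_vec to_fract ` set xs) \<and>
     LinearCombinations.module.span class_ring (module_vec TYPE('a poly fract) n) (map_vec to_fract ` set xs) = mat_kernel (rat_mat P)"
proof -
  interpret ker: kernel m n "rat_mat P" by (rule kernel_rat)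
  have "ker.basis B \<longleftrightarrow> \<not> ker.NC.lin_dep B \<and> ker.NC.span B = mat_kernel (rat_mat P) \<and> B \<subseteq> mat_kernel (rat_mat P)" for B
    unfolding ker.Ker.basis_def using ker.lindep_same[of B] ker.span_same[of B] by auto
  then show ?thesis unfolding polynomial_basis_def by auto
qed

text \<open>Over the field of fractions the kernel is spanned by the last columns of \<open>V\<close>, and a matrix \<open>T\<close> with nonzero
determinant is a change of basis there.\<close>

lemma basis_from_combination:
  assumes T: "T \<in> carrier_mat (n - r) (n - r)" and nz: "det T \<noteq> 0"
  shows "polynomial_basis n (mat_kernel (rat_mat P)) (cols (last_cols r V * T))"
proof -
  interpret ker: kernel m n "rat_mat P" by (rule kernel_rat)
  define N where "N = last_cols r V * T"
  note N = kernel_combination[OF T, folded N_def]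
  let ?N = "map_mat to_fract N"
  let ?T = "map_mat to_fract T"
  have Nc: "?N \<in> carrier_mat n (n - r)" and Tc: "?T \<in> carrier_mat (n - r) (n - r)" using N T by auto
  have nzT: "det ?T \<noteq> 0" using nz by (simp add: fract_det)
  have RN: "rat_mat P * ?N = 0\<^sub>m m (n - r)"
    unfolding rat_mat_def fract_mult[OF P N(1), symmetric] N(2) by (intro eq_matI) auto
  have indep: "v = 0\<^sub>v (n - r)" if v: "v \<in> carrier_vec (n - r)" "?N *\<^sub>v v = 0\<^sub>v n" for v
  proof -
    have "?T = lower_rows r (map_mat to_fract V' * ?N)"
      using arg_cong[OF N(3), of "map_mat to_fract"] carriers N(1)
      by (simp add: map_lower_rows fract_mult[of _ n n _ "n - r"])
    also have "\<dots> = lower_rows r (map_mat to_fract V') * ?N"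
      using carriers Nc by (simp add: lower_rows_mult[of _ n n _ "n - r"])
    finally have "?T *\<^sub>v v = lower_rows r (map_mat to_fract V') *\<^sub>v (?N *\<^sub>v v)"
      using carriers Nc v by (simp add: assoc_mult_mat_vec[of _ "n - r" n _ "n - r"])
    also have "\<dots> = 0\<^sub>v (n - r)"
      unfolding v(2) using carriers by (intro eq_vecI) (auto simp: lower_rows_def)
    finally show ?thesis using mult_mat_vec_zero_iff[OF Tc nzT v(1)] by simp
  qed
  have dist: "distinct (cols ?N)"
  proof (rule ccontr)
    assume "\<not> distinct (cols ?N)"
    then obtain i j where ij: "i < n - r" "j < n - r" "i \<noteq> j" "col ?N i = col ?N j"
      using Nc by (auto simp: distinct_conv_nth)
    have colN: "col N i = col N j" using ij Nc N(1) by (simp add: map_vec_to_fract_inj)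
    have "N $$ (a, i) = N $$ (a, j)" if "a < n" for a
      using arg_cong[OF colN, of "\<lambda>v. vec_index v a"] that ij(1,2) N(1) by simp
    note same = this
    have "?N *\<^sub>v (unit_vec (n - r) i - unit_vec (n - r) j) = ?N *\<^sub>v unit_vec (n - r) i - ?N *\<^sub>v unit_vec (n - r) j"
      by (rule mult_minus_distrib_mat_vec[OF Nc]) auto
    also have "\<dots> = 0\<^sub>v n"
      using ij Nc N(1) same by (intro eq_vecI) auto
    finally have "unit_vec (n - r) i - unit_vec (n - r) j = (0\<^sub>v (n - r) :: 'a poly fract vec)"
      by (intro indep) auto
    then show False using ij by (auto simp: vec_eq_iff)
  qed
  have sub: "set (cols ?N) \<subseteq> mat_kernel (rat_mat P)"
  proof
    fix x assume "x \<in> set (cols ?N)"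
    then obtain j where j: "j < n - r" "x = col ?N j" using Nc by (auto simp: cols_def)
    have "rat_mat P *\<^sub>v x = col (rat_mat P * ?N) j" using j Nc ker.A by (intro eq_vecI) auto
    then have "rat_mat P *\<^sub>v x = 0\<^sub>v m" unfolding RN using j by simp
    then show "x \<in> mat_kernel (rat_mat P)" using ker.A Nc j by (intro mat_kernelI) auto
  qed
  have span: "ker.NC.span (set (cols ?N)) = mat_kernel (rat_mat P)"
  proof
    show "ker.NC.span (set (cols ?N)) \<subseteq> mat_kernel (rat_mat P)"
      using ker.span_same[OF sub] ker.Ker.span_is_subset2[OF sub] by simp
    show "mat_kernel (rat_mat P) \<subseteq> ker.NC.span (set (cols ?N))"
    proof
      fix x assume "x \<in> mat_kernel (rat_mat P)"
      then have x: "x \<in> carrier_vec n" "rat_mat P *\<^sub>v x = 0\<^sub>v m" using mat_kernelD[OF ker.A] by auto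
      define xm where "xm = mat_of_cols n [x]"
      have xm: "xm \<in> carrier_mat n 1"
        using mat_of_cols_carrier(1)[of n "[x]"] by (simp add: xm_def)
      have Pxm: "rat_mat P * xm = 0\<^sub>m m 1"
      proof (rule eq_matI)
        fix i j assume ij: "i < dim_row (0\<^sub>m m 1)" "j < dim_col (0\<^sub>m m 1)"
        have "col xm 0 = x" using x(1) by (simp add: xm_def)
        then show "(rat_mat P * xm) $$ (i, j) = 0\<^sub>m m 1 $$ (i, j)"
          using ij ker.A xm x by (simp add: index_mult_mat_vec[symmetric] del: index_mult_mat_vec)
      qed (use ker.A xm in auto)
      let ?V = "map_mat to_fract V" and ?V' = "map_mat to_fract V'"
      have VV: "inverse_pair n ?V ?V'" by (rule fract_inverse_pair[OF V])
      have D: "map_mat to_fract U * rat_mat P * ?V = rect_diag m n r (\<lambda>i. to_fract (\<alpha> i))"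
        unfolding fract_rect_diag[symmetric] smithP[symmetric] rat_mat_def using carriers
        by (subst fract_mult[of _ m n _ n], force, force, subst fract_mult[of _ m m _ n]) auto
      have zero: "(?V' * xm) $$ (i, j) = 0" if "i < r" "j < 1" for i j
        by (rule kernel_upper_zero[OF ker.A _ _ _ _ D r _ xm Pxm that])
           (use carriers VV \<alpha> in \<open>auto simp: inverse_pair_def\<close>)
      have V'xm: "?V' * xm \<in> carrier_mat n 1" using carriers xm by auto
      define y where "y = lower_rows r (?V' * xm)"
      have yc: "y \<in> carrier_mat (n - r) 1" using V'xm by (simp add: y_def)
      have "xm = ?V * (?V' * xm)" using inverse_pair_cancel[OF VV xm] by simp
      also have "\<dots> = last_cols r ?V * y"
        unfolding y_def by (rule mult_upper_zero[OF _ V'xm r(2) zero]) (use carriers in auto)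
      finally have xy: "xm = last_cols r ?V * y" .
      obtain S where S: "S \<in> carrier_mat (n - r) (n - r)" "?T * S = 1\<^sub>m (n - r)"
        using det_non_zero_imp_unit[OF Tc nzT] by (auto simp: Units_def ring_mat_def)
      have Lc: "last_cols r ?V \<in> carrier_mat n (n - r)" using carriers by simp
      have NL: "?N = last_cols r ?V * ?T"
        unfolding N_def using carriers T
        by (subst fract_mult[of _ n "n - r" _ "n - r"]) (auto simp: map_last_cols)
      have "?N * (S * y) = last_cols r ?V * (?T * S * y)"
        unfolding NL assoc_mult_mat[OF Tc S(1) yc]
        by (rule assoc_mult_mat[OF Lc Tc]) (use S yc in auto)
      then have Nxm: "?N * (S * y) = xm" using S yc xy by simp
      define z where "z = col (S * y) 0"
      have z: "z \<in> carrier_vec (n - r)" unfolding z_def by (intro carrier_vecI) (use S yc in simp)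
      have "?N *\<^sub>v z = col (?N * (S * y)) 0" unfolding z_def using Nc S yc by (intro eq_vecI) auto
      also have "\<dots> = x" unfolding Nxm using x(1) by (simp add: xm_def)
      finally have "x = ker.NC.lincomb (\<lambda>a. z $ find_first a (cols ?N)) (set (cols ?N))"
        using ker.NC.lincomb_eq_mat_mult[OF Nc z dist] by simp
      then show "x \<in> ker.NC.span (set (cols ?N))" unfolding ker.NC.span_def by auto
    qed
  qed
  have li: "\<not> ker.NC.lin_dep (set (cols ?N))"
  proof
    assume "ker.NC.lin_dep (set (cols ?N))"
    then obtain v where "v \<in> carrier_vec (n - r)" "v \<noteq> 0\<^sub>v (n - r)" "?N *\<^sub>v v = 0\<^sub>v n"
      using ker.NC.lin_depE[OF Nc _ dist] by blast
    then show False using indep by blast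
  qed
  have set_eq: "set (cols ?N) = map_vec to_fract ` set (cols N)" by (simp add: cols_map_mat)
  show ?thesis
    unfolding polynomial_basis_iff N_def[symmetric] set_eq[symmetric]
  proof (intro conjI)
    show "distinct (cols N)" using dist by (simp add: cols_map_mat distinct_map_vec_to_fract)
    show "set (cols N) \<subseteq> carrier_vec n" using N(1) cols_dim by blast
  qed (use sub span li in auto)
qed

text \<open>The length comes from the dimension of the kernel. If the determinant vanished, a dependence between the
columns of the coordinate matrix would be a dependence between the basis vectors.\<close>

lemma polynomial_basisD:
  assumes "polynomial_basis n (mat_kernel (rat_mat P)) xs"
  defines "N \<equiv> mat_of_cols n xs"
  shows "length xs = n - r" "N \<in> carrier_mat n (n - r)" "P * N = 0\<^sub>m m (n - r)"
    "det (lower_rows r (V' * N)) \<noteq> 0"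
proof -
  interpret ker: kernel m n "rat_mat P" by (rule kernel_rat)
  have xs: "distinct xs" "set xs \<subseteq> carrier_vec n" "map_vec to_fract ` set xs \<subseteq> mat_kernel (rat_mat P)"
    "\<not> ker.NC.lin_dep (map_vec to_fract ` set xs)"
    using assms(1) unfolding polynomial_basis_iff by auto
  have card: "card (map_vec to_fract ` set ys) = length ys" if "distinct ys" for ys :: "'a poly vec list"
    using that distinct_card[of "map (map_vec to_fract) ys"] by (simp add: distinct_map_vec_to_fract)
  have dim: "ker.dim = length ys" if "polynomial_basis n (mat_kernel (rat_mat P)) ys" for ys
    using ker.Ker.dim_basis[of "map_vec to_fract ` set ys"] card[of ys] that
    by (simp add: polynomial_basis_def)
  show len: "length xs = n - r"
    using dim[OF assms(1)] dim[OF basis_from_combination[of "1\<^sub>m (n - r)"]] carriers by (auto simp: last_cols_def)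
  show N: "N \<in> carrier_mat n (n - r)" using len by (auto simp: N_def)
  have cN: "cols N = xs" unfolding N_def by (rule cols_mat_of_cols[OF xs(2)])
  have colN: "col N j \<in> set xs" if "j < n - r" for j
    using that N cN by (metis carrier_matD(2) cols_length cols_nth nth_mem)
  show PN: "P * N = 0\<^sub>m m (n - r)"
  proof (rule eq_matI)
    fix i j assume ij: "i < dim_row (0\<^sub>m m (n - r) :: 'a poly mat)" "j < dim_col (0\<^sub>m m (n - r) :: 'a poly mat)"
    then have "map_vec to_fract (col N j) \<in> mat_kernel (rat_mat P)" using colN xs(3) by auto
    then have "rat_mat P *\<^sub>v map_vec to_fract (col N j) = 0\<^sub>v m" using mat_kernelD[OF ker.A] by auto
    then have "map_vec to_fract (P *\<^sub>v col N j) = 0\<^sub>v m"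
      unfolding rat_mat_def using P N ij by (subst fract_mult_vec[of _ m n]) auto
    then have "to_fract ((P *\<^sub>v col N j) $ i) = 0" using ij P by (auto simp: vec_eq_iff)
    then show "(P * N) $$ (i, j) = 0\<^sub>m m (n - r) $$ (i, j)" using ij P N by simp
  qed (use P N in auto)
  define w where "w = lower_rows r (V' * N)"
  have VN: "V' * N \<in> carrier_mat n (n - r)" using carriers N by auto
  have wc: "w \<in> carrier_mat (n - r) (n - r)" unfolding w_def using VN by simp
  have top: "(V' * N) $$ (i, j) = 0" if "i < r" "j < n - r" for i j
    by (rule kernel_upper_zero[OF P _ _ _ _ smithP r \<alpha> N PN that])
       (use U V in \<open>auto simp: inverse_pair_def\<close>)
  have "V * (V' * N) = last_cols r V * w"
    unfolding w_def by (rule mult_upper_zero[OF inverse_pair_carrier(1)[OF V] VN r(2) top])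
  then have Nw: "N = last_cols r V * w" using inverse_pair_cancel[OF V N] by simp
  show "det (lower_rows r (V' * N)) \<noteq> 0"
    unfolding w_def[symmetric]
  proof
    assume "det w = 0"
    then obtain v where v: "v \<in> carrier_vec (n - r)" "v \<noteq> 0\<^sub>v (n - r)" "w *\<^sub>v v = 0\<^sub>v (n - r)"
      using det_0_iff_vec_prod_zero[OF wc] by blast
    have "N *\<^sub>v v = last_cols r V *\<^sub>v (w *\<^sub>v v)"
      by (subst Nw, rule assoc_mult_mat_vec[of _ n "n - r" _ "n - r"]) (use carriers wc v in auto)
    also have "\<dots> = 0\<^sub>v n" unfolding v(3) using carriers by (intro eq_vecI) (auto simp: last_cols_def)
    finally have Nv: "N *\<^sub>v v = 0\<^sub>v n" .
    have "map_mat to_fract N *\<^sub>v map_vec to_fract v = map_vec to_fract (N *\<^sub>v v)"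
      using N v by (subst fract_mult_vec[of _ n "n - r"]) auto
    also have "\<dots> = 0\<^sub>v n" unfolding Nv by (intro eq_vecI) auto
    finally have Nv': "map_mat to_fract N *\<^sub>v map_vec to_fract v = 0\<^sub>v n" .
    have "map_vec to_fract v \<noteq> 0\<^sub>v (n - r)"
      using v(1,2) by (auto simp: vec_eq_iff)
    then have "ker.NC.lin_dep (set (cols (map_mat to_fract N)))"
      using N v Nv' xs(1) cN by (intro ker.NC.lin_depI[of _ "n - r"]) (auto simp: cols_map_mat distinct_map_vec_to_fract)
    then show False using xs(4) cN by (simp add: cols_map_mat)
  qed
qed

lemma sum_vec_degree_cols:
  assumes "N \<in> carrier_mat n k"
  shows "sum_list (map vec_degree (cols N)) = (\<Sum>j<k. vec_degree (col N j))"
  using assms by (simp add: cols_def interv_sum_list_conv_sum_set_nat lessThan_atLeast0 o_def)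

lemma polynomial_basis_degree_ge:
  assumes "polynomial_basis n (mat_kernel (rat_mat P)) xs"
  shows "int (sum_list (map vec_degree xs)) \<ge> kdeg"
proof -
  define N where "N = mat_of_cols n xs"
  note N = polynomial_basisD[OF assms, folded N_def]
  have "set xs \<subseteq> carrier_vec n" using assms by (simp add: polynomial_basis_def)
  then have "cols N = xs" unfolding N_def by (rule cols_mat_of_cols)
  then have "sum_list (map vec_degree xs) = (\<Sum>j<n-r. vec_degree (col N j))"
    using sum_vec_degree_cols[OF N(2)] by simp
  moreover have "degree (N $$ (i, j)) \<le> vec_degree (col N j)" if "i < n" "j < n - r" for i j
    using degree_le_vec_degree[of "col N j" n i] that N(2) by auto
  ultimately show ?thesis
    using kernel_degree_formula(3)[OF N(2,3), of "\<lambda>j. vec_degree (col N j)"] N(4) by simp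
qed

text \<open>Minimality is a condition on a single basis: the lower bound \<open>polynomial_basis_degree_ge\<close> is attained by
column reduction.\<close>

lemma minimal_basis_iff:
  "minimal_basis n (mat_kernel (rat_mat P)) xs \<longleftrightarrow>
     polynomial_basis n (mat_kernel (rat_mat P)) xs \<and> int (sum_list (map vec_degree xs)) = kdeg"
proof -
  obtain T where T: "unimod (n - r) T" "int (\<Sum>j<n-r. vec_degree (col (last_cols r V * T) j)) = kdeg"
    using column_reduction by blast
  have Tc: "T \<in> carrier_mat (n - r) (n - r)" using T by auto
  have b: "polynomial_basis n (mat_kernel (rat_mat P)) (cols (last_cols r V * T))"
    using basis_from_combination[OF Tc] det_unimod[OF T(1)] by blast
  have s: "int (sum_list (map vec_degree (cols (last_cols r V * T)))) = kdeg"
    using T(2) sum_vec_degree_cols[OF kernel_combination(1)[OF Tc]] by simp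
  show ?thesis
    unfolding minimal_basis_def using b s polynomial_basis_degree_ge
    by (smt (verit) of_nat_le_iff)
qed

lemma column_minimal_indices_sum:
  assumes "column_minimal_indices P ds"
  shows "int (sum_list ds) = kdeg"
proof -
  from assms obtain xs where xs: "minimal_basis n (mat_kernel (rat_mat P)) xs" "ds = rev (sort (map vec_degree xs))"
    unfolding column_minimal_indices_def minimal_indices_def using P by auto
  have "sum_list ds = sum_list (map vec_degree xs)"
    unfolding xs(2) by (metis mset_rev mset_sort sum_mset_sum_list)
  then show ?thesis using xs(1) by (simp add: minimal_basis_iff)
qed

text \<open>Degree bounds whose sum is the smallest possible one must be equalities, so a basis within these bounds is
minimal and has exactly these degrees.\<close>

lemma column_minimal_indicesI:
  assumes T: "T \<in> carrier_mat (n - r) (n - r)" "det T \<noteq> 0"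
    and ds: "length ds = n - r" "sorted_wrt (\<ge>) ds" "int (sum_list ds) = kdeg"
    and deg: "\<And>i j. i < n \<Longrightarrow> j < n - r \<Longrightarrow> degree ((last_cols r V * T) $$ (i, j)) \<le> ds ! j"
  shows "column_minimal_indices P ds"
proof -
  define N where "N = last_cols r V * T"
  note N = kernel_combination[OF T(1), folded N_def]
  have b: "polynomial_basis n (mat_kernel (rat_mat P)) (cols N)"
    unfolding N_def by (rule basis_from_combination[OF T])
  have le: "vec_degree (col N j) \<le> ds ! j" if "j < n - r" for j
    using that N(1) deg[OF _ that, folded N_def] vec_degree_le_iff[of "col N j" n "ds ! j"] by auto
  have sds: "sum_list ds = (\<Sum>j<n-r. ds ! j)"
    using ds(1) by (simp add: sum_list_sum_nth lessThan_atLeast0)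
  have ge: "(\<Sum>j<n-r. ds ! j) \<le> (\<Sum>j<n-r. vec_degree (col N j))"
    using polynomial_basis_degree_ge[OF b]
    unfolding ds(3)[symmetric] of_nat_le_iff sum_vec_degree_cols[OF N(1)] sds .
  have eq: "vec_degree (col N j) = ds ! j" if "j < n - r" for j
  proof (rule ccontr)
    assume "vec_degree (col N j) \<noteq> ds ! j"
    then have "vec_degree (col N j) < ds ! j" using le[OF that] by simp
    then have "(\<Sum>j<n-r. vec_degree (col N j)) < (\<Sum>j<n-r. ds ! j)"
      using le that by (intro sum_strict_mono_ex1) auto
    then show False using ge by simp
  qed
  have map: "map vec_degree (cols N) = ds"
    using N(1) ds(1) eq by (intro nth_equalityI) auto
  have "minimal_basis n (mat_kernel (rat_mat P)) (cols N)"
    unfolding minimal_basis_iff using b map ds(3) by simp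
  moreover have "rev (sort ds) = ds"
  proof -
    have "sorted (rev ds)" using ds(2) by (simp add: sorted_wrt_rev)
    then have "sort (rev ds) = rev ds" by (rule sorted_sort_id)
    moreover have "sort (rev ds) = sort ds" by (rule properties_for_sort) auto
    ultimately show ?thesis by simp
  qed
  ultimately show ?thesis
    unfolding column_minimal_indices_def minimal_indices_def using P map by auto
qed

end

section \<open>Rank, degree and reversal\<close>

lemma rect_diag_mult_rect_diag:
  fixes f g :: "nat \<Rightarrow> 'a::comm_ring_1"
  assumes "r \<le> b" 
  shows "rect_diag a b r f * rect_diag b c r g = rect_diag a c r (\<lambda>i. f i * g i)"
proof (rule eq_matI)
  fix i j assume "i < dim_row (rect_diag a c r (\<lambda>i. f i * g i))" "j < dim_col (rect_diag a c r (\<lambda>i. f i * g i))"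
  then have ij: "i < a" "j < c" by auto
  show "(rect_diag a b r f * rect_diag b c r g) $$ (i, j) = rect_diag a c r (\<lambda>i. f i * g i) $$ (i, j)"
    using ij assms by (subst index_rect_diag_mult[of _ b c]) (auto simp: rect_diag_def)
qed auto

lemma (in vec_space) rank_eq_if_col_space_eq:
  assumes "span (set (cols A)) = span (set (cols B))"
  shows "rank A = rank B"
  using assms by (simp add: rank_def)

lemma (in vec_space) col_space_mult_subset:
  assumes "B \<in> carrier_mat n k" "G \<in> carrier_mat k l"
  shows "span (set (cols (B * G))) \<subseteq> span (set (cols B))"
proof -
  have "col_space (B * G) \<subseteq> col_space B"
    unfolding col_space_eq[OF assms(1)] col_space_eq[OF mult_carrier_mat[OF assms]]
    using assms by (auto simp: assoc_mult_mat_vec)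
  then show ?thesis by (simp add: col_space_def)
qed

lemma dvd_mult_entries:
  fixes A B M :: "'b::comm_ring_1 mat"
  assumes "A \<in> carrier_mat a m" "M \<in> carrier_mat m n" "B \<in> carrier_mat n b"
    "\<And>i j. i < m \<Longrightarrow> j < n \<Longrightarrow> p dvd M $$ (i, j)" "i < a" "j < b"
  shows "p dvd (A * M * B) $$ (i, j)"
proof -
  have "p dvd (A * M) $$ (i, k)" if "k < n" for k
    using assms that by (auto simp: scalar_prod_def intro!: dvd_sum dvd_mult)
  then have "p dvd (\<Sum>k\<in>{0..<n}. (A * M) $$ (i, k) * B $$ (k, j))"
    by (intro dvd_sum dvd_mult2) auto
  also have "\<dots> = (A * M * B) $$ (i, j)"
    using assms by (auto simp: scalar_prod_def simp del: assoc_mult_mat intro!: sum.cong)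
  finally show ?thesis .
qed

context two_charts
begin

text \<open>The column space of \<open>P\<close> over the field of fractions is spanned by the first \<open>r\<close> columns of the inverse of \<open>U\<close>,
and these are independent.\<close>

lemma poly_rank_eq: "poly_rank P = r"
proof -
  interpret vs: vec_space "TYPE('a poly fract)" m .
  let ?A = "rat_mat P" and ?V = "map_mat to_fract V" and ?V' = "map_mat to_fract V'"
  let ?U = "map_mat to_fract U" and ?U' = "map_mat to_fract U'"
  let ?D = "rect_diag m n r (\<lambda>i. to_fract (\<alpha> i))"
  have VV: "inverse_pair n ?V ?V'" by (rule fract_inverse_pair[OF V])
  have UU: "inverse_pair m ?U ?U'" by (rule fract_inverse_pair[OF U])
  have c: "?A \<in> carrier_mat m n" "?V \<in> carrier_mat n n" "?V' \<in> carrier_mat n n"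
    "?U \<in> carrier_mat m m" "?U' \<in> carrier_mat m m" using carriers by (auto simp: rat_mat_def)
  have D: "?U * ?A * ?V = ?D"
    unfolding fract_rect_diag[symmetric] smithP[symmetric] rat_mat_def using carriers
    by (subst fract_mult[of _ m n _ n], force, force, subst fract_mult[of _ m m _ n]) auto
  have AV: "?A * ?V = ?U' * ?D"
    unfolding D[symmetric] assoc_mult_mat[OF c(4) c(1) c(2)]
    by (rule inverse_pair_cancel(2)[OF UU, symmetric, of _ n]) (use c in auto)
  define B where "B = ?U' * rect_diag m r r (\<lambda>i. 1)"
  have B: "B \<in> carrier_mat m r" using c by (auto simp: B_def)
  have "?A = ?A * ?V * ?V'" using inverse_pair_cancel_right(1)[OF VV c(1)] by simp
  also have "\<dots> = ?U' * (rect_diag m r r (\<lambda>i. 1) * rect_diag r n r (\<lambda>i. to_fract (\<alpha> i))) * ?V'"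
    unfolding AV using r by (simp add: rect_diag_mult_rect_diag)
  also have "?U' * (rect_diag m r r (\<lambda>i. 1) * rect_diag r n r (\<lambda>i. to_fract (\<alpha> i))) = B * rect_diag r n r (\<lambda>i. to_fract (\<alpha> i))"
    unfolding B_def by (rule assoc_mult_mat[symmetric, of _ m m _ r _ n]) (use c in auto)
  also have "\<dots> * ?V' = B * (rect_diag r n r (\<lambda>i. to_fract (\<alpha> i)) * ?V')"
    by (rule assoc_mult_mat[OF B]) (use c in auto)
  finally have AB: "?A = B * (rect_diag r n r (\<lambda>i. to_fract (\<alpha> i)) * ?V')" .
  have d1: "rect_diag m r r (\<lambda>i. 1) = ?D * rect_diag n r r (\<lambda>i. inverse (to_fract (\<alpha> i)))"
    using r \<alpha> by (simp add: rect_diag_mult_rect_diag) (auto simp: rect_diag_def)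
  have "B = ?U' * ?D * rect_diag n r r (\<lambda>i. inverse (to_fract (\<alpha> i)))"
    unfolding B_def d1 by (rule assoc_mult_mat[symmetric, of _ m m _ n _ r]) (use c in auto)
  also have "\<dots> = ?A * (?V * rect_diag n r r (\<lambda>i. inverse (to_fract (\<alpha> i))))"
    unfolding AV[symmetric] by (rule assoc_mult_mat[of _ m n _ n _ r]) (use c in auto)
  finally have BA: "B = ?A * (?V * rect_diag n r r (\<lambda>i. inverse (to_fract (\<alpha> i))))" .
  have "vs.span (set (cols ?A)) \<subseteq> vs.span (set (cols B))"
    by (subst AB, rule vs.col_space_mult_subset[OF B]) (use c in auto)
  moreover have "vs.span (set (cols B)) \<subseteq> vs.span (set (cols ?A))"
    by (subst BA, rule vs.col_space_mult_subset[OF c(1)]) (use c in auto)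
  ultimately have rk: "vs.rank ?A = vs.rank B" by (intro vs.rank_eq_if_col_space_eq) auto
  have indep: "v = 0\<^sub>v r" if v: "v \<in> carrier_vec r" "B *\<^sub>v v = 0\<^sub>v m" for v
  proof -
    have "rect_diag m r r (\<lambda>i. 1) = ?U * B"
      unfolding B_def by (rule inverse_pair_cancel(1)[OF UU, symmetric, of _ r]) auto
    then have "rect_diag m r r (\<lambda>i. 1) *\<^sub>v v = ?U *\<^sub>v (B *\<^sub>v v)"
      using assoc_mult_mat_vec[OF c(4) B v(1)] by simp
    also have "\<dots> = 0\<^sub>v m" unfolding v(2) using c by (intro eq_vecI) auto
    finally have z: "rect_diag m r r (\<lambda>i. 1) *\<^sub>v v = 0\<^sub>v m" .
    show ?thesis
    proof (rule eq_vecI)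
      fix i assume i: "i < dim_vec (0\<^sub>v r :: 'a poly fract vec)"
      have "(rect_diag m r r (\<lambda>i. 1) *\<^sub>v v) $ i = (\<Sum>j<r. (if i = j then 1 else 0) * v $ j)"
        using i r v(1) by (auto simp: rect_diag_def scalar_prod_def lessThan_atLeast0 intro!: sum.cong)
      also have "\<dots> = (\<Sum>j<r. if j = i then v $ j else 0)" by (intro sum.cong) auto
      also have "\<dots> = v $ i" using i by (simp add: sum.delta)
      finally show "v $ i = 0\<^sub>v r $ i" using z i r by simp
    qed (use v in auto)
  qed
  have dist: "distinct (cols B)"
  proof (rule ccontr)
    assume "\<not> distinct (cols B)"
    then obtain i j where ij: "i < r" "j < r" "i \<noteq> j" "col B i = col B j"
      using B by (auto simp: distinct_conv_nth)
    have same: "B $$ (a, i) = B $$ (a, j)" if "a < m" for a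
      using arg_cong[OF ij(4), of "\<lambda>v. vec_index v a"] that ij(1,2) B by simp
    have "B *\<^sub>v (unit_vec r i - unit_vec r j) = B *\<^sub>v unit_vec r i - B *\<^sub>v unit_vec r j"
      by (rule mult_minus_distrib_mat_vec[OF B]) auto
    also have "\<dots> = 0\<^sub>v m"
      using ij B same by (intro eq_vecI) auto
    finally have "unit_vec r i - unit_vec r j = (0\<^sub>v r :: 'a poly fract vec)"
      by (intro indep) auto
    then show False using ij by (auto simp: vec_eq_iff)
  qed
  have "\<not> vs.lin_dep (set (cols B))"
    using vs.lin_depE[OF B _ dist] indep by metis
  then have "vs.rank B = r" using vs.lin_indpt_full_rank[OF B dist] by simp
  then show ?thesis using rk P by (simp add: poly_rank_def)
qed

lemma degree_entries_le: "i < m \<Longrightarrow> j < n \<Longrightarrow> degree (P $$ (i, j)) \<le> d"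
  and reversal_entries: "i < m \<Longrightarrow> j < n \<Longrightarrow> Q $$ (i, j) = rev_poly d (P $$ (i, j))"
proof -
  have *: "in_t (Q $$ (i, j)) = fls_X ^ d * in_inv_t (P $$ (i, j))" if "i < m" "j < n"
    using arg_cong[OF charts, of "\<lambda>M. M $$ (i, j)"] that P Q by simp
  show "i < m \<Longrightarrow> j < n \<Longrightarrow> degree (P $$ (i, j)) \<le> d"
    "i < m \<Longrightarrow> j < n \<Longrightarrow> Q $$ (i, j) = rev_poly d (P $$ (i, j))"
    using * in_t_eq_iff by blast+
qed

text \<open>Both sides say that \<open>t\<close> divides the reversal: unimodular factors neither create nor destroy common
divisors of the entries.\<close>

lemma reversal_vanishes_iff:
  "(\<forall>i<m. \<forall>j<n. [:0, 1:] dvd Q $$ (i, j)) \<longleftrightarrow> (\<forall>i<r. [:0, 1:] dvd \<beta> i)"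
proof
  assume *: "\<forall>i<m. \<forall>j<n. [:0, 1:] dvd Q $$ (i, j)"
  show "\<forall>i<r. [:0, 1:] dvd \<beta> i"
  proof (intro allI impI)
    fix i assume i: "i < r"
    have "[:0, 1:] dvd (W * Q * Z) $$ (i, i)"
      by (rule dvd_mult_entries[of _ m m _ n _ n]) (use carriers * i r in auto)
    then show "[:0, 1:] dvd \<beta> i" unfolding smithQ using i r by (simp add: rect_diag_def)
  qed
next
  assume *: "\<forall>i<r. [:0, 1:] dvd \<beta> i"
  have WQ: "W * Q \<in> carrier_mat m n" and WQZ: "W * Q * Z \<in> carrier_mat m n" using carriers by auto
  have "W' * (W * Q * Z) * Z' = W' * (W * Q * Z * Z')"
    by (rule assoc_mult_mat[OF _ WQZ]) (use carriers in auto)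
  also have "\<dots> = Q" using inverse_pair_cancel_right(1)[OF Z WQ] inverse_pair_cancel(2)[OF W Q] by simp
  finally have Q': "Q = W' * rect_diag m n r \<beta> * Z'" by (simp only: smithQ)
  show "\<forall>i<m. \<forall>j<n. [:0, 1:] dvd Q $$ (i, j)"
  proof (intro allI impI)
    fix i j assume ij: "i < m" "j < n"
    show "[:0, 1:] dvd Q $$ (i, j)"
      by (subst Q', rule dvd_mult_entries[of _ m m _ n _ n]) (use carriers * ij in \<open>auto simp: rect_diag_def\<close>)
  qed
qed

end

section \<open>Construction of a matrix by gluing\<close>

lemma order_0_rev_poly:
  fixes p :: "'a::field poly"
  assumes "p \<noteq> 0" "degree p \<le> k"
  shows "rev_poly k p \<noteq> 0" "order 0 (rev_poly k p) = k - degree p"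
proof -
  have eq: "in_t (rev_poly k p) = fls_X ^ k * in_inv_t p" using in_t_eq_iff[of "rev_poly k p" k p] assms by simp
  then show nz: "rev_poly k p \<noteq> 0" using assms by auto
  have "int (order 0 (rev_poly k p)) = int k - int (degree p)"
    using arg_cong[OF eq, of fls_subdegree] nz assms by (simp add: subdegree_leval_X subdegree_leval_inv_X)
  then show "order 0 (rev_poly k p) = k - degree p" using assms by simp
qed

text \<open>The matrix \<open>X\<close> with diagonal exponents \<open>g i + b i - d\<close> and then \<open>v\<close> dictates through the gluing equation the
upper block of the second transition matrix: it is diagonal with exponents \<open>b i\<close> except for Laurent polynomials
\<open>y i j\<close> in rows with \<open>g i \<le> d\<close> and columns with \<open>g j > d\<close>. Start with an extension gluing \<open>M\<close> of
exponents \<open>b i\<close> and then \<open>- k j\<close>, whose upper block is diagonal. Since \<open>b i \<ge> 0\<close>, every \<open>y i j\<close> is the sum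
of an element of \<open>F[t]\<close> and \<open>t^(b i)\<close> times an element of \<open>F[1/t]\<close>, and shears over \<open>F[t]\<close> on the left and over
\<open>F[1/t]\<close> on the right insert it without losing the factorization. The lower blocks of both transition
matrices are diagonal, and this bounds the degrees of the kernel bases.\<close>

theorem gluing_construction:
  fixes \<alpha> :: "nat \<Rightarrow> 'a::field poly" and g b v k :: "nat \<Rightarrow> nat"
  assumes r: "r \<le> m" "r \<le> n"
    and \<alpha>: "\<And>i. i < r \<Longrightarrow> \<alpha> i \<noteq> 0 \<and> degree (\<alpha> i) \<le> g i"
    and chain: "\<And>i j. i < r \<Longrightarrow> j < r \<Longrightarrow> g i < g j \<Longrightarrow> rev_poly (g i) (\<alpha> i) dvd rev_poly (g j) (\<alpha> j)"
    and b: "\<And>i. i < r \<Longrightarrow> b i \<noteq> 0 \<Longrightarrow> g i + b i \<le> d"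
    and sum_b: "(\<Sum>i<r. b i) = (\<Sum>j<n-r. k j)"
    and sum: "(\<Sum>i<r. g i) + (\<Sum>j<n-r. k j) + (\<Sum>j<m-r. v j) = r * d"
  obtains P Q U U' V V' W W' Z Z' where
    "two_charts m n r d P Q U U' V V' W W' Z Z' \<alpha> (\<lambda>i. rev_poly (g i) (\<alpha> i))"
    "\<And>i j. i < n \<Longrightarrow> j < n - r \<Longrightarrow> degree (V $$ (i, j + r)) \<le> k j"
    "\<And>i j. i < m - r \<Longrightarrow> j < m \<Longrightarrow> degree (U $$ (i + r, j)) \<le> v i"
proof -
  let ?t = "fls_X :: 'a fls"
  define \<gamma> where "\<gamma> i = rev_poly (g i) (\<alpha> i)" for i
  have \<gamma>nz: "\<gamma> i \<noteq> 0" if "i < r" for i using \<alpha>[OF that] order_0_rev_poly unfolding \<gamma>_def by blast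
  have \<gamma>t: "in_t (\<gamma> i) = ?t ^ g i * in_inv_t (\<alpha> i)" if "i < r" for i
    using \<alpha>[OF that] in_t_eq_iff[of "\<gamma> i" "g i" "\<alpha> i"] by (simp add: \<gamma>_def)
  have t0: "?t \<noteq> 0" by simp
  have shift_sum: "(\<Sum>i<N. if i < r then f i else h (i - r)) = (\<Sum>i<r. f i) + (\<Sum>j<N-r. h j)"
    if "r \<le> N" for N and f h :: "nat \<Rightarrow> int"
  proof -
    have "(\<Sum>i<N. if i < r then f i else h (i - r)) = (\<Sum>i<r. f i) + (\<Sum>i\<in>{r..<N}. h (i - r))"
      using that sum.atLeastLessThan_concat[of 0 r N "\<lambda>i. if i < r then f i else h (i - r)"]
      by (simp add: lessThan_atLeast0)
    also have "(\<Sum>i\<in>{r..<N}. h (i - r)) = (\<Sum>j<N-r. h j)"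
      using that sum.shift_bounds_nat_ivl[of "\<lambda>i. h (i - r)" 0 r "N - r"] by (simp add: lessThan_atLeast0)
    finally show ?thesis .
  qed
  define \<epsilon> where "\<epsilon> i = (if i < r then int (g i) + int (b i) - int d else int (v (i - r)))" for i
  define \<delta> where "\<delta> i = (if i < r then int (b i) else - int (k (i - r)))" for i
  have "(\<Sum>i<m. \<epsilon> i) = (\<Sum>i<r. int (g i) + int (b i) - int d) + (\<Sum>j<m-r. int (v j))"
    unfolding \<epsilon>_def by (rule shift_sum[OF r(1)])
  also have "\<dots> = int ((\<Sum>i<r. g i) + (\<Sum>i<r. b i) + (\<Sum>j<m-r. v j)) - int (r * d)"
    by (simp add: sum.distrib sum_subtractf)
  also have "\<dots> = 0" using sum sum_b by simp
  finally have sum\<epsilon>: "(\<Sum>i<m. \<epsilon> i) = 0" .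
  have "(\<Sum>i<n. \<delta> i) = (\<Sum>i<r. int (b i)) + (\<Sum>j<n-r. - int (k j))"
    unfolding \<delta>_def by (rule shift_sum[OF r(2)])
  also have "\<dots> = int (\<Sum>i<r. b i) - int (\<Sum>j<n-r. k j)" by (simp add: sum_negf)
  finally have sum\<delta>: "(\<Sum>i<n. \<delta> i) = 0" using sum_b by simp
  obtain X where X: "extension_gluing ?t m \<epsilon> X" using extension_gluing_exists[OF t0 sum\<epsilon>] by blast
  obtain M where M: "extension_gluing ?t n \<delta> M" using extension_gluing_exists[OF t0 sum\<delta>] by blast
  have Xtriv: "birkhoff_trivial ?t m X" and Mtriv: "birkhoff_trivial ?t n M"
    using X M by (auto simp: extension_gluing_def)
  have Xc: "X \<in> carrier_mat m m" and Mc: "M \<in> carrier_mat n n"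
    using Xtriv Mtriv birkhoff_trivial_carrier by auto
  have Xd: "X $$ (i, i) = ?t powi \<epsilon> i" if "i < m" for i using X that by (auto simp: extension_gluing_def)
  have Xo: "X $$ (i, j) = 0" if "i < m" "j < m" "i \<noteq> j" "\<epsilon> i \<ge> 0 \<or> \<epsilon> j \<le> 0" for i j
    using X that unfolding extension_gluing_def by (meson not_le)
  have Md: "M $$ (i, i) = ?t powi \<delta> i" if "i < n" for i using M that by (auto simp: extension_gluing_def)
  have Mo: "M $$ (i, j) = 0" if "i < n" "j < n" "i \<noteq> j" "\<delta> i \<ge> 0 \<or> \<delta> j \<le> 0" for i j
    using M that unfolding extension_gluing_def by (meson not_le)
  define A where "A = {i. i < r \<and> g i \<le> d}"
  \<comment> \<open>The gluing equation forces these entries of the second transition matrix.\<close>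
  define y where "y i j = X $$ (i, j) * ?t powi (int d - int (g j)) * in_t (\<gamma> j div \<gamma> i)" for i j
  have "\<exists>p q. y i j = in_inv_t p * ?t powi int (b i) + in_t q" if "i < m" "j < m" for i j
  proof -
    have "laurent ?t (y i j)"
      unfolding y_def using birkhoff_trivial_laurent[OF t0 Xtriv that]
      by (intro laurent_mult t0 laurent_powi laurent_leval)
    then show ?thesis using laurent_split[OF t0, of "y i j" 0 "int (b i)"] by auto
  qed
  then obtain p q where pq: "\<And>i j. i < m \<Longrightarrow> j < m \<Longrightarrow> y i j = in_inv_t (p i j) * ?t powi int (b i) + in_t (q i j)"
    by metis
  define Q1 where "Q1 = block_shear n A (\<lambda>i j. if j < r then q i j else 0)"
  define Q2 where "Q2 = block_shear n A (\<lambda>i j. if j < r then p i j else 0)"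
  define Y1 where "Y1 = map_mat in_t Q1 * M"
  define Y where "Y = Y1 * map_mat in_inv_t Q2"
  have "birkhoff_trivial ?t n Y"
    unfolding Y_def Y1_def by (rule birkhoff_trivial_mult[OF Mtriv]) (auto simp: Q1_def Q2_def unimod_block_shear)
  have Y1c: "Y1 \<in> carrier_mat n n" unfolding Y1_def using Mc by (auto simp: Q1_def)
  have \<delta>up: "\<delta> j = 0" if "j < r" "j \<notin> A" for j
    using b[of j] that by (auto simp: \<delta>_def A_def)
  have Mrow: "M $$ (i, j) = (if i = j then ?t powi \<delta> i else 0)" if "i < r" "j < n" for i j
    using Mo[of i j] Md[of i] that r by (auto simp: \<delta>_def)
  have Mcol: "M $$ (i, j) = (if i = j then ?t powi \<delta> i else 0)" if "i < n" "r \<le> j" "j < n" for i j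
    using Mo[of i j] Md[of i] that r by (auto simp: \<delta>_def)
  have Y1: "Y1 $$ (i, j) = M $$ (i, j) + (if i \<in> A \<and> j < r \<and> j \<notin> A then in_t (q i j) else 0)"
    if ij: "i < n" "j < n" for i j
  proof -
    have "(\<Sum>l\<in>{..<n}-A. in_t (if l < r then q i l else 0) * M $$ (l, j)) =
      (\<Sum>l\<in>{..<n}-A. if l = j then if j < r then in_t (q i j) else 0 else 0)"
      using ij by (intro sum.cong) (auto simp: Mrow \<delta>up)
    also have "\<dots> = (if j < r \<and> j \<notin> A then in_t (q i j) else 0)"
      using ij by (auto simp: sum.delta)
    finally show ?thesis
      unfolding Y1_def Q1_def map_block_shear index_block_shear_mult[OF Mc ij] by auto
  qed
  have Y: "Y $$ (i, j) = Y1 $$ (i, j) + (if i \<in> A \<and> j < r \<and> j \<notin> A then in_inv_t (p i j) * ?t powi int (b i) else 0)"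
    if ij: "i < n" "j < n" "i < r \<or> r \<le> j" for i j
  proof -
    have "(\<Sum>l\<in>{..<n}\<inter>A. Y1 $$ (i, l) * in_inv_t (if j < r then p l j else 0)) =
      (\<Sum>l\<in>{..<n}\<inter>A. if l = i then if j < r then in_inv_t (p i j) * ?t powi int (b i) else 0 else 0)"
    proof (intro sum.cong refl)
      fix l assume l: "l \<in> {..<n} \<inter> A"
      then have "l < r" by (auto simp: A_def)
      show "Y1 $$ (i, l) * in_inv_t (if j < r then p l j else 0) =
         (if l = i then if j < r then in_inv_t (p i j) * ?t powi int (b i) else 0 else 0)"
      proof (cases "j < r")
        case True
        then have "i < r" using ij by auto
        then show ?thesis using l \<open>l < r\<close> ij True by (auto simp: Y1 Mrow \<delta>_def mult.commute)
      qed auto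
    qed
    also have "\<dots> = (if i \<in> A \<and> j < r then in_inv_t (p i j) * ?t powi int (b i) else 0)"
      using ij by (auto simp: sum.delta)
    finally show ?thesis
      unfolding Y_def Q2_def map_block_shear index_mult_block_shear[OF Y1c ij(1,2)] by auto
  qed
  have Ycol: "Y $$ (i, j) = (if i = j then ?t powi (- int (k (j - r))) else 0)" if "i < n" "r \<le> j" "j < n" for i j
    using that by (auto simp: Y Y1 Mcol \<delta>_def)
  have Yblock: "Y $$ (i, j) = (if i = j then ?t powi int (b i) else if i \<in> A \<and> j \<notin> A then y i j else 0)"
    if "i < r" "j < r" for i j
    using that r by (auto simp: Y Y1 Mrow \<delta>_def pq)
  have key: "X * rect_diag m n r (\<lambda>i. ?t ^ d * in_inv_t (\<alpha> i)) = rect_diag m n r (\<lambda>i. in_t (\<gamma> i)) * Y"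
  proof (rule eq_matI)
    fix i j assume "i < dim_row (rect_diag m n r (\<lambda>i. in_t (\<gamma> i)) * Y)" "j < dim_col (rect_diag m n r (\<lambda>i. in_t (\<gamma> i)) * Y)"
    then have ij: "i < m" "j < n" using Y1c by (auto simp: Y_def Q2_def)
    have Yc: "Y \<in> carrier_mat n n" using Y1c by (auto simp: Y_def Q2_def)
    have td: "?t ^ d * in_inv_t (\<alpha> j) = ?t powi (int d - int (g j)) * in_t (\<gamma> j)" if "j < r" for j
    proof -
      have "?t powi (int d - int (g j)) * ?t powi int (g j) = ?t powi int d"
        by (subst power_int_add[symmetric]) auto
      then have "?t ^ d = ?t powi (int d - int (g j)) * ?t ^ g j"
        by (simp only: power_int_of_nat)
      then show ?thesis unfolding \<gamma>t[OF that] by (simp only: mult.assoc)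
    qed
    have eq: "(X * rect_diag m n r (\<lambda>i. ?t ^ d * in_inv_t (\<alpha> i))) $$ (i, j) =
          (if j < r then X $$ (i, j) * (?t powi (int d - int (g j)) * in_t (\<gamma> j)) else 0)"
      using ij r Xc td by (subst index_mult_rect_diag[of _ m m]) auto
    have eq': "(rect_diag m n r (\<lambda>i. in_t (\<gamma> i)) * Y) $$ (i, j) = (if i < r then in_t (\<gamma> i) * Y $$ (i, j) else 0)"
      using ij r Yc by (subst index_rect_diag_mult[of _ n n]) auto
    consider "j \<ge> r" | "j < r" "i \<ge> r" | "j < r" "i = j" | "j < r" "i < r" "i \<noteq> j" "i \<in> A" "j \<notin> A"
      | "j < r" "i < r" "i \<noteq> j" "\<not> (i \<in> A \<and> j \<notin> A)" by linarith
    then show "(X * rect_diag m n r (\<lambda>i. ?t ^ d * in_inv_t (\<alpha> i))) $$ (i, j) = (rect_diag m n r (\<lambda>i. in_t (\<gamma> i)) * Y) $$ (i, j)"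
    proof cases
      case 1
      then show ?thesis unfolding eq eq' using ij r Ycol[of i j] by auto
    next
      case 2
      have "X $$ (i, j) = 0" using Xo[of i j] 2 ij r by (auto simp: \<epsilon>_def)
      then show ?thesis unfolding eq eq' using 2 by auto
    next
      case 3
      then have ji: "j < m" "j < n" using ij by auto
      have *: "?t powi \<epsilon> j * ?t powi (int d - int (g j)) = ?t powi int (b j)"
        using 3 by (subst power_int_add[symmetric]) (auto simp: \<epsilon>_def)
      have "X $$ (j, j) * (?t powi (int d - int (g j)) * in_t (\<gamma> j)) = ?t powi int (b j) * in_t (\<gamma> j)"
        unfolding Xd[OF ji(1)] mult.assoc[symmetric] * ..
      also have "\<dots> = in_t (\<gamma> j) * Y $$ (j, j)"
        using Yblock[of j j] 3(1) by (simp only: refl if_True mult.commute)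
      finally show ?thesis unfolding eq eq' using 3 by simp
    next
      case 4
      then have "\<gamma> i dvd \<gamma> j" using chain[of i j] by (auto simp: A_def \<gamma>_def)
      then have "in_t (\<gamma> j) = in_t (\<gamma> i) * in_t (\<gamma> j div \<gamma> i)"
        by (simp add: leval.hom_mult[symmetric])
      then show ?thesis unfolding eq eq' using 4 Yblock[of i j] by (simp add: y_def algebra_simps)
    next
      case 5
      have "\<epsilon> i \<ge> 0 \<or> \<epsilon> j \<le> 0" using 5 b[of j] by (auto simp: A_def \<epsilon>_def)
      then have "X $$ (i, j) = 0" using Xo[of i j] 5 ij r by auto
      then show ?thesis unfolding eq eq' using 5 Yblock[of i j] by auto
    qed
  qed (use Xc Y1c in \<open>auto simp: Y_def Q2_def\<close>)
  from Xtriv obtain W U' where WU: "unimod m W" "unimod m U'" "X = map_mat in_t W * map_mat in_inv_t U'"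
    by (auto simp: birkhoff_trivial_def)
  from \<open>birkhoff_trivial ?t n Y\<close> obtain Z' V where ZV: "unimod n Z'" "unimod n V" "Y = map_mat in_t Z' * map_mat in_inv_t V"
    by (auto simp: birkhoff_trivial_def)
  obtain W' where W: "inverse_pair m W W'" using WU(1) unimod_inverse_pair by blast
  obtain U where U: "inverse_pair m U U'" using WU(2) unimod_inverse_pair inverse_pair_sym by blast
  obtain Z where Z: "inverse_pair n Z Z'" using ZV(1) unimod_inverse_pair inverse_pair_sym by blast
  obtain V' where V: "inverse_pair n V V'" using ZV(2) unimod_inverse_pair by blast
  note carriers = inverse_pair_carrier[OF W] inverse_pair_carrier[OF U] inverse_pair_carrier[OF Z] inverse_pair_carrier[OF V]
  define P where "P = U' * rect_diag m n r \<alpha> * V'"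
  define Q where "Q = W' * rect_diag m n r \<gamma> * Z'"
  have Pc: "P \<in> carrier_mat m n" and Qc: "Q \<in> carrier_mat m n" unfolding P_def Q_def using carriers by auto
  have conj: "G * (G' * D * H') * H = D"
    if "inverse_pair m G G'" "inverse_pair n H H'" "D \<in> carrier_mat m n" for G G' H H' D :: "'a poly mat"
  proof -
    note c = inverse_pair_carrier[OF that(1)] inverse_pair_carrier[OF that(2)]
    have "G * (G' * D * H') = G * (G' * (D * H'))"
      by (subst assoc_mult_mat[of G' m m D n H' n]) (use c that in auto)
    also have "\<dots> = D * H'" by (rule inverse_pair_cancel(1)[OF that(1), of _ n]) (use c that in auto)
    finally show ?thesis using inverse_pair_cancel_right(2)[OF that(2,3)] by simp
  qed
  have charts: "map_mat in_t Q = ?t ^ d \<cdot>\<^sub>m map_mat in_inv_t P"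
  proof -
    let ?Da = "rect_diag m n r (\<lambda>i. ?t ^ d * in_inv_t (\<alpha> i))" and ?Dc = "rect_diag m n r (\<lambda>i. in_t (\<gamma> i))"
    let ?W = "map_mat in_t W" and ?W' = "map_mat in_t W'" and ?U' = "map_mat in_inv_t U'"
    let ?Z' = "map_mat in_t Z'" and ?V = "map_mat in_inv_t V" and ?V' = "map_mat in_inv_t V'"
    have c: "?W \<in> carrier_mat m m" "?W' \<in> carrier_mat m m" "?U' \<in> carrier_mat m m"
      "?Z' \<in> carrier_mat n n" "?V \<in> carrier_mat n n" "?V' \<in> carrier_mat n n" using carriers by auto
    have "?W' * (?W * (?U' * ?Da)) = ?U' * ?Da"
      by (rule inverse_pair_cancel(2)[OF leval.inverse_pair_map[OF W], of _ n]) (use c in auto)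
    also have "?W * (?U' * ?Da) = X * ?Da"
      unfolding WU(3) by (rule assoc_mult_mat[symmetric, of _ m m _ m _ n]) (use c in auto)
    finally have a: "?W' * (X * ?Da) = ?U' * ?Da" .
    have "?Dc * Y * ?V' = ?Dc * (?Z' * ?V * ?V')"
      unfolding ZV(3) by (rule assoc_mult_mat[of _ m n _ n _ n]) (use c in auto)
    also have "?Z' * ?V * ?V' = ?Z'"
      by (rule inverse_pair_cancel_right(1)[OF leval.inverse_pair_map[OF V] c(4)])
    finally have "?Dc * Y * ?V' = ?Dc * ?Z'" .
    then have "?W' * (?Dc * Y * ?V') = ?W' * (?Dc * ?Z')" by simp
    moreover have "?W' * (?Dc * Y * ?V') = ?W' * (?Dc * Y) * ?V'"
      by (rule assoc_mult_mat[symmetric, of _ m m _ n _ n]) (use c ZV(3) in auto)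
    ultimately have e: "?U' * ?Da * ?V' = ?W' * (?Dc * ?Z')"
      using a unfolding key[symmetric] by simp
    have "map_mat in_t Q = ?W' * ?Dc * ?Z'"
      unfolding Q_def using carriers
      by (subst leval.mat_hom_mult[of _ m n _ n], force, force, subst leval.mat_hom_mult[of _ m m _ n])
         (auto simp: leval.map_rect_diag simp del: assoc_mult_mat)
    also have "\<dots> = ?W' * (?Dc * ?Z')"
      by (rule assoc_mult_mat[of _ m m _ n _ n]) (use c in auto)
    also have "\<dots> = ?U' * ?Da * ?V'" by (rule e[symmetric])
    also have "?Da = ?t ^ d \<cdot>\<^sub>m map_mat in_inv_t (rect_diag m n r \<alpha>)"
      by (rule eq_matI) (auto simp: rect_diag_def)
    also have "?U' * (?t ^ d \<cdot>\<^sub>m map_mat in_inv_t (rect_diag m n r \<alpha>)) = ?t ^ d \<cdot>\<^sub>m (?U' * map_mat in_inv_t (rect_diag m n r \<alpha>))"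
      by (rule mult_smult_distrib[of _ m m _ n]) (use c in auto)
    also have "\<dots> * ?V' = ?t ^ d \<cdot>\<^sub>m (?U' * map_mat in_inv_t (rect_diag m n r \<alpha>) * ?V')"
      by (rule mult_smult_assoc_mat[of _ m n _ n]) (use c in auto)
    also have "?U' * map_mat in_inv_t (rect_diag m n r \<alpha>) * ?V' = map_mat in_inv_t P"
      unfolding P_def using carriers
      by (subst leval.mat_hom_mult[of _ m n _ n], force, force, subst leval.mat_hom_mult[of _ m m _ n]) auto
    finally show ?thesis .
  qed
  have "two_charts m n r d P Q U U' V V' W W' Z Z' \<alpha> \<gamma>"
  proof
    show "U * P * V = rect_diag m n r \<alpha>" unfolding P_def by (rule conj[OF U V]) simp
    show "W * Q * Z = rect_diag m n r \<gamma>" unfolding Q_def by (rule conj[OF W Z]) simp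
  qed (use Pc Qc charts r U V W Z \<alpha> \<gamma>nz in auto)
  moreover have "degree (V $$ (i, j + r)) \<le> k j" if ij: "i < n" "j < n - r" for i j
  proof -
    have c: "map_mat in_t Z \<in> carrier_mat n n" "map_mat in_inv_t V \<in> carrier_mat n n" using carriers by auto
    have Yc: "Y \<in> carrier_mat n n" using Y1c by (auto simp: Y_def Q2_def)
    have "map_mat in_inv_t V = map_mat in_t Z * Y"
      unfolding ZV(3) by (rule inverse_pair_cancel(1)[OF leval.inverse_pair_map[OF Z] c(2), symmetric])
    then have "in_inv_t (V $$ (i, j + r)) = (map_mat in_t Z * Y) $$ (i, j + r)"
      using ij carriers by (metis (no_types, lifting) carrier_matD(1) carrier_matD(2) index_map_mat(1) less_diff_conv)
    also have "\<dots> = (\<Sum>l<n. in_t (Z $$ (i, l)) * Y $$ (l, j + r))"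
      using ij carriers Yc by (simp add: scalar_prod_def lessThan_atLeast0)
    also have "\<dots> = (\<Sum>l<n. if l = j + r then in_t (Z $$ (i, l)) * ?t powi (- int (k j)) else 0)"
      using ij by (intro sum.cong) (auto simp: Ycol)
    also have "\<dots> = in_t (Z $$ (i, j + r)) * ?t powi (- int (k j))"
      using ij by (simp add: sum.delta)
    finally have e: "in_inv_t (V $$ (i, j + r)) = in_t (Z $$ (i, j + r)) * ?t powi (- int (k j))" .
    have one: "?t powi (- int (k j)) * ?t ^ k j = 1"
      unfolding power_int_minus power_int_of_nat by (rule left_inverse) simp
    have "in_t (Z $$ (i, j + r)) = in_t (Z $$ (i, j + r)) * (?t powi (- int (k j)) * ?t ^ k j)"
      unfolding one by (rule mult_1_right[symmetric])
    also have "\<dots> = ?t ^ k j * in_inv_t (V $$ (i, j + r))"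
      unfolding e by (simp only: mult_ac)
    finally have "in_t (Z $$ (i, j + r)) = ?t ^ k j * in_inv_t (V $$ (i, j + r))" .
    then show ?thesis using in_t_eq_iff by blast
  qed
  moreover have "degree (U $$ (i + r, j)) \<le> v i" if ij: "i < m - r" "j < m" for i j
  proof -
    have c: "map_mat in_t W \<in> carrier_mat m m" "map_mat in_inv_t U \<in> carrier_mat m m" using carriers by auto
    have "map_mat in_t W = X * map_mat in_inv_t U"
      unfolding WU(3) by (rule inverse_pair_cancel_right(2)[OF leval.inverse_pair_map[OF U] c(1), symmetric])
    then have "in_t (W $$ (i + r, j)) = (X * map_mat in_inv_t U) $$ (i + r, j)"
      using ij carriers by (metis (no_types, lifting) carrier_matD(1) carrier_matD(2) index_map_mat(1) less_diff_conv)
    also have "\<dots> = (\<Sum>l<m. X $$ (i + r, l) * in_inv_t (U $$ (l, j)))"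
      using ij carriers Xc by (simp add: scalar_prod_def lessThan_atLeast0)
    also have "\<dots> = (\<Sum>l<m. if l = i + r then ?t powi (int (v i)) * in_inv_t (U $$ (l, j)) else 0)"
      using ij Xo[of "i + r"] Xd[of "i + r"] by (intro sum.cong) (auto simp: \<epsilon>_def)
    also have "\<dots> = ?t ^ v i * in_inv_t (U $$ (i + r, j))"
      using ij by (simp add: sum.delta)
    finally show ?thesis using in_t_eq_iff by blast
  qed
  ultimately show ?thesis using that unfolding \<gamma>_def by blast
qed

section \<open>Smith forms and homogeneous polynomials\<close>

lemma coeff_homogenize:
  "coeff (homogenize p) l = (if l \<le> degree p then monom (coeff p (degree p - l)) (degree p - l) else 0)"
proof -
  have "coeff (homogenize p) l = (\<Sum>i\<le>degree p. if degree p - i = l then monom (coeff p i) i else 0)"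
    unfolding homogenize_def coeff_sum by (intro sum.cong) (auto simp: coeff_monom)
  also have "\<dots> = (\<Sum>i\<le>degree p. if i = degree p - l \<and> l \<le> degree p then monom (coeff p i) i else 0)"
    by (intro sum.cong) auto
  also have "\<dots> = (if l \<le> degree p then monom (coeff p (degree p - l)) (degree p - l) else 0)"
    by (cases "l \<le> degree p") (auto simp: sum.delta)
  finally show ?thesis .
qed

lemma total_degree_eqI:
  assumes "\<And>i j. coeff (coeff f j) i \<noteq> 0 \<Longrightarrow> i + j = k" "f \<noteq> 0"
  shows "total_degree f = k"
proof -
  from \<open>f \<noteq> 0\<close> obtain j where "coeff f j \<noteq> 0" by (auto simp: poly_eq_iff)
  then obtain i where "coeff (coeff f j) i \<noteq> 0" by (auto simp: poly_eq_iff)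
  then have "(\<lambda>(i, j). i + j) ` bivar_support f = {k}"
    using assms(1) by (force simp: bivar_support_def)
  then show ?thesis by (simp add: total_degree_def)
qed

lemma homogenize_multiple:
  fixes p :: "'a::field poly"
  assumes "p \<noteq> 0"
  shows "total_degree (monom 1 e * homogenize p) = e + degree p"
    and "poly (monom 1 e * homogenize p) 0 \<noteq> 0 \<longleftrightarrow> e = 0"
proof -
  have c: "coeff (monom 1 e * homogenize p) j =
      (if e \<le> j \<and> j - e \<le> degree p then monom (coeff p (degree p - (j - e))) (degree p - (j - e)) else 0)" for j
    by (simp add: coeff_monom_mult coeff_homogenize)
  have "coeff (monom 1 e * homogenize p) e \<noteq> 0"
    unfolding c using assms by simp
  then have nz: "monom 1 e * homogenize p \<noteq> 0" by (metis coeff_0)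
  show "total_degree (monom 1 e * homogenize p) = e + degree p"
    by (rule total_degree_eqI[OF _ nz]) (auto simp: c coeff_monom split: if_splits)
  show "poly (monom 1 e * homogenize p) 0 \<noteq> 0 \<longleftrightarrow> e = 0"
    unfolding poly_0_coeff_0 c using assms by auto
qed

text \<open>A homogeneous polynomial of degree \<open>k\<close> is determined by its value at \<open>t = 1\<close>, and the value at \<open>s = 1\<close> is the
reversal of that one with respect to \<open>k\<close>. So the two dehomogenizations are the entries of the Smith
forms in the two charts.\<close>

lemma monic_homogeneous_decomposition:
  fixes \<gamma> :: "'a::field poly poly"
  assumes "monic_homogeneous \<gamma>"
  defines "k \<equiv> total_degree \<gamma>" and "\<alpha> \<equiv> poly \<gamma> 1"
  shows "\<alpha> \<noteq> 0" "degree \<alpha> \<le> k" "map_poly (\<lambda>p. poly p 1) \<gamma> = rev_poly k \<alpha>"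
    "\<gamma> = monom 1 (k - degree \<alpha>) * homogenize \<alpha>"
proof -
  show nz: "\<alpha> \<noteq> 0" using assms(1) by (auto simp: \<alpha>_def monic_homogeneous_def)
  then have \<gamma>0: "\<gamma> \<noteq> 0" by (auto simp: \<alpha>_def)
  from assms(1) obtain K where K: "\<And>i j. coeff (coeff \<gamma> j) i \<noteq> 0 \<Longrightarrow> i + j = K"
    by (auto simp: monic_homogeneous_def homogeneous_def bivar_support_def)
  have "k = K" unfolding k_def by (rule total_degree_eqI[OF K \<gamma>0])
  then have k: "coeff (coeff \<gamma> j) i = 0" if "i + j \<noteq> k" for i j using K that by blast
  have \<alpha>c: "coeff \<alpha> i = (if i \<le> k then coeff (coeff \<gamma> (k - i)) i else 0)" for i
  proof -
    have "coeff \<alpha> i = (\<Sum>j\<le>degree \<gamma>. coeff (coeff \<gamma> j) i)"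
      by (simp add: \<alpha>_def poly_altdef coeff_sum)
    also have "\<dots> = (\<Sum>j\<le>degree \<gamma>. if j = k - i \<and> i \<le> k then coeff (coeff \<gamma> j) i else 0)"
      using k by (intro sum.cong) auto
    also have "\<dots> = (if i \<le> k then coeff (coeff \<gamma> (k - i)) i else 0)"
      by (cases "i \<le> k") (auto simp: sum.delta coeff_eq_0)
    finally show ?thesis .
  qed
  show deg: "degree \<alpha> \<le> k" by (rule degree_le) (simp add: \<alpha>c)
  have ev: "poly q 1 = (\<Sum>i\<le>degree q. coeff q i)" for q :: "'a poly" by (simp add: poly_altdef)
  show "map_poly (\<lambda>p. poly p 1) \<gamma> = rev_poly k \<alpha>"
  proof (rule poly_eqI)
    fix j
    have "coeff (map_poly (\<lambda>p. poly p 1) \<gamma>) j = (\<Sum>i\<le>degree (coeff \<gamma> j). coeff (coeff \<gamma> j) i)"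
      by (simp add: coeff_map_poly ev)
    also have "\<dots> = (\<Sum>i\<le>degree (coeff \<gamma> j). if i = k - j \<and> j \<le> k then coeff (coeff \<gamma> j) i else 0)"
      using k by (intro sum.cong) auto
    also have "\<dots> = (if j \<le> k then coeff (coeff \<gamma> j) (k - j) else 0)"
      by (cases "j \<le> k") (auto simp: sum.delta coeff_eq_0)
    finally show "coeff (map_poly (\<lambda>p. poly p 1) \<gamma>) j = coeff (rev_poly k \<alpha>) j"
      by (simp add: coeff_rev_poly \<alpha>c)
  qed
  show "\<gamma> = monom 1 (k - degree \<alpha>) * homogenize \<alpha>"
  proof (rule poly_eqI, rule poly_eqI)
    fix j i
    have "coeff (coeff \<gamma> j) i = (if i + j = k then coeff \<alpha> i else 0)"
      using k[of i j] \<alpha>c[of i] by auto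
    also have "\<dots> = coeff (coeff (monom 1 (k - degree \<alpha>) * homogenize \<alpha>) j) i"
      using deg by (auto simp: coeff_monom_mult coeff_homogenize coeff_monom coeff_eq_0)
    finally show "coeff (coeff \<gamma> j) i = coeff (coeff (monom 1 (k - degree \<alpha>) * homogenize \<alpha>) j) i" .
  qed
qed

text \<open>Since \<open>0\<close> divides only \<open>0\<close>, the zeros of a divisibility chain form a final segment.\<close>

lemma filter_nonzero_chain:
  fixes xs :: "'a::idom list"
  assumes "successively (dvd) xs"
  shows "xs = filter (\<lambda>p. p \<noteq> 0) xs @ replicate (length xs - length (filter (\<lambda>p. p \<noteq> 0) xs)) 0"
  using assms
proof (induction xs)
  case (Cons x xs)
  have suc: "successively (dvd) xs" using Cons.prems by (auto simp: successively_Cons)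
  show ?case
  proof (cases "x = 0")
    case True
    have "set xs \<subseteq> {0}"
    proof -
      have "successively (dvd) ys \<Longrightarrow> ys \<noteq> [] \<Longrightarrow> hd ys = 0 \<Longrightarrow> set ys \<subseteq> {0}" for ys :: "'a list"
        by (induction ys) (force simp: successively_Cons)+
      then show ?thesis using Cons.prems True by (metis list.sel(1) list.discI list.set_intros(2) subset_code(1))
    qed
    then have "filter (\<lambda>p. p \<noteq> 0) xs = []" "xs = replicate (length xs) 0"
      by (auto simp: filter_empty_conv intro!: replicate_length_same[symmetric])
    then show ?thesis using True by simp
  next
    case False
    then show ?thesis using Cons.IH[OF suc] length_filter_le[of "\<lambda>p. p \<noteq> 0" xs] by (simp add: Suc_diff_le)
  qed
qed simp

lemma invariant_factorsD:
  fixes P :: "'a::field poly mat"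
  assumes P: "P \<in> carrier_mat m n" and inv: "invariant_factors P \<alpha>s"
  obtains U U' V V' where "inverse_pair m U U'" "inverse_pair n V V'"
    "U * P * V = rect_diag m n (length \<alpha>s) (\<lambda>i. \<alpha>s ! i)" "length \<alpha>s \<le> min m n" "successively (dvd) \<alpha>s"
    "\<And>i. i < length \<alpha>s \<Longrightarrow> \<alpha>s ! i \<noteq> 0"
proof -
  from inv obtain S where S: "smith_form P S" "\<alpha>s = filter (\<lambda>p. p \<noteq> 0) (diag_entries S)"
    by (auto simp: invariant_factors_def)
  from S(1) P obtain U V where UV: "unimod m U" "unimod n V" "S = U * P * V" "diagonal_mat S"
    "successively (dvd) (diag_entries S)"
    by (auto simp: smith_form_def unimod_def)
  have Sc: "S \<in> carrier_mat m n"
    unfolding UV(3) by (rule mult_carrier_mat[of _ m n], rule mult_carrier_mat[of _ m m]) (use UV P in auto)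
  have len: "length (diag_entries S) = min m n" using Sc by (simp add: diag_entries_def)
  obtain k where k: "diag_entries S = \<alpha>s @ replicate k 0" using filter_nonzero_chain[OF UV(5)] S(2) by metis
  have le: "length \<alpha>s \<le> min m n" using len k by (metis le_add1 length_append)
  have "S = rect_diag m n (length \<alpha>s) (\<lambda>i. \<alpha>s ! i)"
  proof (rule eq_matI)
    fix i j assume ij: "i < dim_row (rect_diag m n (length \<alpha>s) (\<lambda>i. \<alpha>s ! i))" "j < dim_col (rect_diag m n (length \<alpha>s) (\<lambda>i. \<alpha>s ! i))"
    show "S $$ (i, j) = rect_diag m n (length \<alpha>s) (\<lambda>i. \<alpha>s ! i) $$ (i, j)"
    proof (cases "i = j")
      case True
      then have i: "i < min m n" using ij by auto
      have "S $$ (i, i) = diag_entries S ! i" using i Sc by (simp add: diag_entries_def)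
      also have "\<dots> = (if i < length \<alpha>s then \<alpha>s ! i else 0)"
        using i len unfolding k by (auto simp: nth_append)
      finally show ?thesis using True ij by (simp add: rect_diag_def)
    next
      case False
      then show ?thesis using UV(4) Sc ij by (auto simp: diagonal_mat_def rect_diag_def)
    qed
  qed (use Sc in auto)
  then have "U * P * V = rect_diag m n (length \<alpha>s) (\<lambda>i. \<alpha>s ! i)" using UV(3) by simp
  moreover have "successively (dvd) \<alpha>s" using UV(5) unfolding k by (simp add: successively_append_iff)
  moreover have "\<alpha>s ! i \<noteq> 0" if "i < length \<alpha>s" for i
    using nth_mem[OF that] S(2) by auto
  ultimately show ?thesis using that UV(1,2) unimod_inverse_pair le by metis
qed

lemma invariant_factorsI:
  fixes P :: "'a::field poly mat"
  assumes P: "P \<in> carrier_mat m n" and UV: "unimod m U" "unimod n V"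
    and eq: "U * P * V = rect_diag m n (length \<alpha>s) (\<lambda>i. \<alpha>s ! i)" and le: "length \<alpha>s \<le> min m n"
    and chain: "successively (dvd) \<alpha>s" and monic: "\<And>p. p \<in> set \<alpha>s \<Longrightarrow> lead_coeff p = 1"
  shows "invariant_factors P \<alpha>s"
proof -
  define S where "S = rect_diag m n (length \<alpha>s) (\<lambda>i. \<alpha>s ! i)"
  have nz: "p \<noteq> 0" if "p \<in> set \<alpha>s" for p using monic[OF that] by auto
  have de: "diag_entries S = \<alpha>s @ replicate (min m n - length \<alpha>s) 0"
    by (rule nth_equalityI) (use le in \<open>auto simp: S_def diag_entries_def rect_diag_def nth_append\<close>)
  have "filter (\<lambda>p. p \<noteq> 0) (diag_entries S) = \<alpha>s"
    unfolding de using nz by (auto simp: filter_empty_conv filter_id_conv)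
  moreover have "successively (dvd) (diag_entries S)"
  proof -
    have "successively (dvd) (replicate k (0 :: 'a poly))" for k
    proof (induction k)
      case (Suc k)
      then show ?case by (cases k) (auto simp: successively_Cons)
    qed simp
    note zeros = this
    show ?thesis
    proof (cases "min m n - length \<alpha>s")
      case 0
      then show ?thesis unfolding de using chain by simp
    next
      case (Suc k)
      then show ?thesis unfolding de using chain zeros[of "Suc k"] by (simp add: successively_append_iff)
    qed
  qed
  moreover have "diagonal_mat S" by (auto simp: diagonal_mat_def S_def rect_diag_def)
  moreover have "\<forall>p\<in>set (diag_entries S). p \<noteq> 0 \<longrightarrow> lead_coeff p = 1"
    unfolding de using monic by auto
  moreover have "\<exists>U V. U \<in> carrier_mat (dim_row P) (dim_row P) \<and> invertible_mat U \<and>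
            V \<in> carrier_mat (dim_col P) (dim_col P) \<and> invertible_mat V \<and> S = U * P * V"
    using P UV eq by (intro exI[of _ U] exI[of _ V]) (simp add: unimod_def S_def del: assoc_mult_mat)
  ultimately have "smith_form P S"
    unfolding smith_form_def by blast
  then show ?thesis unfolding invariant_factors_def
    using \<open>filter (\<lambda>p. p \<noteq> 0) (diag_entries S) = \<alpha>s\<close> by auto
qed

text \<open>Row minimal indices are column minimal indices of the transpose, so only right kernels have to be
studied.\<close>

lemma left_kernel_eq: "left_kernel A = mat_kernel (transpose_mat A)"
proof -
  have "mat_of_row x * A = 0\<^sub>m 1 (dim_col A) \<longleftrightarrow> transpose_mat A *\<^sub>v x = 0\<^sub>v (dim_col A)"
    if x: "x \<in> carrier_vec (dim_row A)" for x
  proof -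
    have "(mat_of_row x * A) $$ (0, j) = (transpose_mat A *\<^sub>v x) $ j" if "j < dim_col A" for j
      using that x by (simp add: scalar_prod_def mult.commute)
    then show ?thesis by (auto simp: mat_eq_iff vec_eq_iff)
  qed
  then show ?thesis by (auto simp: left_kernel_def mat_kernel_def)
qed

lemma row_minimal_indices_transpose:
  "row_minimal_indices P vs \<longleftrightarrow> column_minimal_indices (transpose_mat P) vs"
  unfolding row_minimal_indices_def column_minimal_indices_def left_kernel_eq
  by (simp add: rat_mat_def map_mat_transpose)

lemma degree_le_mat_degree:
  assumes "P \<in> carrier_mat m n" "i < m" "j < n"
  shows "degree (P $$ (i, j)) \<le> mat_degree P"
proof -
  have "finite (elements_mat P)" by (simp add: elements_mat_def)
  then show ?thesis unfolding mat_degree_def using assms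
    by (intro Max_ge) (auto intro!: imageI)
qed

lemma mat_degree_attained:
  assumes "P \<in> carrier_mat m n" "m > 0" "n > 0"
  obtains i j where "i < m" "j < n" "degree (P $$ (i, j)) = mat_degree P"
proof -
  have ne: "P $$ (0, 0) \<in> elements_mat P" using assms by auto
  have "mat_degree P \<in> degree ` elements_mat P"
    unfolding mat_degree_def
  proof (rule Max_in)
    show "finite (degree ` elements_mat P)" by (simp add: elements_mat_def)
  qed (use ne in blast)
  then show ?thesis using that assms(1) by (auto simp: elements_mat_def)
qed

lemma mat_reversal_eq: "mat_reversal P = map_mat (rev_poly (mat_degree P)) P"
  by (intro eq_matI) (simp_all add: mat_reversal_def rev_poly_def Let_def)

lemma two_charts_transpose:
  assumes "two_charts m n r d P Q U U' V V' W W' Z Z' \<alpha> \<beta>"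
  shows "two_charts n m r d (transpose_mat P) (transpose_mat Q) (transpose_mat V) (transpose_mat V')
    (transpose_mat U) (transpose_mat U') (transpose_mat Z) (transpose_mat Z') (transpose_mat W) (transpose_mat W') \<alpha> \<beta>"
proof -
  interpret two_charts m n r d P Q U U' V V' W W' Z Z' \<alpha> \<beta> by fact
  have tr: "transpose_mat B * transpose_mat M * transpose_mat A = transpose_mat (A * M * B)"
    if "A \<in> carrier_mat m m" "M \<in> carrier_mat m n" "B \<in> carrier_mat n n" for A M B :: "'a poly mat"
  proof -
    have "transpose_mat (A * M * B) = transpose_mat B * transpose_mat (A * M)"
      by (rule transpose_mult[of _ m n _ n]) (use that in auto)
    also have "transpose_mat (A * M) = transpose_mat M * transpose_mat A"
      by (rule transpose_mult) (use that in auto)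
    also have "transpose_mat B * (transpose_mat M * transpose_mat A) = transpose_mat B * transpose_mat M * transpose_mat A"
      by (rule assoc_mult_mat[symmetric, of _ n n _ m _ m]) (use that in auto)
    finally show ?thesis ..
  qed
  have smult: "transpose_mat (c \<cdot>\<^sub>m M) = c \<cdot>\<^sub>m transpose_mat M" for c :: "'a fls" and M
    by (rule eq_matI) auto
  show ?thesis
  proof
    show "transpose_mat V * transpose_mat P * transpose_mat U = rect_diag n m r \<alpha>"
      using tr[of U P V] carriers by (simp add: smithP transpose_rect_diag)
    show "transpose_mat Z * transpose_mat Q * transpose_mat W = rect_diag n m r \<beta>"
      using tr[of W Q Z] carriers by (simp add: smithQ transpose_rect_diag)
    show "map_mat in_t (transpose_mat Q) = fls_X ^ d \<cdot>\<^sub>m map_mat in_inv_t (transpose_mat P)"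
      using arg_cong[OF charts, of transpose_mat] smult by (simp add: map_mat_transpose)
  qed (use carriers r U V W Z \<alpha> \<beta> inverse_pair_transpose in auto)
qed

section \<open>Necessity and sufficiency\<close>

context two_charts
begin

lemma index_sum:
  assumes "column_minimal_indices P ds" "row_minimal_indices P vs"
  shows "(\<Sum>i<r. order 0 (\<beta> i) + degree (\<alpha> i)) + sum_list ds + sum_list vs = r * d"
proof -
  interpret tr: two_charts n m r d "transpose_mat P" "transpose_mat Q" "transpose_mat V" "transpose_mat V'"
    "transpose_mat U" "transpose_mat U'" "transpose_mat Z" "transpose_mat Z'" "transpose_mat W" "transpose_mat W'" \<alpha> \<beta>
    by (rule two_charts_transpose[OF two_charts_axioms])
  have "int ((\<Sum>i<r. order 0 (\<beta> i) + degree (\<alpha> i)) + sum_list ds + sum_list vs) = int (r * d)"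
    using index_identity column_minimal_indices_sum[OF assms(1)]
      tr.column_minimal_indices_sum assms(2) by (simp add: row_minimal_indices_transpose)
  then show ?thesis by (simp only: of_nat_eq_iff)
qed

lemma kdeg_le:
  assumes "\<And>i j. i < n \<Longrightarrow> j < n - r \<Longrightarrow> degree (V $$ (i, j + r)) \<le> k j"
  shows "kdeg \<le> int (\<Sum>j<n-r. k j)"
proof -
  have V1: "last_cols r V * 1\<^sub>m (n - r) = last_cols r V"
    using carriers by (intro right_mult_one_mat[of _ n]) simp
  note c = kernel_combination[OF one_carrier_mat[of "n - r"], unfolded V1]
  have "degree (last_cols r V $$ (i, j)) \<le> k j" if "i < n" "j < n - r" for i j
    using assms[OF that] that carriers by (simp add: last_cols_def)
  then show ?thesis using kernel_degree_formula(3)[OF c(1,2), of k] c(3) by simp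
qed

text \<open>The lower bounds for the two sums of degrees add up to the sum of the prescribed indices, so neither
bound can be strict.\<close>

lemma minimal_indicesI:
  assumes V: "\<And>i j. i < n \<Longrightarrow> j < n - r \<Longrightarrow> degree (V $$ (i, j + r)) \<le> ds ! j"
    and U: "\<And>i j. i < m - r \<Longrightarrow> j < m \<Longrightarrow> degree (U $$ (i + r, j)) \<le> vs ! i"
    and ds: "length ds = n - r" "sorted_wrt (\<ge>) ds" and vs: "length vs = m - r" "sorted_wrt (\<ge>) vs"
    and sum: "(\<Sum>i<r. order 0 (\<beta> i) + degree (\<alpha> i)) + sum_list ds + sum_list vs = r * d"
  shows "column_minimal_indices P ds" "row_minimal_indices P vs"
proof -
  interpret tr: two_charts n m r d "transpose_mat P" "transpose_mat Q" "transpose_mat V" "transpose_mat V'"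
    "transpose_mat U" "transpose_mat U'" "transpose_mat Z" "transpose_mat Z'" "transpose_mat W" "transpose_mat W'" \<alpha> \<beta>
    by (rule two_charts_transpose[OF two_charts_axioms])
  have U': "degree (transpose_mat U $$ (j, i + r)) \<le> vs ! i" if "j < m" "i < m - r" for i j
    using U[OF that(2,1)] that carriers by simp
  have s: "sum_list ds = (\<Sum>j<n-r. ds ! j)" "sum_list vs = (\<Sum>j<m-r. vs ! j)"
    using ds(1) vs(1) by (simp_all add: sum_list_sum_nth lessThan_atLeast0)
  have le: "kdeg \<le> int (sum_list ds)" "tr.kdeg \<le> int (sum_list vs)"
    unfolding s using kdeg_le[OF V] tr.kdeg_le[OF U'] by blast+
  have "int ((\<Sum>i<r. order 0 (\<beta> i) + degree (\<alpha> i)) + sum_list ds + sum_list vs) = int (r * d)"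
    using sum by simp
  then have eq: "int (sum_list ds) = kdeg" "int (sum_list vs) = tr.kdeg"
    using le index_identity by simp_all
  have one: "last_cols r V * 1\<^sub>m (n - r) = last_cols r V"
    "last_cols r (transpose_mat U) * 1\<^sub>m (m - r) = last_cols r (transpose_mat U)"
    using carriers right_mult_one_mat[of "last_cols r V" n "n - r"]
      right_mult_one_mat[of "last_cols r (transpose_mat U)" m "m - r"] by simp_all
  show "column_minimal_indices P ds"
    by (rule column_minimal_indicesI[of "1\<^sub>m (n - r)", unfolded one])
       (use ds eq V carriers in \<open>auto simp: last_cols_def\<close>)
  have "column_minimal_indices (transpose_mat P) vs"
    by (rule tr.column_minimal_indicesI[of "1\<^sub>m (m - r)", unfolded one])
       (use vs eq U' carriers in \<open>auto simp: last_cols_def\<close>)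
  then show "row_minimal_indices P vs" by (simp add: row_minimal_indices_transpose)
qed

text \<open>If \<open>t\<close> does not divide the first invariant factor of \<open>Q\<close>, then \<open>Q(0)\<close>, the coefficient of \<open>s^d\<close>
in \<open>P\<close>, is nonzero.\<close>

lemma mat_degree_eq:
  assumes "r > 0" "order 0 (\<beta> 0) = 0"
  shows "mat_degree P = d" "mat_reversal P = Q"
proof -
  have "poly (\<beta> 0) 0 \<noteq> 0" using assms \<beta>[of 0] by (simp add: order_root)
  then have "\<not> [:0, 1:] dvd \<beta> 0" using dvd_iff_poly_eq_0[of 0 "\<beta> 0"] by simp
  then obtain i j where ij: "i < m" "j < n" "\<not> [:0, 1:] dvd Q $$ (i, j)"
    using reversal_vanishes_iff assms(1) by blast
  then have "poly (Q $$ (i, j)) 0 \<noteq> 0" using dvd_iff_poly_eq_0[of 0 "Q $$ (i, j)"] by simp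
  then have "coeff (P $$ (i, j)) d \<noteq> 0"
    using reversal_entries[OF ij(1,2)] by (simp add: poly_0_coeff_0 coeff_rev_poly)
  then have "d \<le> mat_degree P"
    using le_degree degree_le_mat_degree[OF P ij(1,2)] by (metis order_trans)
  moreover have "mat_degree P \<le> d"
    using mat_degree_attained[OF P] ij degree_entries_le by (metis not_gr_zero not_less_zero)
  ultimately show deg: "mat_degree P = d" by simp
  show "mat_reversal P = Q"
    unfolding mat_reversal_eq deg using P Q reversal_entries by (intro eq_matI) auto
qed

end

lemma distribute_sum:
  fixes f :: "nat \<Rightarrow> nat"
  assumes "B \<le> (\<Sum>i<r. f i)"
  shows "\<exists>b. (\<forall>i. b i \<le> f i) \<and> (\<Sum>i<r. b i) = B"
  using assms
proof (induction r arbitrary: B)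
  case 0
  then show ?case by (intro exI[of _ "\<lambda>_. 0"]) simp
next
  case (Suc r)
  have "B - min B (f r) \<le> (\<Sum>i<r. f i)" using Suc.prems by (simp add: min_def) arith
  from Suc.IH[OF this] obtain b where b: "\<forall>i. b i \<le> f i" "(\<Sum>i<r. b i) = B - min B (f r)" by blast
  have "(\<Sum>i<r. (b(r := min B (f r))) i) = (\<Sum>i<r. b i)" by (intro sum.cong) auto
  then show ?case using b by (intro exI[of _ "b(r := min B (f r))"]) auto
qed

lemma dvd_map_poly_eval:
  fixes p q :: "'a::field poly poly"
  assumes "p dvd q"
  shows "map_poly (\<lambda>f. poly f 1) p dvd map_poly (\<lambda>f. poly f 1) q"
proof -
  have "comm_ring_hom (\<lambda>f::'a poly. poly f 1)" by unfold_locales auto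
  then interpret m: map_poly_comm_ring_hom "\<lambda>f::'a poly. poly f 1" by (rule map_poly_comm_ring_hom.intro)
  from assms obtain c where "q = p * c" by (elim dvdE)
  then show ?thesis by (simp add: m.hom_mult)
qed

text \<open>The degree condition is the index identity. The other condition says that the first partial multiplicity
of infinity is \<open>0\<close>: otherwise \<open>t\<close> would divide all of the reversal, and the leading coefficient
matrix would vanish.\<close>

lemma prescribed_necessary:
  fixes P :: "'a::field poly mat"
  assumes mnr: "m > 0" "n > 0" "r > 0" and P: "P \<in> carrier_mat m n" and len: "length \<gamma>s = r"
    and hom: "homogeneous_invariant_factors P \<gamma>s"
    and col: "column_minimal_indices P ds" and row: "row_minimal_indices P vs"
  shows "poly (\<gamma>s ! 0) 0 \<noteq> 0"
    "(\<Sum>\<gamma>\<leftarrow>\<gamma>s. total_degree \<gamma>) + sum_list ds + sum_list vs = r * mat_degree P"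
proof -
  define Q where "Q = mat_reversal P"
  have Qc: "Q \<in> carrier_mat m n" using P by (simp add: Q_def mat_reversal_eq)
  from hom obtain \<alpha>s es \<beta>s where inv: "invariant_factors P \<alpha>s" "invariant_factors Q \<beta>s"
    and es: "es = map (order 0) \<beta>s" "length es = length \<alpha>s"
    and \<gamma>s: "\<gamma>s = map2 (\<lambda>\<alpha> e. monom 1 e * homogenize \<alpha>) \<alpha>s es"
    by (auto simp: homogeneous_invariant_factors_def partial_multiplicities_infinity_def Q_def)
  have lens: "length \<alpha>s = r" "length \<beta>s = r" using es len unfolding \<gamma>s by auto
  obtain U U' V V' where 1: "inverse_pair m U U'" "inverse_pair n V V'"
    "U * P * V = rect_diag m n r (\<lambda>i. \<alpha>s ! i)" "r \<le> min m n" "\<And>i. i < r \<Longrightarrow> \<alpha>s ! i \<noteq> 0"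
    using invariant_factorsD[OF P inv(1)] unfolding lens by metis
  obtain W W' Z Z' where 2: "inverse_pair m W W'" "inverse_pair n Z Z'"
    "W * Q * Z = rect_diag m n r (\<lambda>i. \<beta>s ! i)" "successively (dvd) \<beta>s" "\<And>i. i < r \<Longrightarrow> \<beta>s ! i \<noteq> 0"
    using invariant_factorsD[OF Qc inv(2)] unfolding lens by metis
  have charts: "map_mat in_t Q = fls_X ^ mat_degree P \<cdot>\<^sub>m map_mat in_inv_t P"
  proof (rule eq_matI)
    fix i j assume "i < dim_row (fls_X ^ mat_degree P \<cdot>\<^sub>m map_mat in_inv_t P)"
      "j < dim_col (fls_X ^ mat_degree P \<cdot>\<^sub>m map_mat in_inv_t P)"
    then have ij: "i < m" "j < n" using P by auto
    have "in_t (rev_poly (mat_degree P) (P $$ (i, j))) = fls_X ^ mat_degree P * in_inv_t (P $$ (i, j))"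
      using degree_le_mat_degree[OF P ij] by (subst in_t_eq_iff) simp
    then show "map_mat in_t Q $$ (i, j) = (fls_X ^ mat_degree P \<cdot>\<^sub>m map_mat in_inv_t P) $$ (i, j)"
      using ij P by (simp add: Q_def mat_reversal_eq)
  qed (use P Qc in auto)
  interpret two_charts m n r "mat_degree P" P Q U U' V V' W W' Z Z' "\<lambda>i. \<alpha>s ! i" "\<lambda>i. \<beta>s ! i"
    by unfold_locales (use P Qc charts 1 2 in auto)
  have nth: "\<gamma>s ! i = monom 1 (order 0 (\<beta>s ! i)) * homogenize (\<alpha>s ! i)" if "i < r" for i
    using that lens es unfolding \<gamma>s by simp
  have "(\<Sum>\<gamma>\<leftarrow>\<gamma>s. total_degree \<gamma>) = (\<Sum>i<r. total_degree (\<gamma>s ! i))"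
    using len by (simp add: sum_list_sum_nth lessThan_atLeast0)
  also have "\<dots> = (\<Sum>i<r. order 0 (\<beta>s ! i) + degree (\<alpha>s ! i))"
    using nth 1(5) by (intro sum.cong) (simp_all add: homogenize_multiple)
  finally show "(\<Sum>\<gamma>\<leftarrow>\<gamma>s. total_degree \<gamma>) + sum_list ds + sum_list vs = r * mat_degree P"
    using index_sum[OF col row] by simp
  have "order 0 (\<beta>s ! 0) = 0"
  proof (rule ccontr)
    assume "order 0 (\<beta>s ! 0) \<noteq> 0"
    then have "poly (\<beta>s ! 0) 0 = 0" by (simp add: order_root)
    then have d0: "[:0, 1:] dvd \<beta>s ! 0" using dvd_iff_poly_eq_0[of 0 "\<beta>s ! 0"] by simp
    have "sorted_wrt (dvd) \<beta>s"
      using 2(4) by (subst (asm) successively_conv_sorted_wrt) (auto intro: dvd_trans simp: transp_def)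
    then have "\<beta>s ! 0 dvd \<beta>s ! i" if "i < r" for i
      using that lens sorted_wrt_nth_less[of "(dvd)" \<beta>s 0 i] by (cases "i = 0") auto
    then have "\<forall>i<r. [:0, 1:] dvd \<beta>s ! i" using d0 dvd_trans by blast
    then have van: "[:0, 1:] dvd Q $$ (i, j)" if "i < m" "j < n" for i j
      using reversal_vanishes_iff that by blast
    have c0: "coeff (P $$ (i, j)) (mat_degree P) = 0" if ij: "i < m" "j < n" for i j
    proof -
      have "poly (Q $$ (i, j)) 0 = 0" using van[OF ij] dvd_iff_poly_eq_0[of 0 "Q $$ (i, j)"] by simp
      then show ?thesis using reversal_entries[OF ij] by (simp add: poly_0_coeff_0 coeff_rev_poly)
    qed
    obtain i j where ij: "i < m" "j < n" "degree (P $$ (i, j)) = mat_degree P"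
      using mat_degree_attained[OF P mnr(1,2)] by metis
    then have "P $$ (i, j) = 0" using c0[OF ij(1,2)] by (metis leading_coeff_0_iff)
    then have deg0: "mat_degree P = 0" using ij(3) by simp
    have P0: "0 dvd P $$ (i, j)" if "i < m" "j < n" for i j
      using c0[OF that] degree_le_mat_degree[OF P that] deg0 by (metis dvd_refl le_zero_eq leading_coeff_0_iff)
    have "0 dvd (U * P * V) $$ (0, 0)"
      by (rule dvd_mult_entries[of _ m m _ n _ n]) (use carriers P0 mnr in auto)
    then show False unfolding smithP using \<alpha>[of 0] mnr by (simp add: rect_diag_def)
  qed
  then show "poly (\<gamma>s ! 0) 0 \<noteq> 0"
    using nth[OF mnr(3)] homogenize_multiple(2)[OF 1(5)[OF mnr(3)], of "order 0 (\<beta>s ! 0)"] by simp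
qed

text \<open>The degree condition gives room to choose \<open>b\<close>: the sum of \<open>d - g i\<close> over all \<open>i\<close> is the sum of all minimal
indices, and omitting the negative summands only increases it.\<close>

lemma prescribed_sufficient:
  fixes \<gamma>s :: "'a::field poly poly list"
  assumes mnr: "m > 0" "n > 0" "r > 0" "r \<le> min m n" and len: "length \<gamma>s = r"
    and monic: "\<forall>\<gamma> \<in> set \<gamma>s. monic_homogeneous \<gamma>" and chain: "successively (dvd) \<gamma>s"
    and ds: "length ds = n - r" "sorted_wrt (\<ge>) ds" and vs: "length vs = m - r" "sorted_wrt (\<ge>) vs"
    and g1: "poly (\<gamma>s ! 0) 0 \<noteq> 0"
    and sum: "(\<Sum>\<gamma>\<leftarrow>\<gamma>s. total_degree \<gamma>) + sum_list ds + sum_list vs = r * d"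
  shows "\<exists>P. P \<in> carrier_mat m n \<and> poly_rank P = r \<and> mat_degree P = d \<and>
            homogeneous_invariant_factors P \<gamma>s \<and>
            column_minimal_indices P ds \<and> row_minimal_indices P vs"
proof -
  define g where "g i = total_degree (\<gamma>s ! i)" for i
  define \<alpha> where "\<alpha> i = poly (\<gamma>s ! i) 1" for i
  define \<rho> where "\<rho> i = map_poly (\<lambda>p. poly p 1) (\<gamma>s ! i)" for i
  have mon: "monic_homogeneous (\<gamma>s ! i)" if "i < r" for i using monic len that by simp
  have dec: "\<alpha> i \<noteq> 0" "degree (\<alpha> i) \<le> g i" "\<rho> i = rev_poly (g i) (\<alpha> i)"
    "\<gamma>s ! i = monom 1 (g i - degree (\<alpha> i)) * homogenize (\<alpha> i)" if "i < r" for i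
    using monic_homogeneous_decomposition[OF mon[OF that]] by (simp_all add: g_def \<alpha>_def \<rho>_def)
  have ord: "\<rho> i \<noteq> 0" "order 0 (\<rho> i) = g i - degree (\<alpha> i)" if "i < r" for i
    using order_0_rev_poly[OF dec(1,2)[OF that]] dec(3)[OF that] by simp_all
  have "sorted_wrt (dvd) \<gamma>s"
    using chain by (subst (asm) successively_conv_sorted_wrt) (auto intro: dvd_trans simp: transp_def)
  then have dvd: "\<gamma>s ! i dvd \<gamma>s ! j" if "i \<le> j" "j < r" for i j
    using that len sorted_wrt_nth_less[of "(dvd)" \<gamma>s i j] by (cases "i = j") auto
  have dvd\<rho>: "\<rho> i dvd \<rho> j" if "i \<le> j" "j < r" for i j
    unfolding \<rho>_def by (rule dvd_map_poly_eval[OF dvd[OF that]])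
  have dvd\<alpha>: "\<alpha> i dvd \<alpha> j" if "i \<le> j" "j < r" for i j
    using dvd[OF that] by (auto simp: \<alpha>_def elim!: dvdE)
  have mono: "g i \<le> g j" if "i \<le> j" "j < r" for i j
  proof -
    have "degree (\<alpha> i) \<le> degree (\<alpha> j)" using dvd_imp_degree_le[OF dvd\<alpha>[OF that]] dec(1) that by simp
    moreover have "order 0 (\<rho> i) \<le> order 0 (\<rho> j)" using dvd_imp_order_le[OF ord(1) dvd\<rho>] that by simp
    ultimately show ?thesis using ord(2)[of i] ord(2)[of j] dec(2)[of i] dec(2)[of j] that by simp
  qed
  have g\<Sigma>: "(\<Sum>\<gamma>\<leftarrow>\<gamma>s. total_degree \<gamma>) = (\<Sum>i<r. g i)"
    using len by (simp add: sum_list_sum_nth lessThan_atLeast0 g_def)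
  have s: "sum_list ds = (\<Sum>j<n-r. ds ! j)" "sum_list vs = (\<Sum>j<m-r. vs ! j)"
    using ds(1) vs(1) by (simp_all add: sum_list_sum_nth lessThan_atLeast0)
  have "r * d = (\<Sum>i<r. d)" by simp
  also have "\<dots> \<le> (\<Sum>i<r. (d - g i) + g i)" by (intro sum_mono) auto
  also have "\<dots> = (\<Sum>i<r. d - g i) + (\<Sum>i<r. g i)" by (rule sum.distrib)
  finally have "sum_list ds \<le> (\<Sum>i<r. d - g i)" using sum g\<Sigma> by simp
  then obtain b where b: "\<forall>i. b i \<le> d - g i" "(\<Sum>i<r. b i) = sum_list ds"
    using distribute_sum by metis
  have b': "g i + b i \<le> d" if "b i \<noteq> 0" for i using b(1)[rule_format, of i] that by simp
  have chain\<rho>: "rev_poly (g i) (\<alpha> i) dvd rev_poly (g j) (\<alpha> j)" if "i < r" "j < r" "g i < g j" for i j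
  proof -
    have "i \<le> j" using mono[of j i] that by (metis not_le le_cases)
    then show ?thesis using dvd\<rho>[of i j] dec(3) that by simp
  qed
  obtain P Q U U' V V' W W' Z Z' where
    tc: "two_charts m n r d P Q U U' V V' W W' Z Z' \<alpha> (\<lambda>i. rev_poly (g i) (\<alpha> i))"
    and degV: "\<And>i j. i < n \<Longrightarrow> j < n - r \<Longrightarrow> degree (V $$ (i, j + r)) \<le> ds ! j"
    and degU: "\<And>i j. i < m - r \<Longrightarrow> j < m \<Longrightarrow> degree (U $$ (i + r, j)) \<le> vs ! i"
    by (rule gluing_construction[of r m n \<alpha> g b d "\<lambda>j. ds ! j" "\<lambda>j. vs ! j"])
       (use mnr dec chain\<rho> b b' sum g\<Sigma> s in \<open>auto\<close>)
  interpret two_charts m n r d P Q U U' V V' W W' Z Z' \<alpha> "\<lambda>i. rev_poly (g i) (\<alpha> i)" by (rule tc)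
  have ordrev: "order 0 (rev_poly (g i) (\<alpha> i)) = g i - degree (\<alpha> i)" if "i < r" for i
    using ord(2)[OF that] dec(3)[OF that] by simp
  have "order 0 (rev_poly (g 0) (\<alpha> 0)) = 0"
    using g1 dec(4)[OF mnr(3)] homogenize_multiple(2)[OF dec(1)[OF mnr(3)], of "g 0 - degree (\<alpha> 0)"]
      ordrev[OF mnr(3)] by simp
  then have deg: "mat_degree P = d" "mat_reversal P = Q" using mat_degree_eq mnr by auto
  have "(\<Sum>i<r. order 0 (rev_poly (g i) (\<alpha> i)) + degree (\<alpha> i)) = (\<Sum>i<r. g i)"
    using ordrev dec(2) by (intro sum.cong) auto
  then have min: "column_minimal_indices P ds" "row_minimal_indices P vs"
    using minimal_indicesI[OF degV degU ds vs] sum g\<Sigma> by simp_all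
  define \<alpha>s where "\<alpha>s = map (\<lambda>\<gamma>. poly \<gamma> 1) \<gamma>s"
  define c where "c i = inverse (lead_coeff (\<rho> i))" for i
  have c: "c i \<noteq> 0" if "i < r" for i using ord(1)[OF that] by (simp add: c_def)
  define \<beta>s where "\<beta>s = map (\<lambda>i. smult (c i) (\<rho> i)) [0..<r]"
  have lens: "length \<alpha>s = r" "length \<beta>s = r" by (simp_all add: \<alpha>s_def \<beta>s_def len)
  have nth: "\<alpha>s ! i = \<alpha> i" "\<beta>s ! i = smult (c i) (\<rho> i)" if "i < r" for i
    using that len by (simp_all add: \<alpha>s_def \<beta>s_def \<alpha>_def)
  have succ: "successively (dvd) xs" if "\<And>i j. i \<le> j \<Longrightarrow> j < length xs \<Longrightarrow> xs ! i dvd xs ! j" for xs :: "'a poly list"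
  proof -
    have "sorted_wrt (dvd) xs" using that by (simp add: sorted_wrt_iff_nth_less)
    then show ?thesis by (subst successively_conv_sorted_wrt) (auto intro: dvd_trans simp: transp_def)
  qed
  have "invariant_factors P \<alpha>s"
  proof (rule invariant_factorsI[OF P inverse_pair_unimod(1)[OF U] inverse_pair_unimod(1)[OF V]])
    show "U * P * V = rect_diag m n (length \<alpha>s) (\<lambda>i. \<alpha>s ! i)"
      unfolding smithP lens by (rule eq_matI) (auto simp: rect_diag_def nth)
    show "successively (dvd) \<alpha>s" by (rule succ) (use dvd\<alpha> nth lens in auto)
    show "lead_coeff p = 1" if "p \<in> set \<alpha>s" for p
      using that monic by (auto simp: \<alpha>s_def monic_homogeneous_def)
  qed (use lens mnr in simp)
  moreover have "invariant_factors Q \<beta>s"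
  proof (rule invariant_factorsI[OF Q inverse_pair_unimod(1)[OF W]])
    \<comment> \<open>Scaling by constants makes the diagonal entries monic.\<close>
    define E where "E = rect_diag n n n (\<lambda>i. if i < r then [:c i:] else 1)"
    have "inverse_pair n E (rect_diag n n n (\<lambda>i. if i < r then [:inverse (c i):] else 1))"
      unfolding inverse_pair_def E_def
      by (auto simp: rect_diag_mult_rect_diag c intro!: eq_matI) (auto simp: rect_diag_def c one_pCons)
    then show "unimod n (Z * E)"
      using unimod_mult inverse_pair_unimod(1) Z by blast
    have Ec: "E \<in> carrier_mat n n" by (simp add: E_def)
    have "W * Q * (Z * E) = W * Q * Z * E"
      by (rule assoc_mult_mat[symmetric, of _ m n _ n _ n]) (use carriers Ec in auto)
    also have "\<dots> = rect_diag m n (length \<beta>s) (\<lambda>i. \<beta>s ! i)"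
      unfolding smithQ lens
    proof (rule eq_matI)
      fix i j assume ij: "i < dim_row (rect_diag m n r (\<lambda>i. \<beta>s ! i))" "j < dim_col (rect_diag m n r (\<lambda>i. \<beta>s ! i))"
      then show "(rect_diag m n r (\<lambda>i. rev_poly (g i) (\<alpha> i)) * E) $$ (i, j) = rect_diag m n r (\<lambda>i. \<beta>s ! i) $$ (i, j)"
        using mnr(4) by (subst index_rect_diag_mult[OF Ec]) (auto simp: rect_diag_def E_def nth dec(3))
    qed (use Ec in auto)
    finally show "W * Q * (Z * E) = rect_diag m n (length \<beta>s) (\<lambda>i. \<beta>s ! i)" .
    show "successively (dvd) \<beta>s"
      by (rule succ) (use dvd\<rho> nth lens c in \<open>auto simp: smult_dvd_iff intro: dvd_smult\<close>)
    show "lead_coeff p = 1" if "p \<in> set \<beta>s" for p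
      using that ord(1) by (auto simp: \<beta>s_def c_def)
  qed (use lens mnr in simp)
  moreover have "\<gamma>s = map2 (\<lambda>\<alpha> e. monom 1 e * homogenize \<alpha>) \<alpha>s (map (order 0) \<beta>s)"
    by (rule nth_equalityI) (use lens len nth c ord dec(4) in \<open>auto simp: order_smult\<close>)
  ultimately have "homogeneous_invariant_factors P \<gamma>s"
    unfolding homogeneous_invariant_factors_def partial_multiplicities_infinity_def deg(2)
    using lens by (metis length_map)
  then show ?thesis using P poly_rank_eq deg min by blast
qed

theorem theorem3p1:
  fixes m n r d :: nat
    and \<gamma>s :: "'a::field poly poly list"
    and ds vs :: "nat list"
  assumes "m > 0" and "n > 0" and "r > 0" and "r \<le> min m n"
    and "length \<gamma>s = r"
    and "\<forall>\<gamma> \<in> set \<gamma>s. monic_homogeneous \<gamma>"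
    and "successively (dvd) \<gamma>s"
    and "length ds = n - r" and "sorted_wrt (\<ge>) ds"
    and "length vs = m - r" and "sorted_wrt (\<ge>) vs"
  shows "(\<exists>P :: 'a poly mat. P \<in> carrier_mat m n \<and> poly_rank P = r \<and> mat_degree P = d \<and>
            homogeneous_invariant_factors P \<gamma>s \<and>
            column_minimal_indices P ds \<and> row_minimal_indices P vs)
    \<longleftrightarrow>
         (poly (\<gamma>s ! 0) 0 \<noteq> 0 \<and>
          (\<Sum>\<gamma>\<leftarrow>\<gamma>s. total_degree \<gamma>) + sum_list ds + sum_list vs = r * d)"
  using prescribed_necessary[OF assms(1-3) _ assms(5)] prescribed_sufficient[OF assms] by blast

end
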